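(* Consider the model $y_i=x_i\beta+u_i$, $x_i=Z_{i.}'\pi+v_i$, $i=1,\dots,n$, with scalar dependent variable $y_i$, scalar endogenous regressor $x_i$ and a vector $Z_{i.}$ of $L$ instruments ($L$ fixed as $n$ grows), where $x_i$ is missing for $n_1$ of the $n$ observations. Assume: (1) $\operatorname{plim}(Z'u/n)=E[Z_{i.}u_i]=0$ and $\operatorname{plim}(Z'v/n)=E[Z_{i.}v_i]=0$; (2) $\operatorname{plim}(Z'x/n)=E[Z_{i.}x_i]=Q_{Zx}\neq 0$; (3) $\operatorname{plim}(Z'Z/n)=E[Z_{i.}Z_{i.}']=Q_{ZZ}$, with $Q_{ZZ}$ a finite and full rank matrix; (4) observations are identically and independently distributed; (5) $\widehat p=n_1/n\to p<1$ as $n\to\infty$; (6) the missing structure is ignorable, i.e. the data are either missing completely at random or missing at random; (7) $E[y_i^4]$, $E[\widetilde x_i^4]$ and $E[\Vert Z_{i.}\Vert^4]$ are finite. (Homoskedasticity is not assumed.) Let $\widehat\beta_{RI}=(\widetilde x'P_Z\widetilde x)^{-1}\widetilde x'P_Zy$ be the two-stage least squares estimator with regression imputation. Then, as $n\to\infty$, $$\sqrt n(\widehat\beta_{RI}-\beta)\xrightarrow{d}N(0,V_{\widehat\beta_{RI}}),$$ with $$V_{\widehat\beta_{RI}}=\left(Q_{xZ}Q_{ZZ}^{-1}Q_{Zx}\right)^{-1}Q_{xZ}Q_{ZZ}^{-1}\,\Omega\,Q_{ZZ}^{-1}Q_{Zx}\left(Q_{xZ}Q_{ZZ}^{-1}Q_{Zx}\right)^{-1},$$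 where $$\begin{aligned}\Omega=&\,E[u_i^2Z_{i.}Z_{i.}']-2p\,E[u_{0i}v_{0i}Z_{0i.}Z_{0i.}']Q_{Z_0Z_0}^{-1}Q_{Z_1Z_1}\beta\\&+\frac{p^2}{1-p}Q_{Z_1Z_1}Q_{Z_0Z_0}^{-1}E[v_{0i}^2Z_{0i.}Z_{0i.}']Q_{Z_0Z_0}^{-1}Q_{Z_1Z_1}\beta^2\\&+2p\,E[u_{1i}v_{1i}Z_{1i.}Z_{1i.}']\beta+p\,E[v_{1i}^2Z_{1i.}Z_{1i.}']\beta^2.\end{aligned}$$
   Context: Notation: $y,x,u,v$ are the $n$-vectors of the $y_i,x_i,u_i,v_i$, and $Z$ is the $n\times L$ matrix with rows $Z_{i.}'$. $P_Z=Z(Z'Z)^{-1}Z'$ and $Q_{xZ}=Q_{Zx}'$. Complete and incomplete observations: only $x_i$ can be missing; $y_i$ and $Z_{i.}$ are observed for all $i$. Without loss of generality the first $n_0=n-n_1$ observations are complete ($x_i$ observed) and the remaining $n_1$ are incomplete ($x_i$ missing). A subscript $0$ denotes the complete observations and a subscript $1$ the incomplete ones, so $y_0,x_0,Z_0,u_0,v_0$ are the first $n_0$ rows and $y_1,x_1,Z_1,u_1,v_1$ the last $n_1$ rows of the respective vectors and matrix. Likewise $u_{ji},v_{ji},Z_{ji.}$ with $j\in\{0,1\}$ denote the variables of a complete ($j=0$) or incomplete ($j=1$) observation, expectations with subscript $j$ are taken for such an observation, and $Q_{Z_jZ_j}$ is the probability limit of $Z_j'Z_j/n_j$. Missing at random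 means that the missing structure depends only on observables. Regression imputation: $\widehat\pi_{CC}=(Z_0'Z_0)^{-1}Z_0'x_0$ is the first-stage estimate from the complete observations. The imputed regressor $\widetilde x$ has entries $\widetilde x_i=x_i$ for complete observations and $\widetilde x_i=Z_{i.}'\widehat\pi_{CC}$ for incomplete observations.
   Formalization: In the missing-at-random case it is additionally assumed that E[Z_{0i.}v_{0i}]=0 for complete observations, that E[u_i^2 Z_{i.}Z_{i.}'] exists and that Q_{Z_0Z_0} is invertible; without the first, the estimator can be inconsistent (e.g. Z=1, missingness depending on y). *)

theory Defs
  imports "HOL-Probability.Probability"
begin

definition conv_in_prob ::
    "'a measure \<Rightarrow> (nat \<Rightarrow> 'a \<Rightarrow> 'b::metric_space) \<Rightarrow> 'b \<Rightarrow> bool" where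
  "conv_in_prob M X c \<longleftrightarrow>
     (\<forall>\<epsilon>>0. (\<lambda>n. measure M {\<omega> \<in> space M. dist (X n \<omega>) c > \<epsilon>}) \<longlonglongrightarrow> 0)"

text \<open>Law of \<open>\<mu> + \<sigma> G\<close> with \<open>G\<close> standard normal and \<open>\<sigma>\<^sup>2\<close> the given variance.  Unlike a density-based
  definition this also covers variance \<open>0\<close>, where it is the point mass at \<open>\<mu>\<close>.\<close>

definition normal_law :: "real \<Rightarrow> real \<Rightarrow> real measure" where
  "normal_law \<mu> var = distr std_normal_distribution borel (\<lambda>g. \<mu> + sqrt var * g)"

text \<open>Elementary conditional expectation \<open>E[f | A]\<close>; it is \<open>0\<close> if \<open>A\<close> is a null set.\<close>

definition expectation_on ::
    "'a measure \<Rightarrow> 'a set \<Rightarrow> ('a \<Rightarrow> 'b) \<Rightarrow> 'b::{banach, second_countable_topology}" where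
  "expectation_on M A f = integral\<^sup>L (uniform_measure M A) f"

text \<open>A realized sample of size \<open>n\<close> is given by sequences \<open>y\<close>, \<open>x\<close>, \<open>z\<close>, \<open>m\<close> restricted to the
  indices \<open>i < n\<close>, where \<open>m i\<close> says that \<open>x i\<close> is missing.  Instead of sorting the observations,
  the complete and the incomplete ones are kept as index sets.\<close>

definition complete_obs :: "nat \<Rightarrow> (nat \<Rightarrow> bool) \<Rightarrow> nat set" where
  "complete_obs n m = {i. i < n \<and> \<not> m i}"

definition incomplete_obs :: "nat \<Rightarrow> (nat \<Rightarrow> bool) \<Rightarrow> nat set" where
  "incomplete_obs n m = {i. i < n \<and> m i}"

definition outer :: "real^'L \<Rightarrow> real^'L \<Rightarrow> real^'L^'L" where
  "outer a b = (\<chi> r c. a $ r * b $ c)"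

text \<open>With \<open>S\<close> the set of rows used, \<open>gram S z\<close> is \<open>Z'Z\<close> and \<open>cross S z w\<close> is \<open>Z'w\<close>.\<close>

definition gram :: "nat set \<Rightarrow> (nat \<Rightarrow> real^'L) \<Rightarrow> real^'L^'L" where
  "gram S z = (\<Sum>i\<in>S. outer (z i) (z i))"

definition cross :: "nat set \<Rightarrow> (nat \<Rightarrow> real^'L) \<Rightarrow> (nat \<Rightarrow> real) \<Rightarrow> real^'L" where
  "cross S z w = (\<Sum>i\<in>S. w i *\<^sub>R z i)"

definition pi_CC ::
    "nat \<Rightarrow> (nat \<Rightarrow> real) \<Rightarrow> (nat \<Rightarrow> real^'L) \<Rightarrow> (nat \<Rightarrow> bool) \<Rightarrow> real^'L" where
  "pi_CC n x z m =
     matrix_inv (gram (complete_obs n m) z) *v cross (complete_obs n m) z x"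

definition imputed ::
    "nat \<Rightarrow> (nat \<Rightarrow> real) \<Rightarrow> (nat \<Rightarrow> real^'L) \<Rightarrow> (nat \<Rightarrow> bool) \<Rightarrow> nat \<Rightarrow> real" where
  "imputed n x z m i = (if m i then z i \<bullet> pi_CC n x z m else x i)"

text \<open>Entry \<open>(i, j)\<close> of the \<open>n \<times> n\<close> matrix \<open>P\<^sub>Z\<close>, and the bilinear form \<open>a'P\<^sub>Zb\<close>.\<close>

definition proj_Z :: "nat \<Rightarrow> (nat \<Rightarrow> real^'L) \<Rightarrow> nat \<Rightarrow> nat \<Rightarrow> real" where
  "proj_Z n z i j = z i \<bullet> (matrix_inv (gram {..<n} z) *v z j)"

definition proj_form ::
    "nat \<Rightarrow> (nat \<Rightarrow> real^'L) \<Rightarrow> (nat \<Rightarrow> real) \<Rightarrow> (nat \<Rightarrow> real) \<Rightarrow> real" where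
  "proj_form n z a b = (\<Sum>i<n. \<Sum>j<n. a i * proj_Z n z i j * b j)"

definition beta_RI ::
    "nat \<Rightarrow> (nat \<Rightarrow> real) \<Rightarrow> (nat \<Rightarrow> real) \<Rightarrow> (nat \<Rightarrow> real^'L) \<Rightarrow> (nat \<Rightarrow> bool) \<Rightarrow> real" where
  "beta_RI n y x z m =
     inverse (proj_form n z (imputed n x z m) (imputed n x z m)) *
     proj_form n z (imputed n x z m) y"

definition missing_event :: "'a measure \<Rightarrow> ('a \<Rightarrow> bool) \<Rightarrow> 'a set" where
  "missing_event M m = {\<omega> \<in> space M. m \<omega>}"

definition complete_event :: "'a measure \<Rightarrow> ('a \<Rightarrow> bool) \<Rightarrow> 'a set" where
  "complete_event M m = {\<omega> \<in> space M. \<not> m \<omega>}"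

definition MCAR ::
    "'a measure \<Rightarrow> ('a \<Rightarrow> real) \<Rightarrow> ('a \<Rightarrow> real) \<Rightarrow> ('a \<Rightarrow> real^'L) \<Rightarrow> ('a \<Rightarrow> bool) \<Rightarrow> bool" where
  "MCAR M y x z m \<longleftrightarrow>
     prob_space.indep_set M
       (sets (vimage_algebra (space M) (\<lambda>\<omega>. (y \<omega>, x \<omega>, z \<omega>)) borel))
       (sets (vimage_algebra (space M) m (count_space UNIV)))"

text \<open>The missingness probability given all variables depends only on the variables \<open>y\<close>, \<open>z\<close> that are
  always observed: \<open>P(m | y, x, z) = P(m | y, z)\<close>.\<close>

definition MAR ::
    "'a measure \<Rightarrow> ('a \<Rightarrow> real) \<Rightarrow> ('a \<Rightarrow> real) \<Rightarrow> ('a \<Rightarrow> real^'L) \<Rightarrow> ('a \<Rightarrow> bool) \<Rightarrow> bool" where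
  "MAR M y x z m \<longleftrightarrow>
     (AE \<omega> in M.
        real_cond_exp M (vimage_algebra (space M) (\<lambda>\<omega>. (y \<omega>, x \<omega>, z \<omega>)) borel)
          (indicator (missing_event M m)) \<omega> =
        real_cond_exp M (vimage_algebra (space M) (\<lambda>\<omega>. (y \<omega>, z \<omega>)) borel)
          (indicator (missing_event M m)) \<omega>)"

text \<open>\<open>u\<close>, \<open>v\<close>, \<open>z\<close>, \<open>m\<close> belong to one generic observation, and \<open>Q0\<close>, \<open>Q1\<close> are the limits of the
  normalized Gram matrices of the complete and the incomplete observations.  The second summand
  need not be symmetric, but the matrix is only used through a quadratic form.\<close>

definition Omega_RI ::
    "'a measure \<Rightarrow> ('a \<Rightarrow> real) \<Rightarrow> ('a \<Rightarrow> real) \<Rightarrow> ('a \<Rightarrow> real^'L) \<Rightarrow> ('a \<Rightarrow> bool) \<Rightarrow>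
     real \<Rightarrow> real \<Rightarrow> real^'L^'L \<Rightarrow> real^'L^'L \<Rightarrow> real^'L^'L" where
  "Omega_RI M u v z m p \<beta> Q0 Q1 =
     (let E0 = expectation_on M (complete_event M m);
          E1 = expectation_on M (missing_event M m);
          zz = (\<lambda>\<omega>. outer (z \<omega>) (z \<omega>))
      in integral\<^sup>L M (\<lambda>\<omega>. (u \<omega>)\<^sup>2 *\<^sub>R zz \<omega>)
         - (2 * p * \<beta>) *\<^sub>R (E0 (\<lambda>\<omega>. (u \<omega> * v \<omega>) *\<^sub>R zz \<omega>) ** matrix_inv Q0 ** Q1)
         + (p\<^sup>2 / (1 - p) * \<beta>\<^sup>2) *\<^sub>R
             (Q1 ** matrix_inv Q0 ** E0 (\<lambda>\<omega>. (v \<omega>)\<^sup>2 *\<^sub>R zz \<omega>) ** matrix_inv Q0 ** Q1)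
         + (2 * p * \<beta>) *\<^sub>R E1 (\<lambda>\<omega>. (u \<omega> * v \<omega>) *\<^sub>R zz \<omega>)
         + (p * \<beta>\<^sup>2) *\<^sub>R E1 (\<lambda>\<omega>. (v \<omega>)\<^sup>2 *\<^sub>R zz \<omega>))"

definition V_RI :: "real^'L^'L \<Rightarrow> real^'L \<Rightarrow> real^'L^'L \<Rightarrow> real" where
  "V_RI QZZ QZx Omega =
     (let d = QZx \<bullet> (matrix_inv QZZ *v QZx)
      in inverse d *
         (QZx \<bullet> (matrix_inv QZZ *v (Omega *v (matrix_inv QZZ *v QZx)))) *
         inverse d)"

end

theory Submission
  imports Defs
begin

text \<open>
  The imputation error is \<open>v\<^sub>1 - Z\<^sub>1 (\<pi>\<^sub>C\<^sub>C - \<pi>)\<close> on the incomplete observations, where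
  \<open>\<pi>\<^sub>C\<^sub>C - \<pi> = (Z\<^sub>0'Z\<^sub>0)\<^sup>-\<^sup>1 Z\<^sub>0'v\<^sub>0\<close>.  Hence, whenever the Gram matrices are invertible and
  \<open>c\<^sub>n\<close> is well defined, the estimation error is exactly
  \<open>\<surd>n (\<beta>\<^sub>R\<^sub>I - \<beta>) = c\<^sub>n \<bullet> (Z'u + \<beta> Z\<^sub>1'v\<^sub>1 - \<beta> A\<^sub>n Z\<^sub>0'v\<^sub>0) / \<surd>n\<close> with \<open>A\<^sub>n = Z\<^sub>1'Z\<^sub>1 (Z\<^sub>0'Z\<^sub>0)\<^sup>-\<^sup>1\<close>.
  The summands of the score are independent, identically distributed, centred (ignorability gives
  \<open>E[Z v | complete] = 0\<close>) and square integrable, and the random coefficients \<open>c\<^sub>n\<close>, \<open>A\<^sub>n\<close> are continuous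
  functions of sample moments, so they converge in probability to constants.  The central limit theorem
  for the limiting coefficients and Slutsky's theorem give the result; the asymptotic variance is the
  second moment of the limiting linear combination of the score.
\<close>

subsection \<open>Convergence in probability and the weak law of large numbers\<close>

text \<open>Moments are the first obstacle. A fourth moment of the imputed regressor bounds
  \<open>x\<close> only where it is observed, whereas \<Omega> contains second moments of
  \<open>u\<close> and \<open>v\<close> separately, also over incomplete observations. Under MCAR,
  independence carries the moment of \<open>x\<close> over to all observations. In the MAR branch
  integrability of the \<open>u\<close> term is given and \<open>x\<close> is recovered as
  \<open>(y - u) / \<beta>\<close>, which is why \<open>\<beta> = 0\<close> is tracked separately.
  The second obstacle is that the exact error formula can fail where a Gram matrix is singular or
  the first-stage form is 0. Such samples have vanishing probability, so the limit theorem asks for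
  equality with the linear form only up to such events. The two score sums are stacked in one
  product space, so the error is a single inner product of random coefficients with a normalized
  sum. The second moment of that sum is bounded, so the coefficients may be replaced by their
  limits, and a scalar central limit theorem remains. The constant
  \<open>p\<^sup>2 / (1 - p)\<close> arises because \<open>A\<^sub>n\<close> tends to
  \<open>p / (1 - p)\<close> times \<open>Q1 ** matrix_inv Q0\<close>, which enters squared and is
  weighted by the probability \<open>1 - p\<close> of a complete observation.\<close>

lemma (in prob_space) conv_in_prob_imp_prob_not_in:
  fixes X :: "nat \<Rightarrow> 'a \<Rightarrow> 'b::{metric_space, second_countable_topology}"
  assumes conv: "conv_in_prob M X c" and [measurable]: "\<And>n. X n \<in> borel_measurable M"
    and U: "open U" "c \<in> U"
  shows "(\<lambda>n. prob {\<omega> \<in> space M. X n \<omega> \<notin> U}) \<longlonglongrightarrow> 0"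
proof -
  obtain e where e: "e > 0" "ball c e \<subseteq> U"
    using U open_contains_ball by blast
  \<comment> \<open>\<open>conv_in_prob\<close> uses a strict inequality, while leaving
    \<open>ball c e\<close> yields only distance at least \<open>e\<close>; halving the radius
    closes the gap.\<close>
  have lim: "(\<lambda>n. prob {\<omega> \<in> space M. dist (X n \<omega>) c > e / 2}) \<longlonglongrightarrow> 0"
    using conv half_gt_zero[OF e(1)] unfolding conv_in_prob_def by blast
  have "prob {\<omega> \<in> space M. X n \<omega> \<notin> U} \<le> prob {\<omega> \<in> space M. dist (X n \<omega>) c > e / 2}" for n
  proof (rule finite_measure_mono)
    show "{\<omega> \<in> space M. X n \<omega> \<notin> U} \<subseteq> {\<omega> \<in> space M. dist (X n \<omega>) c > e / 2}"
    proof clarify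
      fix \<omega> assume "X n \<omega> \<notin> U"
      then have "X n \<omega> \<notin> ball c e" using e by blast
      then show "dist (X n \<omega>) c > e / 2" using e(1) by (simp add: dist_commute)
    qed
  qed measurable
  then show ?thesis
    by (intro real_tendsto_sandwich[OF _ _ tendsto_const lim]) auto
qed

text \<open>A distance event for \<open>f (X n)\<close> lies inside one for \<open>X n\<close>, and
  monotonicity of measure asks for measurability of the larger event only, so \<open>f\<close> may
  be arbitrary away from \<open>c\<close>. This suits functions built from
  \<open>matrix_inv\<close>, whose continuity is available only at invertible matrices.\<close>

lemma (in prob_space) conv_in_prob_isCont:
  fixes X :: "nat \<Rightarrow> 'a \<Rightarrow> 'b::{metric_space, second_countable_topology}"
    and f :: "'b \<Rightarrow> 'c::metric_space"
  assumes conv: "conv_in_prob M X c" and [measurable]: "\<And>n. X n \<in> borel_measurable M"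
    and f: "isCont f c"
  shows "conv_in_prob M (\<lambda>n \<omega>. f (X n \<omega>)) (f c)"
  unfolding conv_in_prob_def
proof (intro allI impI)
  fix e :: real assume e: "e > 0"
  then obtain d where d: "d > 0" "\<And>x. dist x c < d \<Longrightarrow> dist (f x) (f c) < e"
    using f by (auto simp: continuous_at_eps_delta dist_commute)
  have lim: "(\<lambda>n. prob {\<omega> \<in> space M. dist (X n \<omega>) c > d / 2}) \<longlonglongrightarrow> 0"
    using conv half_gt_zero[OF d(1)] unfolding conv_in_prob_def by blast
  have "prob {\<omega> \<in> space M. dist (f (X n \<omega>)) (f c) > e} \<le> prob {\<omega> \<in> space M. dist (X n \<omega>) c > d / 2}" for n
  proof (rule finite_measure_mono)
    show "{\<omega> \<in> space M. dist (f (X n \<omega>)) (f c) > e} \<subseteq> {\<omega> \<in> space M. dist (X n \<omega>) c > d / 2}"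
    proof clarify
      fix \<omega> assume "dist (f (X n \<omega>)) (f c) > e"
      then have "\<not> dist (X n \<omega>) c < d" using d(2)[of "X n \<omega>"] by auto
      then show "dist (X n \<omega>) c > d / 2" using d(1) by simp
    qed
  qed measurable
  then show "(\<lambda>n. prob {\<omega> \<in> space M. dist (f (X n \<omega>)) (f c) > e}) \<longlonglongrightarrow> 0"
    by (intro real_tendsto_sandwich[OF _ _ tendsto_const lim]) auto
qed

lemma (in prob_space) conv_in_prob_Pair:
  fixes X :: "nat \<Rightarrow> 'a \<Rightarrow> 'b::{metric_space, second_countable_topology}"
    and Y :: "nat \<Rightarrow> 'a \<Rightarrow> 'c::{metric_space, second_countable_topology}"
  assumes X: "conv_in_prob M X c" and [measurable]: "\<And>n. X n \<in> borel_measurable M"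
    and Y: "conv_in_prob M Y d" and [measurable]: "\<And>n. Y n \<in> borel_measurable M"
  shows "conv_in_prob M (\<lambda>n \<omega>. (X n \<omega>, Y n \<omega>)) (c, d)"
  unfolding conv_in_prob_def
proof (intro allI impI)
  fix e :: real assume e: "e > 0"
  define A where "A n = {\<omega> \<in> space M. dist (X n \<omega>) c > e / 2}" for n
  define B where "B n = {\<omega> \<in> space M. dist (Y n \<omega>) d > e / 2}" for n
  have [measurable]: "A n \<in> events" "B n \<in> events" for n
    unfolding A_def B_def by measurable
  have "(\<lambda>n. prob (A n)) \<longlonglongrightarrow> 0" "(\<lambda>n. prob (B n)) \<longlonglongrightarrow> 0"
    using X Y half_gt_zero[OF e] unfolding conv_in_prob_def A_def B_def by blast+
  then have lim: "(\<lambda>n. prob (A n) + prob (B n)) \<longlonglongrightarrow> 0"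
    using tendsto_add by fastforce
  have "prob {\<omega> \<in> space M. dist (X n \<omega>, Y n \<omega>) (c, d) > e} \<le> prob (A n) + prob (B n)" for n
  proof -
    have "prob {\<omega> \<in> space M. dist (X n \<omega>, Y n \<omega>) (c, d) > e} \<le> prob (A n \<union> B n)"
    proof (rule finite_measure_mono)
      show "{\<omega> \<in> space M. dist (X n \<omega>, Y n \<omega>) (c, d) > e} \<subseteq> A n \<union> B n"
      proof clarify
        fix \<omega> assume w: "\<omega> \<in> space M" "dist (X n \<omega>, Y n \<omega>) (c, d) > e" "\<omega> \<notin> B n"
        have "dist (X n \<omega>, Y n \<omega>) (c, d) \<le> dist (X n \<omega>) c + dist (Y n \<omega>) d"
          unfolding dist_Pair_Pair by (rule sqrt_sum_squares_le_sum) auto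
        then show "\<omega> \<in> A n" using w by (auto simp: A_def B_def)
      qed
    qed measurable
    also have "\<dots> \<le> prob (A n) + prob (B n)"
      by (rule measure_Un_le) measurable
    finally show ?thesis .
  qed
  then show "(\<lambda>n. prob {\<omega> \<in> space M. dist (X n \<omega>, Y n \<omega>) (c, d) > e}) \<longlonglongrightarrow> 0"
    by (intro real_tendsto_sandwich[OF _ _ tendsto_const lim]) auto
qed

text \<open>The distance is continuous on pairs, and \<open>X n\<close> has distance 0 from itself.
  The lemma identifies probability limits given as hypotheses with the expectations that the weak
  law delivers.\<close>

lemma (in prob_space) conv_in_prob_unique:
  fixes X :: "nat \<Rightarrow> 'a \<Rightarrow> 'b::{metric_space, second_countable_topology}"
  assumes c: "conv_in_prob M X c" and d: "conv_in_prob M X d"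
    and X[measurable]: "\<And>n. X n \<in> borel_measurable M"
  shows "c = d"
proof (rule ccontr)
  assume "c \<noteq> d"
  define g where "g = (\<lambda>(a::'b, b). dist a b)"
  have "isCont g (c, d)"
    unfolding g_def case_prod_unfold by (intro continuous_intros)
  then have "conv_in_prob M (\<lambda>n \<omega>. g (X n \<omega>, X n \<omega>)) (g (c, d))"
    by (intro conv_in_prob_isCont[where X="\<lambda>n \<omega>. (X n \<omega>, X n \<omega>)" and f=g] conv_in_prob_Pair c d) auto
  then have conv: "conv_in_prob M (\<lambda>n \<omega>. 0::real) (dist c d)"
    by (simp add: g_def)
  have "(\<lambda>n::nat. prob {\<omega> \<in> space M. dist 0 (dist c d) > dist c d / 2}) \<longlonglongrightarrow> 0"
    by (rule conv[unfolded conv_in_prob_def, rule_format]) (use \<open>c \<noteq> d\<close> in simp)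
  moreover have "{\<omega> \<in> space M. dist 0 (dist c d) > dist c d / 2} = space M"
    using \<open>c \<noteq> d\<close> by (auto simp: dist_real_def)
  ultimately show False
    by (simp add: prob_space LIMSEQ_const_iff)
qed

text \<open>A factor tending to 0 in probability times one bounded in probability. The boundedness
  is Markov's inequality for the uniformly bounded second moment of \<open>W n\<close>.\<close>

lemma (in prob_space) conv_in_prob_inner_bounded:
  fixes B W :: "nat \<Rightarrow> 'a \<Rightarrow> 'b::euclidean_space"
  assumes conv: "conv_in_prob M B 0" and [measurable]: "\<And>n. B n \<in> borel_measurable M"
    and [measurable]: "\<And>n. W n \<in> borel_measurable M"
    and int: "\<And>n. integrable M (\<lambda>\<omega>. (norm (W n \<omega>))\<^sup>2)"
    and C: "\<And>n. expectation (\<lambda>\<omega>. (norm (W n \<omega>))\<^sup>2) \<le> C"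
  shows "conv_in_prob M (\<lambda>n \<omega>. B n \<omega> \<bullet> W n \<omega>) 0"
  unfolding conv_in_prob_def
proof (intro allI impI)
  fix e :: real assume e: "e > 0"
  have C0: "C \<ge> 0"
    using C[of 0] by (rule order_trans[rotated]) (rule Bochner_Integration.integral_nonneg, simp)
  let ?P = "\<lambda>n. prob {\<omega> \<in> space M. dist (B n \<omega> \<bullet> W n \<omega>) 0 > e}"
  \<comment> \<open>If \<open>norm (B n \<omega>)\<close> is at most \<open>d\<close>,
    Cauchy-Schwarz turns an inner product above \<open>e\<close> into
    \<open>norm (W n \<omega>)\<close> of at least \<open>e / d\<close>, and Markov's inequality
    bounds that event.\<close>
  have bound: "?P n \<le> prob {\<omega> \<in> space M. dist (B n \<omega>) 0 > d} + C * d\<^sup>2 / e\<^sup>2" if d: "d > 0" for d n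
  proof -
    have "?P n \<le> prob ({\<omega> \<in> space M. dist (B n \<omega>) 0 > d} \<union> {\<omega> \<in> space M. (norm (W n \<omega>))\<^sup>2 \<ge> (e / d)\<^sup>2})"
    proof (rule finite_measure_mono)
      show "{\<omega> \<in> space M. dist (B n \<omega> \<bullet> W n \<omega>) 0 > e}
        \<subseteq> {\<omega> \<in> space M. dist (B n \<omega>) 0 > d} \<union> {\<omega> \<in> space M. (norm (W n \<omega>))\<^sup>2 \<ge> (e / d)\<^sup>2}"
      proof
        fix \<omega> assume "\<omega> \<in> {\<omega> \<in> space M. dist (B n \<omega> \<bullet> W n \<omega>) 0 > e}"
        then have w0: "\<omega> \<in> space M" and w1: "\<bar>B n \<omega> \<bullet> W n \<omega>\<bar> > e"
          by auto
        have "(e / d)\<^sup>2 \<le> (norm (W n \<omega>))\<^sup>2" if w2: "\<not> norm (B n \<omega>) > d"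
        proof -
        have "e < norm (B n \<omega>) * norm (W n \<omega>)"
          using w1 Cauchy_Schwarz_ineq2[of "B n \<omega>" "W n \<omega>"] by linarith
        also have "\<dots> \<le> d * norm (W n \<omega>)"
          using w2 by (intro mult_right_mono) auto
        finally have "e / d \<le> norm (W n \<omega>)"
          using d by (simp add: field_simps)
          then show ?thesis
            using e d by (intro power_mono) auto
        qed
        then show "\<omega> \<in> {\<omega> \<in> space M. dist (B n \<omega>) 0 > d} \<union> {\<omega> \<in> space M. (norm (W n \<omega>))\<^sup>2 \<ge> (e / d)\<^sup>2}"
          using w0 by auto
      qed
    qed measurable
    also have "\<dots> \<le> prob {\<omega> \<in> space M. dist (B n \<omega>) 0 > d} + prob {\<omega> \<in> space M. (norm (W n \<omega>))\<^sup>2 \<ge> (e / d)\<^sup>2}"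
      by (rule measure_Un_le) measurable
    also have "prob {\<omega> \<in> space M. (norm (W n \<omega>))\<^sup>2 \<ge> (e / d)\<^sup>2} \<le> expectation (\<lambda>\<omega>. (norm (W n \<omega>))\<^sup>2) / (e / d)\<^sup>2"
      using e d by (intro integral_Markov_inequality_measure[where A="{}"] int) auto
    also have "\<dots> \<le> C / (e / d)\<^sup>2"
      by (intro divide_right_mono C) auto
    also have "C / (e / d)\<^sup>2 = C * d\<^sup>2 / e\<^sup>2"
      using d e by (simp add: power_divide)
    finally show ?thesis by simp
  qed
  show "?P \<longlonglongrightarrow> 0"
  proof (rule LIMSEQ_I)
    fix r :: real assume r: "r > 0"
    \<comment> \<open>Chosen so that \<open>C * d\<^sup>2 / e\<^sup>2\<close> equals
      \<open>r / 2\<close> times \<open>C / (C + 1)\<close>; the shift by 1 covers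
      \<open>C = 0\<close>.\<close>
    define d where "d = e * sqrt (r / (2 * (C + 1)))"
    have d: "d > 0" using r e C0 by (simp add: d_def)
    have "C * d\<^sup>2 / e\<^sup>2 = r / 2 * (C / (C + 1))"
      using e r C0 by (simp add: d_def power_mult_distrib)
    also have "\<dots> \<le> r / 2 * 1"
      using r C0 by (intro mult_left_mono) auto
    finally have 1: "C * d\<^sup>2 / e\<^sup>2 \<le> r / 2" by simp
    have "(\<lambda>n. prob {\<omega> \<in> space M. dist (B n \<omega>) 0 > d}) \<longlonglongrightarrow> 0"
      using conv d by (auto simp: conv_in_prob_def)
    from LIMSEQ_D[OF this, of "r / 2"] r obtain N where
      N: "\<And>n. n \<ge> N \<Longrightarrow> prob {\<omega> \<in> space M. dist (B n \<omega>) 0 > d} < r / 2"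
      by auto
    have "?P n < r" if "n \<ge> N" for n
      using bound[OF d, of n] N[OF that] 1 by linarith
    then have "norm (?P n - 0) < r" if "n \<ge> N" for n
      using that by simp
    then show "\<exists>N. \<forall>n\<ge>N. norm (?P n - 0) < r" by blast
  qed
qed

lemma (in prob_space) integrable_if_norm_sq:
  fixes X :: "'a \<Rightarrow> 'b::{banach, second_countable_topology}"
  assumes [measurable]: "X \<in> borel_measurable M" and sq: "integrable M (\<lambda>\<omega>. (norm (X \<omega>))\<^sup>2)"
  shows "integrable M X"
proof (rule Bochner_Integration.integrable_bound)
  show "integrable M (\<lambda>\<omega>. 1 + (norm (X \<omega>))\<^sup>2)" using sq by simp
  have "r \<le> 1 + r\<^sup>2" for r :: real
    using sum_squares_bound[of r 1] zero_le_power2[of r] by (simp; linarith)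
  then show "AE \<omega> in M. norm (X \<omega>) \<le> norm (1 + (norm (X \<omega>))\<^sup>2)"
    by (intro AE_I2) (simp add: add_nonneg_nonneg)
qed simp

lemma
  fixes X Y :: "'a \<Rightarrow> 'b::topological_space" and g :: "'b \<Rightarrow> 'c::{banach, second_countable_topology}"
  assumes "X \<in> borel_measurable M" "Y \<in> borel_measurable M"
    and "distr M borel X = distr M borel Y" "g \<in> borel_measurable borel"
  shows integrable_cong_distr: "integrable M (\<lambda>\<omega>. g (X \<omega>)) \<longleftrightarrow> integrable M (\<lambda>\<omega>. g (Y \<omega>))"
    and integral_cong_distr: "integral\<^sup>L M (\<lambda>\<omega>. g (X \<omega>)) = integral\<^sup>L M (\<lambda>\<omega>. g (Y \<omega>))"
  using integrable_distr_eq[OF assms(1,4)] integrable_distr_eq[OF assms(2,4)]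
    integral_distr[OF assms(1,4)] integral_distr[OF assms(2,4)]
  by (simp_all only: assms(3))

text \<open>Expanding the squared norm over the basis leaves products of scalar coordinates. Those
  with distinct indices have expectation 0 by independence and centring, so only the diagonal
  survives.\<close>

lemma (in prob_space) second_moment_sum:
  fixes W :: "nat \<Rightarrow> 'a \<Rightarrow> 'b::euclidean_space"
  assumes indep: "indep_vars (\<lambda>_. borel) W UNIV"
    and sq: "\<And>i. integrable M (\<lambda>\<omega>. (norm (W i \<omega>))\<^sup>2)"
    and mean: "\<And>i. expectation (W i) = 0"
  shows "integrable M (\<lambda>\<omega>. (norm (\<Sum>i<n. W i \<omega>))\<^sup>2)" (is ?int)
    and "expectation (\<lambda>\<omega>. (norm (\<Sum>i<n. W i \<omega>))\<^sup>2) = (\<Sum>i<n. expectation (\<lambda>\<omega>. (norm (W i \<omega>))\<^sup>2))" (is ?eq)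
proof -
  have W[measurable]: "W i \<in> borel_measurable M" for i
    using indep by (auto simp: indep_vars_def)
  have Wint: "integrable M (W i)" for i
    by (rule integrable_if_norm_sq[OF _ sq]) measurable
  have prod: "integrable M (\<lambda>\<omega>. (W i \<omega> \<bullet> b) * (W j \<omega> \<bullet> b)) \<and>
     expectation (\<lambda>\<omega>. (W i \<omega> \<bullet> b) * (W j \<omega> \<bullet> b)) =
       (if i = j then expectation (\<lambda>\<omega>. (W i \<omega> \<bullet> b)\<^sup>2) else 0)" if "b \<in> Basis" for i j b
  proof (cases "i = j")
    case True
    have "integrable M (\<lambda>\<omega>. (W i \<omega> \<bullet> b)\<^sup>2)"
    proof (rule Bochner_Integration.integrable_bound[OF sq[of i]])
      show "AE \<omega> in M. norm ((W i \<omega> \<bullet> b)\<^sup>2) \<le> norm ((norm (W i \<omega>))\<^sup>2)"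
        using that by (intro AE_I2) (auto simp: Basis_le_norm abs_le_square_iff[symmetric])
    qed simp
    then show ?thesis using True by (simp add: power2_eq_square)
  next
    case False
    \<comment> \<open>Pairwise independence is extracted from the family by restricting to the
      disjoint index sets \<open>{i}\<close> and \<open>{j}\<close> and evaluating the restricted
      functions.\<close>
    have "indep_var borel (W i) borel (W j)"
    proof -
      have "indep_vars (\<lambda>_. borel) W {i, j}"
        by (rule indep_vars_subset[OF indep]) auto
      then have *: "indep_var (PiM {i} (\<lambda>_. borel)) (\<lambda>\<omega>. restrict (\<lambda>i. W i \<omega>) {i})
         (PiM {j} (\<lambda>_. borel)) (\<lambda>\<omega>. restrict (\<lambda>i. W i \<omega>) {j})"
        using False by (intro indep_var_restrict) auto
      have "indep_var borel ((\<lambda>f. f i) \<circ> (\<lambda>\<omega>. restrict (\<lambda>i. W i \<omega>) {i}))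
         borel ((\<lambda>f. f j) \<circ> (\<lambda>\<omega>. restrict (\<lambda>i. W i \<omega>) {j}))"
        by (rule indep_var_compose[OF *]) auto
      then show ?thesis by (simp add: comp_def)
    qed
    then have "indep_var borel ((\<lambda>x. x \<bullet> b) \<circ> W i) borel ((\<lambda>x. x \<bullet> b) \<circ> W j)"
      by (rule indep_var_compose) auto
    then have ind: "indep_var borel (\<lambda>\<omega>. W i \<omega> \<bullet> b) borel (\<lambda>\<omega>. W j \<omega> \<bullet> b)"
      by (simp add: comp_def)
    have int: "integrable M (\<lambda>\<omega>. W k \<omega> \<bullet> b)" for k
      using Wint by auto
    have zero: "expectation (\<lambda>\<omega>. W k \<omega> \<bullet> b) = 0" for k
      using mean[of k] integral_inner_left[of b M "W k"] Wint[of k] by simp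
    show ?thesis
      using indep_var_lebesgue_integral[OF ind int int] indep_var_integrable[OF ind int int]
      by (simp add: zero False)
  qed
  have expand: "(norm (\<Sum>i<n. W i \<omega>))\<^sup>2 = (\<Sum>b\<in>Basis. \<Sum>i<n. \<Sum>j<n. (W i \<omega> \<bullet> b) * (W j \<omega> \<bullet> b))" for \<omega>
    unfolding power2_norm_eq_inner
    by (subst euclidean_inner) (simp add: inner_sum_left sum_product)
  have expand1: "(norm (W i \<omega>))\<^sup>2 = (\<Sum>b\<in>Basis. (W i \<omega> \<bullet> b)\<^sup>2)" for i \<omega>
    unfolding power2_norm_eq_inner by (subst euclidean_inner) (simp add: power2_eq_square)
  show ?int
    unfolding expand using prod by (intro Bochner_Integration.integrable_sum) auto
  have "expectation (\<lambda>\<omega>. (norm (\<Sum>i<n. W i \<omega>))\<^sup>2) =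
      (\<Sum>b\<in>Basis. \<Sum>i<n. \<Sum>j<n. expectation (\<lambda>\<omega>. (W i \<omega> \<bullet> b) * (W j \<omega> \<bullet> b)))"
    unfolding expand using prod by (simp add: Bochner_Integration.integral_sum Bochner_Integration.integrable_sum)
  also have "\<dots> = (\<Sum>b\<in>Basis. \<Sum>i<n. expectation (\<lambda>\<omega>. (W i \<omega> \<bullet> b)\<^sup>2))"
    using prod by (intro sum.cong refl) (simp add: sum.delta)
  also have "\<dots> = (\<Sum>i<n. \<Sum>b\<in>Basis. expectation (\<lambda>\<omega>. (W i \<omega> \<bullet> b)\<^sup>2))"
    by (rule sum.swap)
  also have "\<dots> = (\<Sum>i<n. expectation (\<lambda>\<omega>. (norm (W i \<omega>))\<^sup>2))"
  proof (intro sum.cong refl)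
    fix i
    have "integrable M (\<lambda>\<omega>. (W i \<omega> \<bullet> b)\<^sup>2)" if "b \<in> Basis" for b
      using prod[OF that, of i i] by (simp add: power2_eq_square)
    then show "(\<Sum>b\<in>Basis. expectation (\<lambda>\<omega>. (W i \<omega> \<bullet> b)\<^sup>2)) = expectation (\<lambda>\<omega>. (norm (W i \<omega>))\<^sup>2)"
      unfolding expand1 by (simp add: Bochner_Integration.integral_sum)
  qed
  finally show ?eq .
qed

text \<open>Chebyshev's argument for the norm, hence the second moment. The sample moments it serves
  are mostly products of two variables, which is where fourth moments enter.\<close>

lemma (in prob_space) weak_law_of_large_numbers:
  fixes X :: "nat \<Rightarrow> 'a \<Rightarrow> 'b::euclidean_space"
  assumes indep: "indep_vars (\<lambda>_. borel) X UNIV"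
    and distr: "\<And>i. distr M borel (X i) = \<nu>"
    and sq: "integrable M (\<lambda>\<omega>. (norm (X 0 \<omega>))\<^sup>2)"
  shows "conv_in_prob M (\<lambda>n \<omega>. (1 / real n) *\<^sub>R (\<Sum>i<n. X i \<omega>)) (expectation (X 0))"
  unfolding conv_in_prob_def
proof (intro allI impI)
  fix e :: real assume e: "e > 0"
  have X[measurable]: "X i \<in> borel_measurable M" for i
    using indep by (auto simp: indep_vars_def)
  let ?m = "expectation (X 0)"
  have same_distr: "distr M borel (X i) = distr M borel (X 0)" for i
    by (simp add: distr)
  define W where "W i \<omega> = X i \<omega> - ?m" for i \<omega>
  have sqX: "integrable M (\<lambda>\<omega>. (norm (X i \<omega>))\<^sup>2)" for i
    using integrable_cong_distr[OF X X same_distr, of "\<lambda>x. (norm x)\<^sup>2" i] sq by simp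
  have Xint: "integrable M (X i)" for i
    by (rule integrable_if_norm_sq[OF _ sqX]) measurable
  have indepW: "indep_vars (\<lambda>_. borel) W UNIV"
    unfolding W_def by (rule indep_vars_compose2[OF indep]) auto
  have meanW: "expectation (W i) = 0" for i
    using integral_cong_distr[OF X X same_distr, of "\<lambda>x. x" i] Xint[of i] unfolding W_def
    by (simp add: prob_space)
  have sqW: "integrable M (\<lambda>\<omega>. (norm (W i \<omega>))\<^sup>2)" for i
    unfolding W_def power2_norm_eq_inner inner_diff_left inner_diff_right
    using sqX[of i] Xint[of i]
    by (intro Bochner_Integration.integrable_diff) (auto simp: power2_norm_eq_inner)
  define C where "C = expectation (\<lambda>\<omega>. (norm (W 0 \<omega>))\<^sup>2)"
  have C: "expectation (\<lambda>\<omega>. (norm (W i \<omega>))\<^sup>2) = C" for i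
    unfolding C_def W_def
    by (rule integral_cong_distr[OF X X same_distr, where g="\<lambda>x. (norm (x - ?m))\<^sup>2"]) measurable
  have W[measurable]: "W i \<in> borel_measurable M" for i
    unfolding W_def by measurable
  have bound: "prob {\<omega> \<in> space M. dist ((1 / real n) *\<^sub>R (\<Sum>i<n. X i \<omega>)) ?m > e} \<le> C / e\<^sup>2 * (1 / real n)"
    if n: "n > 0" for n
  proof -
    have "prob {\<omega> \<in> space M. dist ((1 / real n) *\<^sub>R (\<Sum>i<n. X i \<omega>)) ?m > e} \<le>
       prob {\<omega> \<in> space M. (norm (\<Sum>i<n. W i \<omega>))\<^sup>2 \<ge> (real n * e)\<^sup>2}"
    proof (rule finite_measure_mono)
      show "{\<omega> \<in> space M. dist ((1 / real n) *\<^sub>R (\<Sum>i<n. X i \<omega>)) ?m > e} \<subseteq>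
        {\<omega> \<in> space M. (norm (\<Sum>i<n. W i \<omega>))\<^sup>2 \<ge> (real n * e)\<^sup>2}"
      proof clarify
        fix \<omega> assume w: "dist ((1 / real n) *\<^sub>R (\<Sum>i<n. X i \<omega>)) ?m > e"
        have "(1 / real n) *\<^sub>R (\<Sum>i<n. X i \<omega>) - ?m = (1 / real n) *\<^sub>R (\<Sum>i<n. W i \<omega>)"
          using n by (simp add: W_def sum_subtractf scaleR_diff_right sum_constant_scaleR)
        then have "norm (\<Sum>i<n. W i \<omega>) = real n * dist ((1 / real n) *\<^sub>R (\<Sum>i<n. X i \<omega>)) ?m"
          using n by (simp add: dist_norm)
        also have "\<dots> \<ge> real n * e"
          using w by (intro mult_left_mono) auto
        finally show "(norm (\<Sum>i<n. W i \<omega>))\<^sup>2 \<ge> (real n * e)\<^sup>2"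
          using e by (intro power_mono) auto
      qed
    qed measurable
    also have "\<dots> \<le> expectation (\<lambda>\<omega>. (norm (\<Sum>i<n. W i \<omega>))\<^sup>2) / (real n * e)\<^sup>2"
      using e n by (intro integral_Markov_inequality_measure[where A="{}"] second_moment_sum indepW sqW meanW) auto
    also have "\<dots> = C / e\<^sup>2 * (1 / real n)"
      using n e by (subst second_moment_sum[OF indepW sqW meanW]) (simp only: C, simp add: power2_eq_square)
    finally show ?thesis .
  qed
  show "(\<lambda>n. prob {\<omega> \<in> space M. dist ((1 / real n) *\<^sub>R (\<Sum>i<n. X i \<omega>)) ?m > e}) \<longlonglongrightarrow> 0"
  proof (rule real_tendsto_sandwich[OF _ _ tendsto_const])
    show "\<forall>\<^sub>F n in sequentially. prob {\<omega> \<in> space M. dist ((1 / real n) *\<^sub>R (\<Sum>i<n. X i \<omega>)) ?m > e} \<le> C / e\<^sup>2 * (1 / real n)"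
      using eventually_gt_at_top[of 0] by eventually_elim (rule bound)
    show "(\<lambda>n. C / e\<^sup>2 * (1 / real n)) \<longlonglongrightarrow> 0"
      using tendsto_mult_right[OF lim_1_over_n, of "C / e\<^sup>2"] by (simp add: mult.commute)
  qed simp
qed

subsection \<open>Slutsky's theorem and a central limit theorem with random coefficients\<close>

lemma (in prob_space) conv_in_prob_transfer:
  fixes X Y :: "nat \<Rightarrow> 'a \<Rightarrow> 'b::{metric_space, second_countable_topology}"
  assumes conv: "conv_in_prob M X c"
    and [measurable]: "\<And>n. X n \<in> borel_measurable M" "\<And>n. Y n \<in> borel_measurable M"
    and eq: "(\<lambda>n. prob {\<omega> \<in> space M. Y n \<omega> \<noteq> X n \<omega>}) \<longlonglongrightarrow> 0"
  shows "conv_in_prob M Y c"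
  unfolding conv_in_prob_def
proof (intro allI impI)
  fix e :: real assume e: "e > 0"
  have "(\<lambda>n. prob {\<omega> \<in> space M. dist (X n \<omega>) c > e}) \<longlonglongrightarrow> 0"
    using conv e unfolding conv_in_prob_def by blast
  from tendsto_add[OF this eq]
  have lim: "(\<lambda>n. prob {\<omega> \<in> space M. dist (X n \<omega>) c > e} + prob {\<omega> \<in> space M. Y n \<omega> \<noteq> X n \<omega>}) \<longlonglongrightarrow> 0"
    by simp
  have "prob {\<omega> \<in> space M. dist (Y n \<omega>) c > e} \<le>
      prob {\<omega> \<in> space M. dist (X n \<omega>) c > e} + prob {\<omega> \<in> space M. Y n \<omega> \<noteq> X n \<omega>}" for n
  proof -
    have "prob {\<omega> \<in> space M. dist (Y n \<omega>) c > e} \<le>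
        prob ({\<omega> \<in> space M. dist (X n \<omega>) c > e} \<union> {\<omega> \<in> space M. Y n \<omega> \<noteq> X n \<omega>})"
      by (rule finite_measure_mono, force) measurable
    also have "\<dots> \<le> prob {\<omega> \<in> space M. dist (X n \<omega>) c > e} + prob {\<omega> \<in> space M. Y n \<omega> \<noteq> X n \<omega>}"
      by (rule measure_Un_le) measurable
    finally show ?thesis .
  qed
  then show "(\<lambda>n. prob {\<omega> \<in> space M. dist (Y n \<omega>) c > e}) \<longlonglongrightarrow> 0"
    by (intro real_tendsto_sandwich[OF _ _ tendsto_const lim]) auto
qed

text \<open>Factoring out an exponential of modulus 1 reduces the claim to \<open>b = 0\<close>, the
  lowest-order Taylor bound.\<close>

lemma norm_iexp_diff_le: "norm (iexp a - iexp b) \<le> \<bar>a - b\<bar>"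
proof -
  have "iexp a - iexp b = iexp b * (iexp (a - b) - 1)"
    by (simp add: algebra_simps flip: exp_add)
  then have "norm (iexp a - iexp b) = norm (iexp (a - b) - 1)"
    by (simp add: norm_mult)
  also have "\<dots> \<le> \<bar>a - b\<bar>"
    using iexp_approx1[of "a - b" 0] by simp
  finally show ?thesis .
qed

lemma (in prob_space) char_distr_eq:
  assumes [measurable]: "X \<in> borel_measurable M"
  shows "char (distr M borel X) t = expectation (\<lambda>\<omega>. iexp (t * X \<omega>))"
  unfolding char_def by (subst integral_distr) auto

text \<open>By Levy continuity it suffices to compare characteristic functions. The integrands
  differ by at most \<open>\<bar>t\<bar> * e\<close> where \<open>Y n\<close> and \<open>X n\<close>
  are within \<open>e\<close>, and by at most 2 elsewhere.\<close>

lemma (in prob_space) weak_conv_m_slutsky: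
  fixes X Y :: "nat \<Rightarrow> 'a \<Rightarrow> real"
  assumes [measurable]: "\<And>n. X n \<in> borel_measurable M" "\<And>n. Y n \<in> borel_measurable M"
    and \<nu>: "real_distribution \<nu>"
    and weak: "weak_conv_m (\<lambda>n. distr M borel (X n)) \<nu>"
    and conv: "conv_in_prob M (\<lambda>n \<omega>. Y n \<omega> - X n \<omega>) 0"
  shows "weak_conv_m (\<lambda>n. distr M borel (Y n)) \<nu>"
proof (rule levy_continuity[OF _ \<nu>])
  show "real_distribution (distr M borel (Y n))" for n
    by (rule real_distribution_distr) measurable
  fix t
  have X: "(\<lambda>n. char (distr M borel (X n)) t) \<longlonglongrightarrow> char \<nu> t"
    by (rule levy_continuity1[OF _ \<nu> weak]) (rule real_distribution_distr, measurable)
  have bound: "norm (char (distr M borel (Y n)) t - char (distr M borel (X n)) t) \<le>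
      \<bar>t\<bar> * e + 2 * prob {\<omega> \<in> space M. dist (Y n \<omega> - X n \<omega>) 0 > e}" if e: "e > 0" for e n
  proof -
    define A where "A = {\<omega> \<in> space M. dist (Y n \<omega> - X n \<omega>) 0 > e}"
    have A[measurable]: "A \<in> events" unfolding A_def by measurable
    have intA: "integrable M (indicator A :: 'a \<Rightarrow> real)"
      by (intro integrable_real_indicator A) (simp add: less_top[symmetric])
    have int: "integrable M (\<lambda>\<omega>. iexp (t * X n \<omega>))" "integrable M (\<lambda>\<omega>. iexp (t * Y n \<omega>))"
      by (rule integrable_iexp; measurable)+
    have "norm (char (distr M borel (Y n)) t - char (distr M borel (X n)) t) =
        norm (expectation (\<lambda>\<omega>. iexp (t * Y n \<omega>) - iexp (t * X n \<omega>)))"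
      by (simp only: char_distr_eq assms(1,2) Bochner_Integration.integral_diff[OF int(2,1)])
    also have "\<dots> \<le> expectation (\<lambda>\<omega>. norm (iexp (t * Y n \<omega>) - iexp (t * X n \<omega>)))"
      by (rule integral_norm_bound)
    also have "\<dots> \<le> expectation (\<lambda>\<omega>. \<bar>t\<bar> * e + 2 * indicator A \<omega>)"
    proof (rule integral_mono)
      show "integrable M (\<lambda>\<omega>. norm (iexp (t * Y n \<omega>) - iexp (t * X n \<omega>)))"
        using int by (intro integrable_norm Bochner_Integration.integrable_diff)
      show "norm (iexp (t * Y n \<omega>) - iexp (t * X n \<omega>)) \<le> \<bar>t\<bar> * e + 2 * indicator A \<omega>"
        if "\<omega> \<in> space M" for \<omega>
      proof (cases "\<omega> \<in> A")
        case True
        have "norm (iexp (t * Y n \<omega>) - iexp (t * X n \<omega>)) \<le> 1 + 1"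
          by (rule order_trans[OF norm_triangle_ineq4]) simp
        then show ?thesis using True e by (simp add: add_increasing)
      next
        case False
        then have "\<bar>Y n \<omega> - X n \<omega>\<bar> \<le> e" using that by (simp add: A_def)
        then have "\<bar>t\<bar> * \<bar>Y n \<omega> - X n \<omega>\<bar> \<le> \<bar>t\<bar> * e" by (intro mult_left_mono) auto
        then have "\<bar>t * Y n \<omega> - t * X n \<omega>\<bar> \<le> \<bar>t\<bar> * e"
          by (simp add: abs_mult flip: right_diff_distrib)
        then show ?thesis
          using norm_iexp_diff_le[of "t * Y n \<omega>" "t * X n \<omega>"] False by simp
      qed
      show "integrable M (\<lambda>\<omega>. \<bar>t\<bar> * e + 2 * indicator A \<omega>)"
        using intA by (intro Bochner_Integration.integrable_add integrable_mult_right) auto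
    qed
    also have "\<dots> = \<bar>t\<bar> * e + 2 * prob A"
      using intA sets.sets_into_space[OF A]
      by (subst Bochner_Integration.integral_add) (auto simp: prob_space Int_absorb2)
    finally show ?thesis unfolding A_def .
  qed
  have diff: "(\<lambda>n. char (distr M borel (Y n)) t - char (distr M borel (X n)) t) \<longlonglongrightarrow> 0"
  proof (rule LIMSEQ_I)
    fix r :: real assume r: "r > 0"
    \<comment> \<open>This makes \<open>\<bar>t\<bar> * e\<close> at most \<open>r / 2\<close>, with
      the shift by 1 covering \<open>t = 0\<close>. The other half of \<open>r\<close> is spent on
      twice a probability below \<open>r / 4\<close>.\<close>
    define e where "e = r / (2 * (\<bar>t\<bar> + 1))"
    have e: "e > 0" using r by (simp add: e_def)
    have "\<bar>t\<bar> * e = r / 2 * (\<bar>t\<bar> / (\<bar>t\<bar> + 1))" by (simp add: e_def)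
    also have "\<dots> \<le> r / 2 * 1" using r by (intro mult_left_mono) auto
    finally have te: "\<bar>t\<bar> * e \<le> r / 2" by simp
    have "(\<lambda>n. prob {\<omega> \<in> space M. dist (Y n \<omega> - X n \<omega>) 0 > e}) \<longlonglongrightarrow> 0"
      using conv e unfolding conv_in_prob_def by blast
    from LIMSEQ_D[OF this, of "r / 4"] r obtain N where
      N: "\<And>n. n \<ge> N \<Longrightarrow> prob {\<omega> \<in> space M. dist (Y n \<omega> - X n \<omega>) 0 > e} < r / 4"
      by auto
    have "norm (char (distr M borel (Y n)) t - char (distr M borel (X n)) t - 0) < r" if "n \<ge> N" for n
      using bound[OF e, of n] N[OF that] te by simp
    then show "\<exists>N. \<forall>n\<ge>N. norm (char (distr M borel (Y n)) t - char (distr M borel (X n)) t - 0) < r"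
      by blast
  qed
  show "(\<lambda>n. char (distr M borel (Y n)) t) \<longlonglongrightarrow> char \<nu> t"
    using tendsto_add[OF diff X] by simp
qed

lemma real_distribution_normal_law: "real_distribution (normal_law a b)"
  unfolding normal_law_def
  by (rule prob_space.real_distribution_distr)
    (auto intro: prob_space_normal_density simp: measurable_cong_sets[of std_normal_distribution borel])

lemma char_normal_law_0:
  assumes "s \<ge> 0"
  shows "char (normal_law 0 s) t = char std_normal_distribution (sqrt s * t)"
  unfolding char_def normal_law_def
  by (subst integral_distr) (auto simp: mult_ac measurable_cong_sets[of std_normal_distribution borel])

text \<open>Standardizing divides by \<open>sqrt s\<close>, so \<open>s = 0\<close> is separate:
  then every \<open>X i\<close> is 0 almost surely and \<open>normal_law 0 0\<close> is the point
  mass at 0. For positive \<open>s\<close> the scale moves into the argument of the characteristic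
  function.\<close>

lemma (in prob_space) clt_normal_law:
  fixes X :: "nat \<Rightarrow> 'a \<Rightarrow> real"
  assumes indep: "indep_vars (\<lambda>_. borel) X UNIV"
    and distr: "\<And>i. distr M borel (X i) = \<mu>"
    and mean: "\<And>i. expectation (X i) = 0"
    and sq: "\<And>i. integrable M (\<lambda>\<omega>. (X i \<omega>)\<^sup>2)"
    and s: "\<And>i. expectation (\<lambda>\<omega>. (X i \<omega>)\<^sup>2) = s"
  shows "weak_conv_m (\<lambda>n. distr M borel (\<lambda>\<omega>. (1 / sqrt (real n)) * (\<Sum>i<n. X i \<omega>))) (normal_law 0 s)"
proof (rule levy_continuity[OF _ real_distribution_normal_law])
  have X[measurable]: "X i \<in> borel_measurable M" for i
    using indep by (auto simp: indep_vars_def)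
  show "real_distribution (distr M borel (\<lambda>\<omega>. (1 / sqrt (real n)) * (\<Sum>i<n. X i \<omega>)))" for n
    by (rule real_distribution_distr) measurable
  have s0: "s \<ge> 0" using s[of 0] by (metis Bochner_Integration.integral_nonneg zero_le_power2)
  fix t
  show "(\<lambda>n. char (distr M borel (\<lambda>\<omega>. (1 / sqrt (real n)) * (\<Sum>i<n. X i \<omega>))) t) \<longlonglongrightarrow> char (normal_law 0 s) t"
  proof (cases "s = 0")
    case True
    have "AE \<omega> in M. X i \<omega> = 0" for i
    proof -
      have "AE \<omega> in M. (X i \<omega>)\<^sup>2 = 0"
        using s[of i] True sq[of i] by (subst integral_nonneg_eq_0_iff_AE[symmetric]) auto
      then show ?thesis by simp
    qed
    then have AE0: "AE \<omega> in M. \<forall>i. X i \<omega> = 0" by (simp add: AE_all_countable)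
    have "char (distr M borel (\<lambda>\<omega>. (1 / sqrt (real n)) * (\<Sum>i<n. X i \<omega>))) t = 1" for n
    proof -
      have "expectation (\<lambda>\<omega>. iexp (t * ((1 / sqrt (real n)) * (\<Sum>i<n. X i \<omega>)))) = expectation (\<lambda>_. 1::complex)"
        by (rule integral_cong_AE) (use AE0 in \<open>auto elim!: AE_mp\<close>)
      then show ?thesis by (subst char_distr_eq) (auto simp: prob_space)
    qed
    moreover have "char (normal_law 0 s) t = 1"
      using True by (simp add: char_normal_law_0 real_distribution.char_zero[OF real_dist_normal_dist])
    ultimately show ?thesis by simp
  next
    case False
    then have spos: "sqrt s > 0" using s0 by simp
    have var: "variance (X i) = (sqrt s)\<^sup>2" for i
      using s0 by (simp add: mean s)
    have "weak_conv_m (\<lambda>n. distr M borel (\<lambda>\<omega>. (\<Sum>i<n. X i \<omega>) / sqrt (real n * (sqrt s)\<^sup>2))) std_normal_distribution"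
      by (rule central_limit_theorem_zero_mean[OF indep mean spos sq var distr])
    then have "(\<lambda>n. char (distr M borel (\<lambda>\<omega>. (\<Sum>i<n. X i \<omega>) / sqrt (real n * (sqrt s)\<^sup>2))) (sqrt s * t))
       \<longlonglongrightarrow> char std_normal_distribution (sqrt s * t)"
      by (intro levy_continuity1 real_dist_normal_dist) (rule real_distribution_distr, measurable)
    moreover have "char (distr M borel (\<lambda>\<omega>. (\<Sum>i<n. X i \<omega>) / sqrt (real n * (sqrt s)\<^sup>2))) (sqrt s * t) =
        char (distr M borel (\<lambda>\<omega>. (1 / sqrt (real n)) * (\<Sum>i<n. X i \<omega>))) t" for n
    proof -
      have "(sqrt s * t) * ((\<Sum>i<n. X i \<omega>) / sqrt (real n * (sqrt s)\<^sup>2)) = t * ((1 / sqrt (real n)) * (\<Sum>i<n. X i \<omega>))" for \<omega>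
        using spos s0 by (simp add: real_sqrt_mult field_simps)
      then show ?thesis by (subst (1 2) char_distr_eq) (auto simp only:, measurable)
    qed
    ultimately show ?thesis
      using s0 by (simp add: char_normal_law_0)
  qed
qed

text \<open>With \<open>S n\<close> the normalized sum, \<open>T n\<close> and
  \<open>b \<bullet> S n\<close> differ by \<open>(B n - b) \<bullet> S n\<close> up to a vanishing
  event, and this is small because \<open>S n\<close> has bounded second moment. What remains is a
  normalized sum of the scalars \<open>b \<bullet> W i\<close>, so joint convergence of the vector
  sum is never invoked.\<close>

theorem (in prob_space) clt_random_coefficients:
  fixes W B :: "nat \<Rightarrow> 'a \<Rightarrow> 'b::euclidean_space" and T :: "nat \<Rightarrow> 'a \<Rightarrow> real"
  assumes indep: "indep_vars (\<lambda>_. borel) W UNIV"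
    and distr: "\<And>i. distr M borel (W i) = \<mu>"
    and mean: "expectation (W 0) = 0"
    and sq: "integrable M (\<lambda>\<omega>. (norm (W 0 \<omega>))\<^sup>2)"
    and B: "conv_in_prob M B b" and [measurable]: "\<And>n. B n \<in> borel_measurable M"
    and [measurable]: "\<And>n. T n \<in> borel_measurable M"
    and T: "(\<lambda>n. prob {\<omega> \<in> space M. T n \<omega> \<noteq> B n \<omega> \<bullet> ((1 / sqrt (real n)) *\<^sub>R (\<Sum>i<n. W i \<omega>))}) \<longlonglongrightarrow> 0"
  shows "weak_conv_m (\<lambda>n. distr M borel (T n)) (normal_law 0 (expectation (\<lambda>\<omega>. (b \<bullet> W 0 \<omega>)\<^sup>2)))"
proof -
  have W[measurable]: "W i \<in> borel_measurable M" for i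
    using indep by (auto simp: indep_vars_def)
  have same_distr: "distr M borel (W i) = distr M borel (W 0)" for i
    by (simp add: distr)
  have sqW: "integrable M (\<lambda>\<omega>. (norm (W i \<omega>))\<^sup>2)" for i
    using integrable_cong_distr[OF W W same_distr, of "\<lambda>x. (norm x)\<^sup>2" i] sq by simp
  have meanW: "expectation (W i) = 0" for i
    using integral_cong_distr[OF W W same_distr, of "\<lambda>x. x" i] mean by simp
  define C where "C = expectation (\<lambda>\<omega>. (norm (W 0 \<omega>))\<^sup>2)"
  have C0: "C \<ge> 0" unfolding C_def by (rule Bochner_Integration.integral_nonneg) simp
  have CW: "expectation (\<lambda>\<omega>. (norm (W i \<omega>))\<^sup>2) = C" for i
    unfolding C_def
    by (rule integral_cong_distr[OF W W same_distr, where g="\<lambda>x. (norm x)\<^sup>2"]) measurable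
  define S where "S n \<omega> = (1 / sqrt (real n)) *\<^sub>R (\<Sum>i<n. W i \<omega>)" for n \<omega>
  have S[measurable]: "S n \<in> borel_measurable M" for n
    unfolding S_def by measurable
  have normS: "(norm (S n \<omega>))\<^sup>2 = (1 / real n) * (norm (\<Sum>i<n. W i \<omega>))\<^sup>2" for n \<omega>
    by (simp add: S_def power_mult_distrib power_divide)
  have intS: "integrable M (\<lambda>\<omega>. (norm (S n \<omega>))\<^sup>2)" for n
    unfolding normS by (intro integrable_mult_right second_moment_sum indep sqW meanW)
  \<comment> \<open>Equality holds for positive \<open>n\<close>. At \<open>n = 0\<close> the factor
    \<open>1 / sqrt 0\<close> is 0 and the left side vanishes, so the uniform statement is an
    inequality.\<close>
  have ES: "expectation (\<lambda>\<omega>. (norm (S n \<omega>))\<^sup>2) \<le> C" for n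
  proof -
    have "expectation (\<lambda>\<omega>. (norm (S n \<omega>))\<^sup>2) = (1 / real n) * (real n * C)"
      unfolding normS by (simp only: integral_mult_right_zero second_moment_sum(2)[OF indep sqW meanW] CW) simp
    also have "\<dots> \<le> C" using C0 by simp
    finally show ?thesis .
  qed
  have diff: "conv_in_prob M (\<lambda>n \<omega>. (B n \<omega> - b) \<bullet> S n \<omega>) 0"
  proof (rule conv_in_prob_inner_bounded[OF _ _ _ intS ES])
    show "conv_in_prob M (\<lambda>n \<omega>. B n \<omega> - b) 0"
      using B by (simp add: conv_in_prob_def dist_norm)
  qed measurable
  have conv: "conv_in_prob M (\<lambda>n \<omega>. T n \<omega> - b \<bullet> S n \<omega>) 0"
  proof (rule conv_in_prob_transfer[OF diff])
    have "{\<omega> \<in> space M. T n \<omega> - b \<bullet> S n \<omega> \<noteq> (B n \<omega> - b) \<bullet> S n \<omega>} = {\<omega> \<in> space M. T n \<omega> \<noteq> B n \<omega> \<bullet> S n \<omega>}" for n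
      by (auto simp: inner_diff_left)
    then show "(\<lambda>n. prob {\<omega> \<in> space M. T n \<omega> - b \<bullet> S n \<omega> \<noteq> (B n \<omega> - b) \<bullet> S n \<omega>}) \<longlonglongrightarrow> 0"
      using T by (simp only: S_def)
  qed measurable
  have lin: "b \<bullet> S n \<omega> = (1 / sqrt (real n)) * (\<Sum>i<n. b \<bullet> W i \<omega>)" for n \<omega>
    by (simp add: S_def inner_sum_right)
  have int_bW: "integrable M (\<lambda>\<omega>. (b \<bullet> W i \<omega>)\<^sup>2)" for i
  proof (rule Bochner_Integration.integrable_bound)
    show "integrable M (\<lambda>\<omega>. (norm b)\<^sup>2 * (norm (W i \<omega>))\<^sup>2)" using sqW by simp
    show "AE \<omega> in M. norm ((b \<bullet> W i \<omega>)\<^sup>2) \<le> norm ((norm b)\<^sup>2 * (norm (W i \<omega>))\<^sup>2)"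
      using power_mono[OF Cauchy_Schwarz_ineq2, of b _ 2] by (intro AE_I2) (simp add: power_mult_distrib)
  qed measurable
  have intW: "integrable M (W i)" for i
    by (rule integrable_if_norm_sq[OF _ sqW]) measurable
  have clt: "weak_conv_m (\<lambda>n. distr M borel (\<lambda>\<omega>. (1 / sqrt (real n)) * (\<Sum>i<n. b \<bullet> W i \<omega>)))
      (normal_law 0 (expectation (\<lambda>\<omega>. (b \<bullet> W 0 \<omega>)\<^sup>2)))"
  proof (rule clt_normal_law)
    show "indep_vars (\<lambda>_. borel) (\<lambda>i \<omega>. b \<bullet> W i \<omega>) UNIV"
      by (rule indep_vars_compose2[OF indep]) measurable
    show "distr M borel (\<lambda>\<omega>. b \<bullet> W i \<omega>) = distr \<mu> borel (\<lambda>x. b \<bullet> x)" for i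
      by (subst distr[of i, symmetric], subst distr_distr) (auto simp: comp_def)
    show "expectation (\<lambda>\<omega>. b \<bullet> W i \<omega>) = 0" for i
      using integral_inner_right[of b M "W i"] intW[of i] meanW[of i] by simp
    show "expectation (\<lambda>\<omega>. (b \<bullet> W i \<omega>)\<^sup>2) = expectation (\<lambda>\<omega>. (b \<bullet> W 0 \<omega>)\<^sup>2)" for i
      by (rule integral_cong_distr[OF W W same_distr, where g="\<lambda>x. (b \<bullet> x)\<^sup>2"]) measurable
  qed (rule int_bW)
  show ?thesis
    by (rule weak_conv_m_slutsky[OF _ _ real_distribution_normal_law clt[folded lin] conv]) measurable
qed

subsection \<open>Analytic properties of matrix operations\<close>

lemma
  fixes A :: "real^'n^'n"
  assumes "invertible A"
  shows matrix_inv_right: "A ** matrix_inv A = mat 1"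
    and matrix_inv_left: "matrix_inv A ** A = mat 1"
proof -
  have "A ** matrix_inv A = mat 1 \<and> matrix_inv A ** A = mat 1"
    using assms unfolding invertible_def matrix_inv_def by (rule someI_ex)
  then show "A ** matrix_inv A = mat 1" "matrix_inv A ** A = mat 1" by auto
qed

lemma matrix_inv_unique:
  fixes A B :: "real^'n^'n"
  assumes "A ** B = mat 1"
  shows "matrix_inv A = B"
proof -
  have "invertible A"
    using assms by (auto simp: invertible_right_inverse)
  then have "matrix_inv A = matrix_inv A ** (A ** B)"
    by (simp add: assms)
  also have "\<dots> = B"
    by (simp add: matrix_mul_assoc matrix_inv_left \<open>invertible A\<close>)
  finally show ?thesis .
qed

lemma matrix_inv_scaleR:
  fixes A :: "real^'n^'n"
  assumes "invertible A" "c \<noteq> 0"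
  shows "matrix_inv (c *\<^sub>R A) = (1 / c) *\<^sub>R matrix_inv A"
  by (rule matrix_inv_unique)
    (use assms in \<open>simp add: matrix_scalar_ac scalar_matrix_assoc[symmetric] matrix_inv_right\<close>)

lemma transpose_matrix_inv:
  fixes A :: "real^'n^'n"
  assumes "invertible A"
  shows "transpose (matrix_inv A) = matrix_inv (transpose A)"
  by (rule matrix_inv_unique[symmetric])
    (simp add: matrix_transpose_mul[symmetric] matrix_inv_left assms)

text \<open>Cramer's rule applied to the columns of the inverse. It exhibits each entry as a
  quotient of polynomials in the entries of \<open>A\<close>, from which continuity follows.\<close>

lemma matrix_inv_cramer:
  fixes A :: "real^'n^'n"
  assumes "invertible A"
  shows "matrix_inv A = (\<chi> k l. det (\<chi> i j. if j = k then axis l 1 $ i else A $ i $ j) / det A)"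
proof -
  have "matrix_inv A *v axis l 1 = (\<chi> k. det (\<chi> i j. if j = k then axis l 1 $ i else A $ i $ j) / det A)" for l
    using assms
    by (subst cramer[symmetric]) (auto simp: matrix_vector_mul_assoc matrix_inv_right invertible_det_nz)
  then show ?thesis
    by (simp add: vec_eq_iff matrix_vector_mult_basis column_def)
qed

lemma tendsto_det [tendsto_intros]:
  fixes f :: "'a \<Rightarrow> real^'n^'n"
  assumes "(f \<longlongrightarrow> A) F"
  shows "((\<lambda>x. det (f x)) \<longlongrightarrow> det A) F"
  unfolding det_def by (intro tendsto_intros assms)

lemma tendsto_matrix_vector_mult [tendsto_intros]:
  fixes f :: "'a \<Rightarrow> real^'n^'m"
  assumes "(f \<longlongrightarrow> A) F" "(g \<longlongrightarrow> b) F"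
  shows "((\<lambda>x. f x *v g x) \<longlongrightarrow> A *v b) F"
  unfolding matrix_vector_mult_def by (intro tendsto_intros assms)

lemma tendsto_vector_matrix_mult [tendsto_intros]:
  fixes f :: "'a \<Rightarrow> real^'n^'m"
  assumes "(g \<longlongrightarrow> b) F" "(f \<longlongrightarrow> A) F"
  shows "((\<lambda>x. g x v* f x) \<longlongrightarrow> b v* A) F"
  unfolding vector_matrix_mult_def by (intro tendsto_intros assms)

lemma tendsto_matrix_mult [tendsto_intros]:
  fixes f :: "'a \<Rightarrow> real^'n^'m" and g :: "'a \<Rightarrow> real^'k^'n"
  assumes "(f \<longlongrightarrow> A) F" "(g \<longlongrightarrow> B) F"
  shows "((\<lambda>x. f x ** g x) \<longlongrightarrow> A ** B) F"
  unfolding matrix_matrix_mult_def by (intro tendsto_intros assms)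

lemma open_invertible: "open {A :: real^'n^'n. invertible A}"
proof -
  have "continuous_on UNIV (det :: real^'n^'n \<Rightarrow> real)"
    unfolding continuous_on_def by (intro ballI tendsto_intros)
  then show ?thesis
    unfolding invertible_det_nz by (intro open_Collect_neq continuous_on_const)
qed

lemma isCont_matrix_inv:
  fixes A :: "real^'n^'n"
  assumes "invertible A"
  shows "isCont matrix_inv A"
proof -
  let ?f = "\<lambda>A :: real^'n^'n. \<chi> k l. det (\<chi> i j. if j = k then axis l 1 $ i else A $ i $ j) / det A"
  have *: "((\<lambda>A. if j = k then axis l 1 $ i else A $ i $ j) \<longlongrightarrow>
      (if j = k then axis l 1 $ i else A $ i $ j)) (at A)" for i j k l
    by (cases "j = k") (auto intro!: tendsto_intros)
  have "det A \<noteq> 0" using assms by (simp add: invertible_det_nz)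
  then have "(?f \<longlongrightarrow> ?f A) (at A)"
    by (intro tendsto_intros *)
  \<comment> \<open>The Cramer formula is available only for invertible matrices; these form an open
    set, hence a neighbourhood of \<open>A\<close>.\<close>
  moreover have "\<forall>\<^sub>F B in at A. ?f B = matrix_inv B"
    unfolding eventually_at_topological
    using open_invertible assms
    by (intro exI[of _ "{A. invertible A}"]) (auto intro!: matrix_inv_cramer[symmetric])
  ultimately have "(matrix_inv \<longlongrightarrow> ?f A) (at A)"
    by (rule Lim_transform_eventually)
  then show ?thesis
    using matrix_inv_cramer[OF assms] by (simp add: isCont_def)
qed

lemma tendsto_matrix_inv [tendsto_intros]:
  fixes f :: "'a \<Rightarrow> real^'n^'n"
  assumes "(f \<longlongrightarrow> A) F" "invertible A"
  shows "((\<lambda>x. matrix_inv (f x)) \<longlongrightarrow> matrix_inv A) F"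
  by (rule isCont_tendsto_compose[OF isCont_matrix_inv]) (use assms in auto)

lemma borel_measurable_tendsto2:
  fixes H :: "'b::{second_countable_topology} \<Rightarrow> 'c::{second_countable_topology} \<Rightarrow> 'd::topological_space"
  assumes H: "\<And>a b. ((\<lambda>x. H (fst x) (snd x)) \<longlongrightarrow> H a b) (at (a, b))"
    and [measurable]: "f \<in> borel_measurable M" "g \<in> borel_measurable M"
  shows "(\<lambda>x. H (f x) (g x)) \<in> borel_measurable M"
proof -
  have "continuous_on UNIV (\<lambda>x. H (fst x) (snd x))"
    unfolding continuous_on_def using H by auto
  then have [measurable]: "(\<lambda>x. H (fst x) (snd x)) \<in> borel_measurable borel"
    by (rule borel_measurable_continuous_onI)
  have "(\<lambda>x. (\<lambda>x. H (fst x) (snd x)) (f x, g x)) \<in> borel_measurable M"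
    by measurable
  then show ?thesis by simp
qed

lemma borel_measurable_matrix_vector_mult [measurable (raw)]:
  fixes f :: "'a \<Rightarrow> real^'n^'m"
  assumes "f \<in> borel_measurable M" "g \<in> borel_measurable M"
  shows "(\<lambda>x. f x *v g x) \<in> borel_measurable M"
  by (rule borel_measurable_tendsto2[OF _ assms]) (auto intro!: tendsto_eq_intros)

lemma borel_measurable_vector_matrix_mult [measurable (raw)]:
  fixes f :: "'a \<Rightarrow> real^'n^'m"
  assumes "g \<in> borel_measurable M" "f \<in> borel_measurable M"
  shows "(\<lambda>x. g x v* f x) \<in> borel_measurable M"
  by (rule borel_measurable_tendsto2[OF _ assms]) (auto intro!: tendsto_eq_intros)

lemma borel_measurable_matrix_mult [measurable (raw)]:
  fixes f :: "'a \<Rightarrow> real^'n^'m" and g :: "'a \<Rightarrow> real^'k^'n"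
  assumes "f \<in> borel_measurable M" "g \<in> borel_measurable M"
  shows "(\<lambda>x. f x ** g x) \<in> borel_measurable M"
  by (rule borel_measurable_tendsto2[OF _ assms]) (auto intro!: tendsto_eq_intros)

text \<open>On singular matrices \<open>matrix_inv\<close> is \<open>SOME\<close> of an empty predicate, hence constant.\<close>

lemma borel_measurable_matrix_inv [measurable (raw)]:
  fixes f :: "'a \<Rightarrow> real^'n^'n"
  assumes [measurable]: "f \<in> borel_measurable M"
  shows "(\<lambda>x. matrix_inv (f x)) \<in> borel_measurable M"
proof -
  define S where "S = {A :: real^'n^'n. invertible A}"
  have "matrix_inv A = (SOME A'. False)" if "A \<notin> S" for A :: "real^'n^'n"
  proof -
    have "(\<lambda>A'. A ** A' = mat 1 \<and> A' ** A = mat 1) = (\<lambda>_. False)"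
      using that by (auto simp: S_def invertible_def fun_eq_iff)
    then show ?thesis by (simp only: matrix_inv_def)
  qed
  then have "matrix_inv = (\<lambda>A :: real^'n^'n. if A \<in> S then matrix_inv A else (SOME A'. False))"
    by auto
  also have "\<dots> \<in> borel_measurable borel"
  proof (rule borel_measurable_continuous_on_if)
    show "S \<in> sets borel" unfolding S_def using open_invertible by (rule borel_open)
    show "continuous_on S matrix_inv"
      by (intro continuous_at_imp_continuous_on ballI isCont_matrix_inv) (simp add: S_def)
  qed (rule continuous_on_const)
  finally have [measurable]: "(matrix_inv :: real^'n^'n \<Rightarrow> _) \<in> borel_measurable borel" .
  show ?thesis by measurable
qed

lemma bounded_linear_matrix_mult_vec: "bounded_linear (\<lambda>A :: real^'n^'n. A *v b)"
  unfolding linear_conv_bounded_linear[symmetric]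
  by (rule linearI) (simp_all add: matrix_vector_mult_add_rdistrib scaleR_matrix_vector_assoc[symmetric])

lemma bounded_linear_transpose: "bounded_linear (transpose :: real^'n^'n \<Rightarrow> real^'n^'n)"
  unfolding linear_conv_bounded_linear[symmetric]
  by (rule linearI) (simp_all add: transpose_scalar, simp add: transpose_def vec_eq_iff)

subsection \<open>The estimation error of regression imputation\<close>

lemma borel_measurable_outer [measurable (raw)]:
  fixes f g :: "'a \<Rightarrow> real^'n"
  assumes "f \<in> borel_measurable M" "g \<in> borel_measurable M"
  shows "(\<lambda>x. outer (f x) (g x)) \<in> borel_measurable M"
  by (rule borel_measurable_tendsto2[OF _ assms])
    (auto simp: outer_def intro!: tendsto_eq_intros)

lemma outer_mult_vec: "outer a b *v c = (b \<bullet> c) *\<^sub>R (a :: real^'n)"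
  by (simp add: vec_eq_iff outer_def matrix_vector_mult_def inner_vec_def sum_distrib_left mult_ac)

lemma sum_matrix_vector_mult: "(\<Sum>i\<in>S. A i) *v (c :: real^'n) = (\<Sum>i\<in>S. A i *v c)"
  by (induction S rule: infinite_finite_induct) (simp_all add: matrix_vector_mult_add_rdistrib)

lemma gram_mult_vec: "gram S z *v c = (\<Sum>i\<in>S. (z i \<bullet> c) *\<^sub>R z i)"
  by (simp add: gram_def sum_matrix_vector_mult outer_mult_vec)

text \<open>Trades the growing \<open>n \<times> n\<close> projection for moments of fixed
  dimension, to which the law of large numbers applies.\<close>

lemma proj_form_eq:
  "proj_form n z a b = cross {..<n} z a \<bullet> (matrix_inv (gram {..<n} z) *v cross {..<n} z b)"
  by (simp add: proj_form_def proj_Z_def cross_def inner_sum_left inner_sum_right linear_sum[OF matrix_vector_mul_linear]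
      matrix_vector_mult_scaleR sum_distrib_left mult_ac) (rule sum.swap)

text \<open>In the next definitions \<open>G\<close>, \<open>G0\<close>, \<open>g\<close> stand for \<open>Z'Z/n\<close>, \<open>Z\<^sub>0'Z\<^sub>0/n\<close>, \<open>Z\<^sub>0'x\<^sub>0/n\<close>.  For these values
  \<open>imputed_cross_moment\<close> is \<open>Z'x/n\<close> with the imputed \<open>x\<close>, and \<open>RI_coeffs\<close> collects the coefficients
  \<open>c\<^sub>n\<close> and \<open>- \<beta> A\<^sub>n' c\<^sub>n\<close> of the two score sums.\<close>

definition imputed_cross_moment :: "real^'L^'L \<Rightarrow> real^'L^'L \<Rightarrow> real^'L \<Rightarrow> real^'L" where
  "imputed_cross_moment G G0 g = g + ((G - G0) ** matrix_inv G0) *v g"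

definition first_stage_form :: "real^'L^'L \<Rightarrow> real^'L^'L \<Rightarrow> real^'L \<Rightarrow> real" where
  "first_stage_form G G0 g = imputed_cross_moment G G0 g \<bullet> (matrix_inv G *v imputed_cross_moment G G0 g)"

definition score_coeff :: "real^'L^'L \<Rightarrow> real^'L^'L \<Rightarrow> real^'L \<Rightarrow> real^'L" where
  "score_coeff G G0 g = inverse (first_stage_form G G0 g) *\<^sub>R (imputed_cross_moment G G0 g v* matrix_inv G)"

definition RI_coeffs :: "real \<Rightarrow> real^'L^'L \<Rightarrow> real^'L^'L \<Rightarrow> real^'L \<Rightarrow> (real^'L) \<times> (real^'L)" where
  "RI_coeffs \<beta> G G0 g =
     (score_coeff G G0 g, (- \<beta>) *\<^sub>R (score_coeff G G0 g v* ((G - G0) ** matrix_inv G0)))"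

lemma tendsto_first_stage_form:
  assumes "invertible G" "invertible G0"
  shows "((\<lambda>t. first_stage_form (fst t) (fst (snd t)) (snd (snd t))) \<longlongrightarrow> first_stage_form G G0 g) (at (G, G0, g))"
  unfolding first_stage_form_def imputed_cross_moment_def
  using assms by (auto intro!: tendsto_eq_intros)

lemma isCont_RI_coeffs:
  assumes "invertible G" "invertible G0" "first_stage_form G G0 g \<noteq> 0"
  shows "isCont (\<lambda>t. RI_coeffs \<beta> (fst t) (fst (snd t)) (snd (snd t))) (G, G0, g)"
  unfolding isCont_def RI_coeffs_def score_coeff_def fst_conv snd_conv imputed_cross_moment_def
  using assms
  by (auto intro!: tendsto_intros tendsto_first_stage_form
    tendsto_fst[where a="(G, G0, g)", simplified]
    tendsto_fst[OF tendsto_snd[where a="(G, G0, g)"], simplified] tendsto_snd[OF tendsto_snd[where a="(G, G0, g)"], simplified])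

lemma borel_measurable_first_stage_form [measurable (raw)]:
  assumes [measurable]: "G \<in> borel_measurable M" "G0 \<in> borel_measurable M" "g \<in> borel_measurable M"
  shows "(\<lambda>x. first_stage_form (G x) (G0 x) (g x)) \<in> borel_measurable M"
  unfolding first_stage_form_def imputed_cross_moment_def by measurable

lemma borel_measurable_RI_coeffs [measurable (raw)]:
  assumes [measurable]: "G \<in> borel_measurable M" "G0 \<in> borel_measurable M" "g \<in> borel_measurable M"
  shows "(\<lambda>x. RI_coeffs \<beta> (G x) (G0 x) (g x)) \<in> borel_measurable M"
  unfolding RI_coeffs_def score_coeff_def imputed_cross_moment_def by measurable

text \<open>Pure algebra for one realized sample. Invertibility of \<open>G\<close> and
  \<open>G0\<close> gives \<open>matrix_inv\<close> its meaning, and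
  \<open>first_stage_form G G0 g\<close> is the denominator of the estimator divided by
  \<open>n\<close>.\<close>

lemma beta_RI_error:
  fixes z :: "nat \<Rightarrow> real^'L" and x y u v :: "nat \<Rightarrow> real" and m :: "nat \<Rightarrow> bool"
  assumes n: "n > 0"
    and y: "\<And>i. i < n \<Longrightarrow> y i = x i * \<beta> + u i" and x: "\<And>i. i < n \<Longrightarrow> x i = z i \<bullet> \<pi> + v i"
  defines "G \<equiv> (1 / real n) *\<^sub>R gram {..<n} z"
    and "G0 \<equiv> (1 / real n) *\<^sub>R gram (complete_obs n m) z"
    and "g \<equiv> (1 / real n) *\<^sub>R cross (complete_obs n m) z x"
  assumes G: "invertible G" and G0: "invertible G0" and d: "first_stage_form G G0 g \<noteq> 0"
  shows "sqrt (real n) * (beta_RI n y x z m - \<beta>) =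
    RI_coeffs \<beta> G G0 g \<bullet> ((1 / sqrt (real n)) *\<^sub>R
      (\<Sum>i<n. ((u i + \<beta> * of_bool (m i) * v i) *\<^sub>R z i, (of_bool (\<not> m i) * v i) *\<^sub>R z i)))"
proof -
  let ?c = "complete_obs n m" and ?i = "incomplete_obs n m"
  have split: "(\<Sum>i<n. f i) = (\<Sum>i\<in>?c. f i) + (\<Sum>i\<in>?i. f i)" for f :: "nat \<Rightarrow> 'b::comm_monoid_add"
  proof -
    have "{..<n} = ?c \<union> ?i" "?c \<inter> ?i = {}"
      by (auto simp: complete_obs_def incomplete_obs_def)
    moreover have "finite ?c" "finite ?i"
      by (auto simp: complete_obs_def incomplete_obs_def)
    ultimately show ?thesis by (metis sum.union_disjoint)
  qed
  have gram_all: "gram {..<n} z = real n *\<^sub>R G" and gram_c: "gram ?c z = real n *\<^sub>R G0"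
    and cross_c: "cross ?c z x = real n *\<^sub>R g"
    using n by (simp_all add: G_def G0_def g_def)
  have gram_i: "gram ?i z = real n *\<^sub>R (G - G0)"
  proof -
    have "gram {..<n} z = gram ?c z + gram ?i z"
      unfolding gram_def by (rule split)
    then show ?thesis by (simp add: gram_all gram_c algebra_simps)
  qed
  define A where "A = (G - G0) ** matrix_inv G0"
  define h where "h = imputed_cross_moment G G0 g"
  have h: "h = g + A *v g" by (simp add: h_def A_def imputed_cross_moment_def)
  define p where "p = matrix_inv G0 *v g"
  have pi_CC: "pi_CC n x z m = p"
    using n by (simp add: pi_CC_def gram_c cross_c matrix_inv_scaleR G0 p_def
        matrix_vector_mult_scaleR scaleR_matrix_vector_assoc[symmetric])
  let ?x = "imputed n x z m"
  have cross_x: "cross {..<n} z ?x = real n *\<^sub>R h"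
  proof -
    have "cross {..<n} z ?x = (\<Sum>i\<in>?c. x i *\<^sub>R z i) + (\<Sum>i\<in>?i. (z i \<bullet> p) *\<^sub>R z i)"
      unfolding cross_def split
      by (intro arg_cong2[where f="(+)"] sum.cong) (auto simp: imputed_def pi_CC complete_obs_def incomplete_obs_def)
    also have "\<dots> = cross ?c z x + gram ?i z *v p"
      by (simp add: cross_def gram_mult_vec)
    also have "gram ?i z *v p = real n *\<^sub>R (A *v g)"
      unfolding gram_i scaleR_matrix_vector_assoc[symmetric] by (simp add: A_def p_def matrix_vector_mul_assoc)
    also have "cross ?c z x + \<dots> = real n *\<^sub>R h"
      by (simp add: cross_c h scaleR_right_distrib)
    finally show ?thesis .
  qed
  define s where "s = (\<Sum>i\<in>?c. v i *\<^sub>R z i)"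
  define r where "r = (\<Sum>i<n. (u i + \<beta> * of_bool (m i) * v i) *\<^sub>R z i)"
  have s_eq: "s = (\<Sum>i<n. (of_bool (\<not> m i) * v i) *\<^sub>R z i)"
    unfolding s_def split by (subst add.commute, subst sum.neutral) (auto simp: complete_obs_def incomplete_obs_def)
  have g_eq: "real n *\<^sub>R g = real n *\<^sub>R (G0 *v \<pi>) + s"
  proof -
    have "real n *\<^sub>R g = (\<Sum>i\<in>?c. (z i \<bullet> \<pi> + v i) *\<^sub>R z i)"
      unfolding cross_c[symmetric] cross_def by (intro sum.cong) (auto simp: x complete_obs_def)
    also have "\<dots> = gram ?c z *v \<pi> + s"
      by (simp add: gram_mult_vec s_def scaleR_left_distrib sum.distrib)
    finally show ?thesis by (simp add: gram_c scaleR_matrix_vector_assoc[symmetric])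
  qed
  have p_eq: "real n *\<^sub>R (p - \<pi>) = matrix_inv G0 *v s"
  proof -
    have "matrix_inv G0 *v (real n *\<^sub>R g) = matrix_inv G0 *v (real n *\<^sub>R (G0 *v \<pi>) + s)"
      by (simp add: g_eq)
    then show ?thesis
      by (simp add: p_def matrix_vector_mult_scaleR matrix_vector_right_distrib matrix_vector_mul_assoc
          matrix_inv_left G0 scaleR_diff_right)
  qed
  \<comment> \<open>With \<open>?x\<close> the imputed regressor, \<open>y - \<beta> ?x\<close> is
    \<open>u + \<beta> (x - ?x)\<close>. The difference \<open>x - ?x\<close> is 0 on complete
    observations, so only the incomplete Gram matrix multiplies \<open>p - \<pi>\<close>.\<close>
  have cross_y: "cross {..<n} z y = \<beta> *\<^sub>R cross {..<n} z ?x + (r - \<beta> *\<^sub>R (A *v s))"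
  proof -
    have "cross {..<n} z y - \<beta> *\<^sub>R cross {..<n} z ?x = (\<Sum>i<n. (u i + \<beta> * (x i - ?x i)) *\<^sub>R z i)"
      unfolding cross_def scaleR_sum_right sum_subtractf[symmetric]
      by (intro sum.cong) (auto simp: y algebra_simps)
    also have "\<dots> = (\<Sum>i<n. (u i + \<beta> * of_bool (m i) * v i) *\<^sub>R z i
        - \<beta> *\<^sub>R (if m i then (z i \<bullet> (p - \<pi>)) *\<^sub>R z i else 0))"
      by (intro sum.cong) (auto simp: imputed_def pi_CC x algebra_simps inner_diff_right)
    also have "\<dots> = r - \<beta> *\<^sub>R (\<Sum>i<n. (if m i then (z i \<bullet> (p - \<pi>)) *\<^sub>R z i else 0))"
      by (simp add: r_def sum_subtractf scaleR_sum_right)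
    also have "(\<Sum>i<n. (if m i then (z i \<bullet> (p - \<pi>)) *\<^sub>R z i else 0)) = gram ?i z *v (p - \<pi>)"
      unfolding gram_mult_vec split
      by (subst sum.neutral) (auto simp: complete_obs_def incomplete_obs_def intro!: sum.cong)
    also have "\<dots> = (G - G0) *v (real n *\<^sub>R (p - \<pi>))"
      by (simp add: gram_i scaleR_matrix_vector_assoc[symmetric] matrix_vector_mult_scaleR)
    also have "\<dots> = A *v s"
      by (simp add: p_eq A_def matrix_vector_mul_assoc)
    finally show ?thesis by (simp add: algebra_simps)
  qed
  define D where "D = first_stage_form G G0 g"
  have D: "D = h \<bullet> (matrix_inv G *v h)" by (simp add: D_def first_stage_form_def h_def)
  have D0: "D \<noteq> 0" using d by (simp add: D_def)
  have form: "proj_form n z ?x b = h \<bullet> (matrix_inv G *v cross {..<n} z b)" for b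
    using n by (simp add: proj_form_eq cross_x gram_all matrix_inv_scaleR G scaleR_matrix_vector_assoc[symmetric])
  have den: "proj_form n z ?x ?x = real n * D"
    by (simp add: form cross_x D matrix_vector_mult_scaleR)
  define w where "w = r - \<beta> *\<^sub>R (A *v s)"
  \<comment> \<open>The first term is \<beta> times the denominator \<open>den\<close>; subtracting
    \<beta> from the estimator removes it exactly.\<close>
  have num: "proj_form n z ?x y = \<beta> * (real n * D) + h \<bullet> (matrix_inv G *v w)"
    by (simp add: form cross_y cross_x w_def[symmetric] D matrix_vector_mult_scaleR matrix_vector_right_distrib inner_add_right)
  have "beta_RI n y x z m - \<beta> = inverse (real n) * (inverse D * (h \<bullet> (matrix_inv G *v w)))"
    using n D0 by (simp add: beta_RI_def den num field_simps)
  also have "inverse D * (h \<bullet> (matrix_inv G *v w)) = score_coeff G G0 g \<bullet> w"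
    by (simp add: score_coeff_def D_def[symmetric] h_def[symmetric] dot_lmul_matrix)
  \<comment> \<open>Moving \<open>A\<close> from \<open>s\<close> to the other side of the inner
    product yields the second component of \<open>RI_coeffs\<close>; the inner product of pairs adds
    the two components.\<close>
  also have "score_coeff G G0 g \<bullet> w = RI_coeffs \<beta> G G0 g \<bullet> (r, s)"
    by (simp add: RI_coeffs_def w_def inner_diff_right A_def[symmetric] dot_lmul_matrix)
  also have "(r, s) = (\<Sum>i<n. ((u i + \<beta> * of_bool (m i) * v i) *\<^sub>R z i, (of_bool (\<not> m i) * v i) *\<^sub>R z i))"
    by (simp add: r_def s_eq sum_prod)
  finally have "beta_RI n y x z m - \<beta> = inverse (real n) * (RI_coeffs \<beta> G G0 g \<bullet>
      (\<Sum>i<n. ((u i + \<beta> * of_bool (m i) * v i) *\<^sub>R z i, (of_bool (\<not> m i) * v i) *\<^sub>R z i)))" .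
  moreover have "sqrt (real n) * inverse (real n) = 1 / sqrt (real n)"
    using n by (simp add: field_simps)
  ultimately show ?thesis
    by (simp only: inner_scaleR_right mult.assoc[symmetric])
qed

lemma gram_complete_obs: "gram (complete_obs n m) z = (\<Sum>i<n. of_bool (\<not> m i) *\<^sub>R outer (z i) (z i))"
proof -
  have "gram (complete_obs n m) z = (\<Sum>i\<in>{i \<in> {..<n}. \<not> m i}. outer (z i) (z i))"
    by (simp add: gram_def complete_obs_def lessThan_def Collect_conj_eq)
  also have "\<dots> = (\<Sum>i<n. if \<not> m i then outer (z i) (z i) else 0)"
    by (rule sum.inter_filter) simp
  also have "\<dots> = (\<Sum>i<n. of_bool (\<not> m i) *\<^sub>R outer (z i) (z i))"
    by (rule sum.cong) auto
  finally show ?thesis .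
qed

lemma gram_incomplete_obs: "gram (incomplete_obs n m) z = (\<Sum>i<n. of_bool (m i) *\<^sub>R outer (z i) (z i))"
  using gram_complete_obs[of n "\<lambda>i. \<not> m i" z] by (simp add: complete_obs_def incomplete_obs_def)

lemma cross_complete_obs: "cross (complete_obs n m) z x = (\<Sum>i<n. (of_bool (\<not> m i) * x i) *\<^sub>R z i)"
proof -
  have "cross (complete_obs n m) z x = (\<Sum>i\<in>{i \<in> {..<n}. \<not> m i}. x i *\<^sub>R z i)"
    by (simp add: cross_def complete_obs_def lessThan_def Collect_conj_eq)
  also have "\<dots> = (\<Sum>i<n. if \<not> m i then x i *\<^sub>R z i else 0)"
    by (rule sum.inter_filter) simp
  also have "\<dots> = (\<Sum>i<n. (of_bool (\<not> m i) * x i) *\<^sub>R z i)"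
    by (rule sum.cong) auto
  finally show ?thesis .
qed

lemma card_complete_obs: "real (card (complete_obs n m)) = (\<Sum>i<n. of_bool (\<not> m i))"
proof -
  have "real (card (complete_obs n m)) = (\<Sum>i\<in>{i \<in> {..<n}. \<not> m i}. 1)"
    by (simp add: complete_obs_def lessThan_def Collect_conj_eq)
  also have "\<dots> = (\<Sum>i<n. if \<not> m i then 1 else 0)"
    by (rule sum.inter_filter) simp
  also have "\<dots> = (\<Sum>i<n. of_bool (\<not> m i))"
    by (rule sum.cong) auto
  finally show ?thesis .
qed

lemma card_incomplete_obs: "real (card (incomplete_obs n m)) = (\<Sum>i<n. of_bool (m i))"
  using card_complete_obs[of n "\<lambda>i. \<not> m i"] by (simp add: complete_obs_def incomplete_obs_def)

lemma borel_measurable_beta_RI: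
  fixes z :: "nat \<Rightarrow> 'a \<Rightarrow> real^'L" and x y :: "nat \<Rightarrow> 'a \<Rightarrow> real"
  assumes [measurable]: "\<And>i. y i \<in> borel_measurable M" "\<And>i. x i \<in> borel_measurable M"
    "\<And>i. z i \<in> borel_measurable M" "\<And>i. m i \<in> measurable M (count_space UNIV)"
  shows "(\<lambda>\<omega>. beta_RI n (\<lambda>i. y i \<omega>) (\<lambda>i. x i \<omega>) (\<lambda>i. z i \<omega>) (\<lambda>i. m i \<omega>)) \<in> borel_measurable M"
proof -
  have [measurable]: "(\<lambda>\<omega>. pi_CC n (\<lambda>i. x i \<omega>) (\<lambda>i. z i \<omega>) (\<lambda>i. m i \<omega>)) \<in> borel_measurable M"
    unfolding pi_CC_def gram_complete_obs cross_complete_obs by measurable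
  have [measurable]: "(\<lambda>\<omega>. imputed n (\<lambda>i. x i \<omega>) (\<lambda>i. z i \<omega>) (\<lambda>i. m i \<omega>) i) \<in> borel_measurable M" for i
    unfolding imputed_def by measurable
  show ?thesis
    unfolding beta_RI_def proj_form_def proj_Z_def gram_def by measurable
qed

subsection \<open>Moments of a single observation\<close>

text \<open>The factor \<open>prob A\<close> makes the identity hold for null events as well, where
  both sides are 0. This is how \<open>p = 0\<close> is covered.\<close>

lemma (in prob_space) scaleR_expectation_on:
  fixes f :: "'a \<Rightarrow> 'b::{banach, second_countable_topology}"
  assumes A[measurable]: "A \<in> events" and [measurable]: "f \<in> borel_measurable M"
  shows "prob A *\<^sub>R expectation_on M A f = expectation (\<lambda>\<omega>. indicator A \<omega> *\<^sub>R f \<omega>)"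
proof (cases "prob A = 0")
  case True
  then have "AE \<omega> in M. \<omega> \<notin> A"
    using prob_eq_0[OF A] by simp
  then have "expectation (\<lambda>\<omega>. indicator A \<omega> *\<^sub>R f \<omega>) = expectation (\<lambda>_. 0)"
    by (intro integral_cong_AE) auto
  then show ?thesis using True by simp
next
  case False
  then have pos: "prob A > 0" by (simp add: zero_less_measure_iff)
  have "uniform_measure M A = density M (\<lambda>\<omega>. ennreal (indicator A \<omega> / prob A))"
    unfolding uniform_measure_def
  proof (rule density_cong)
    have "indicator A \<omega> / ennreal (prob A) = ennreal (indicator A \<omega> / prob A)" for \<omega>
      using divide_ennreal[of "indicator A \<omega>" "prob A"] pos by (simp add: ennreal_indicator)
    then show "AE \<omega> in M. indicator A \<omega> / emeasure M A = ennreal (indicator A \<omega> / prob A)"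
      by (simp add: emeasure_eq_measure)
  qed measurable
  then have "expectation_on M A f = expectation (\<lambda>\<omega>. (indicator A \<omega> / prob A) *\<^sub>R f \<omega>)"
    unfolding expectation_on_def by (simp add: integral_density)
  also have "\<dots> = expectation (\<lambda>\<omega>. (1 / prob A) *\<^sub>R (indicator A \<omega> *\<^sub>R f \<omega>))"
    by simp
  also have "\<dots> = (1 / prob A) *\<^sub>R expectation (\<lambda>\<omega>. indicator A \<omega> *\<^sub>R f \<omega>)"
    by (rule integral_scaleR_right)
  finally show ?thesis using pos by simp
qed

lemma norm_outer: "norm (outer a b) = norm a * norm (b :: real^'n)"
proof -
  have "outer a b $ r = a $ r *\<^sub>R b" for r
    by (simp add: outer_def vec_eq_iff)
  then have "norm (outer a b) = L2_set (\<lambda>r. norm (a $ r) * norm b) UNIV"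
    by (simp add: norm_vec_def[of "outer a b"])
  also have "\<dots> = norm a * norm b"
    by (simp add: L2_set_left_distrib[symmetric] norm_vec_def[of a])
  finally show ?thesis .
qed

lemma transpose_outer: "transpose (outer a a) = outer a a"
  by (simp add: outer_def transpose_def vec_eq_iff mult.commute)

lemma bounded_linear_quadratic_form: "bounded_linear (\<lambda>A. a \<bullet> (A *v (b :: real^'n)))"
  unfolding linear_conv_bounded_linear[symmetric]
  by (rule linearI) (simp_all add: matrix_vector_mult_add_rdistrib inner_add_right scaleR_matrix_vector_assoc[symmetric])

lemma quadratic_form_integral_outer:
  fixes z :: "'a \<Rightarrow> real^'n"
  assumes "integrable M (\<lambda>\<omega>. w \<omega> *\<^sub>R outer (z \<omega>) (z \<omega>))"
  shows "a \<bullet> (integral\<^sup>L M (\<lambda>\<omega>. w \<omega> *\<^sub>R outer (z \<omega>) (z \<omega>)) *v b) =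
    integral\<^sup>L M (\<lambda>\<omega>. w \<omega> * (a \<bullet> z \<omega>) * (b \<bullet> z \<omega>))"
  unfolding integral_bounded_linear[OF bounded_linear_quadratic_form assms, symmetric]
  by (simp add: scaleR_matrix_vector_assoc[symmetric] outer_mult_vec inner_commute mult_ac)

lemma integrable_scaleR_outer:
  fixes z :: "'a \<Rightarrow> real^'n"
  assumes [measurable]: "w \<in> borel_measurable M" "z \<in> borel_measurable M"
    and "integrable M (\<lambda>\<omega>. w \<omega> * (norm (z \<omega>))\<^sup>2)"
  shows "integrable M (\<lambda>\<omega>. w \<omega> *\<^sub>R outer (z \<omega>) (z \<omega>))"
  by (rule Bochner_Integration.integrable_bound[OF assms(3)])
    (auto simp: norm_outer power2_eq_square abs_mult)

text \<open>The right-hand integrand is the trace of the matrix, a finite sum of quadratic forms in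
  unit vectors.\<close>

lemma integrable_mult_norm_sq:
  fixes z :: "'a \<Rightarrow> real^'n"
  assumes "integrable M (\<lambda>\<omega>. w \<omega> *\<^sub>R outer (z \<omega>) (z \<omega>))"
  shows "integrable M (\<lambda>\<omega>. w \<omega> * (norm (z \<omega>))\<^sup>2)"
proof -
  have "integrable M (\<lambda>\<omega>. \<Sum>r\<in>UNIV. axis r 1 \<bullet> ((w \<omega> *\<^sub>R outer (z \<omega>) (z \<omega>)) *v axis r 1))"
    by (intro Bochner_Integration.integrable_sum integrable_bounded_linear[OF bounded_linear_quadratic_form assms])
  also have "(\<lambda>\<omega>. \<Sum>r\<in>UNIV. axis r 1 \<bullet> ((w \<omega> *\<^sub>R outer (z \<omega>) (z \<omega>)) *v axis r 1)) = (\<lambda>\<omega>. w \<omega> * (norm (z \<omega>))\<^sup>2)"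
  proof
    fix \<omega>
    have "axis r 1 \<bullet> ((w \<omega> *\<^sub>R outer (z \<omega>) (z \<omega>)) *v axis r 1) = w \<omega> * (z \<omega> $ r * z \<omega> $ r)" for r
      by (simp add: scaleR_matrix_vector_assoc[symmetric] outer_mult_vec inner_axis inner_axis')
    then show "(\<Sum>r\<in>UNIV. axis r 1 \<bullet> ((w \<omega> *\<^sub>R outer (z \<omega>) (z \<omega>)) *v axis r 1)) = w \<omega> * (norm (z \<omega>))\<^sup>2"
      unfolding power2_norm_eq_inner inner_vec_def by (simp add: sum_distrib_left)
  qed
  finally show ?thesis .
qed

lemma borel_measurable_of_bool [measurable (raw)]:
  assumes "P \<in> measurable M (count_space UNIV)"
  shows "(\<lambda>x. of_bool (P x) :: real) \<in> borel_measurable M"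
  by (rule measurable_compose[OF assms]) simp

text \<open>For \<open>\<beta> = 0\<close> the second moment of \<open>v\<close> on the incomplete observations may be infinite, but then it
  enters both sides with factor \<open>0\<close>.\<close>

lemma (in prob_space) RI_score_variance:
  fixes u v :: "'a \<Rightarrow> real" and z :: "'a \<Rightarrow> real^'L"
  assumes [measurable]: "u \<in> borel_measurable M" "v \<in> borel_measurable M" "z \<in> borel_measurable M"
    and m[measurable]: "m \<in> measurable M (count_space UNIV)"
    and p: "prob (missing_event M m) = p" "p < 1"
    and Iu: "integrable M (\<lambda>\<omega>. (u \<omega>)\<^sup>2 * (norm (z \<omega>))\<^sup>2)"
    and Iv0: "integrable M (\<lambda>\<omega>. of_bool (\<not> m \<omega>) * (v \<omega>)\<^sup>2 * (norm (z \<omega>))\<^sup>2)"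
    and Iv: "\<beta> \<noteq> 0 \<Longrightarrow> integrable M (\<lambda>\<omega>. (v \<omega>)\<^sup>2 * (norm (z \<omega>))\<^sup>2)"
    and Q0: "invertible Q0" "transpose Q0 = Q0" and Q1: "p *\<^sub>R transpose Q1 = p *\<^sub>R Q1"
  defines "A \<equiv> (p *\<^sub>R Q1) ** matrix_inv ((1 - p) *\<^sub>R Q0)"
  shows "expectation (\<lambda>\<omega>. ((c, (- \<beta>) *\<^sub>R (c v* A)) \<bullet>
      ((u \<omega> + \<beta> * of_bool (m \<omega>) * v \<omega>) *\<^sub>R z \<omega>, (of_bool (\<not> m \<omega>) * v \<omega>) *\<^sub>R z \<omega>))\<^sup>2) =
    c \<bullet> (Omega_RI M u v z m p \<beta> Q0 Q1 *v c)"
proof -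
  define q where "q = 1 - p"
  have q: "q > 0" using p by (simp add: q_def)
  have Em[measurable]: "missing_event M m \<in> events" and Ec[measurable]: "complete_event M m \<in> events"
    unfolding missing_event_def complete_event_def by measurable
  have prob_c: "prob (complete_event M m) = q"
  proof -
    have "complete_event M m = space M - missing_event M m"
      by (auto simp: complete_event_def missing_event_def)
    then show ?thesis using prob_compl[OF Em] p by (simp add: q_def)
  qed
  let ?m = "\<lambda>\<omega>. of_bool (m \<omega>) :: real" and ?c = "\<lambda>\<omega>. of_bool (\<not> m \<omega>) :: real"
  have E1: "p *\<^sub>R expectation_on M (missing_event M m) (\<lambda>\<omega>. w \<omega> *\<^sub>R outer (z \<omega>) (z \<omega>)) =
      expectation (\<lambda>\<omega>. (?m \<omega> * w \<omega>) *\<^sub>R outer (z \<omega>) (z \<omega>))"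
    if [measurable]: "w \<in> borel_measurable M" for w
  proof -
    have "expectation (\<lambda>\<omega>. indicator (missing_event M m) \<omega> *\<^sub>R (w \<omega> *\<^sub>R outer (z \<omega>) (z \<omega>))) =
        expectation (\<lambda>\<omega>. (of_bool (m \<omega>) * w \<omega>) *\<^sub>R outer (z \<omega>) (z \<omega>))"
      by (intro Bochner_Integration.integral_cong) (auto simp: indicator_def missing_event_def)
    then show ?thesis
      using scaleR_expectation_on[OF Em, of "\<lambda>\<omega>. w \<omega> *\<^sub>R outer (z \<omega>) (z \<omega>)"]
      by (simp add: p(1))
  qed
  have E0: "q *\<^sub>R expectation_on M (complete_event M m) (\<lambda>\<omega>. w \<omega> *\<^sub>R outer (z \<omega>) (z \<omega>)) =
      expectation (\<lambda>\<omega>. (?c \<omega> * w \<omega>) *\<^sub>R outer (z \<omega>) (z \<omega>))"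
    if [measurable]: "w \<in> borel_measurable M" for w
  proof -
    have "expectation (\<lambda>\<omega>. indicator (complete_event M m) \<omega> *\<^sub>R (w \<omega> *\<^sub>R outer (z \<omega>) (z \<omega>))) =
        expectation (\<lambda>\<omega>. (of_bool (\<not> m \<omega>) * w \<omega>) *\<^sub>R outer (z \<omega>) (z \<omega>))"
      by (intro Bochner_Integration.integral_cong) (auto simp: indicator_def complete_event_def)
    then show ?thesis
      using scaleR_expectation_on[OF Ec, of "\<lambda>\<omega>. w \<omega> *\<^sub>R outer (z \<omega>) (z \<omega>)"]
      by (simp add: prob_c)
  qed
  \<comment> \<open>The product \<open>u v\<close> is bounded by the sum of the squares. The weight
    is kept on the \<open>v\<close> part only, because \<open>v\<close> may have a second moment
    only on the weighted observations.\<close>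
  have Iuv: "integrable M (\<lambda>\<omega>. w \<omega> * (u \<omega> * v \<omega>) * (norm (z \<omega>))\<^sup>2)"
    if [measurable]: "w \<in> borel_measurable M" and w: "\<And>\<omega>. 0 \<le> w \<omega>" "\<And>\<omega>. w \<omega> \<le> 1"
      and Iw: "integrable M (\<lambda>\<omega>. w \<omega> * (v \<omega>)\<^sup>2 * (norm (z \<omega>))\<^sup>2)" for w
  proof (rule Bochner_Integration.integrable_bound[OF Bochner_Integration.integrable_add[OF Iu Iw]])
    have "\<bar>w \<omega> * (u \<omega> * v \<omega>) * (norm (z \<omega>))\<^sup>2\<bar> \<le> (u \<omega>)\<^sup>2 * (norm (z \<omega>))\<^sup>2 + w \<omega> * (v \<omega>)\<^sup>2 * (norm (z \<omega>))\<^sup>2" for \<omega>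
    proof -
      have "\<bar>u \<omega> * v \<omega>\<bar> \<le> (u \<omega>)\<^sup>2 + (v \<omega>)\<^sup>2"
        using sum_squares_bound[of "\<bar>u \<omega>\<bar>" "\<bar>v \<omega>\<bar>"] abs_ge_zero[of "u \<omega> * v \<omega>"]
        unfolding abs_mult power2_abs by linarith
      then have "w \<omega> * \<bar>u \<omega> * v \<omega>\<bar> \<le> w \<omega> * ((u \<omega>)\<^sup>2 + (v \<omega>)\<^sup>2)"
        by (rule mult_left_mono) (rule w)
      also have "\<dots> \<le> (u \<omega>)\<^sup>2 + w \<omega> * (v \<omega>)\<^sup>2"
        using mult_right_mono[OF w(2), of "(u \<omega>)\<^sup>2" \<omega>] by (simp add: distrib_left)
      finally have "w \<omega> * \<bar>u \<omega> * v \<omega>\<bar> * (norm (z \<omega>))\<^sup>2 \<le> ((u \<omega>)\<^sup>2 + w \<omega> * (v \<omega>)\<^sup>2) * (norm (z \<omega>))\<^sup>2"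
        by (rule mult_right_mono) simp
      then show ?thesis
        using w by (simp add: abs_mult distrib_right)
    qed
    then show "AE \<omega> in M. norm (w \<omega> * (u \<omega> * v \<omega>) * (norm (z \<omega>))\<^sup>2)
        \<le> norm ((u \<omega>)\<^sup>2 * (norm (z \<omega>))\<^sup>2 + w \<omega> * (v \<omega>)\<^sup>2 * (norm (z \<omega>))\<^sup>2)"
      by (intro AE_I2) (simp add: order_trans[OF _ abs_ge_self])
  qed measurable
  have Iuv0: "integrable M (\<lambda>\<omega>. ?c \<omega> * (u \<omega> * v \<omega>) * (norm (z \<omega>))\<^sup>2)"
    using Iv0 by (intro Iuv) auto
  have Iv1: "integrable M (\<lambda>\<omega>. ?m \<omega> * (v \<omega>)\<^sup>2 * (norm (z \<omega>))\<^sup>2)" if "\<beta> \<noteq> 0"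
    by (rule Bochner_Integration.integrable_bound[OF Iv[OF that]]) auto
  have Iuv1: "integrable M (\<lambda>\<omega>. ?m \<omega> * (u \<omega> * v \<omega>) * (norm (z \<omega>))\<^sup>2)" if "\<beta> \<noteq> 0"
    using Iv1[OF that] by (intro Iuv) auto
  define e where "e = c v* A"
  define a where "a \<omega> = c \<bullet> z \<omega>" for \<omega>
  define b where "b \<omega> = e \<bullet> z \<omega>" for \<omega>
  have [measurable]: "a \<in> borel_measurable M" "b \<in> borel_measurable M"
    unfolding a_def b_def by measurable
  have iw: "integrable M (\<lambda>\<omega>. w \<omega> * (c1 \<bullet> z \<omega>) * (c2 \<bullet> z \<omega>))"
    if [measurable]: "w \<in> borel_measurable M" and "integrable M (\<lambda>\<omega>. w \<omega> * (norm (z \<omega>))\<^sup>2)" for w c1 c2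
  proof -
    have "integrable M (\<lambda>\<omega>. c1 \<bullet> ((w \<omega> *\<^sub>R outer (z \<omega>) (z \<omega>)) *v c2))"
      by (intro integrable_bounded_linear[OF bounded_linear_quadratic_form] integrable_scaleR_outer that) simp
    then show ?thesis
      by (simp add: scaleR_matrix_vector_assoc[symmetric] outer_mult_vec inner_commute mult_ac)
  qed
  have qf: "c1 \<bullet> (expectation (\<lambda>\<omega>. w \<omega> *\<^sub>R outer (z \<omega>) (z \<omega>)) *v c2) = expectation (\<lambda>\<omega>. w \<omega> * (c1 \<bullet> z \<omega>) * (c2 \<bullet> z \<omega>))"
    if [measurable]: "w \<in> borel_measurable M" and "integrable M (\<lambda>\<omega>. w \<omega> * (norm (z \<omega>))\<^sup>2)" for w c1 c2
    by (intro quadratic_form_integral_outer integrable_scaleR_outer that) simp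
  \<comment> \<open>The two indicators are idempotent with product 0, so complete and incomplete
    \<open>v\<close> never mix. The \<open>u v\<close> products survive with opposite signs: minus
    from the first-stage estimation error, plus from the imputation error.\<close>
  have expand: "((c, (- \<beta>) *\<^sub>R (c v* A)) \<bullet> ((u \<omega> + \<beta> * ?m \<omega> * v \<omega>) *\<^sub>R z \<omega>, (?c \<omega> * v \<omega>) *\<^sub>R z \<omega>))\<^sup>2 =
      (u \<omega>)\<^sup>2 * a \<omega> * a \<omega> - (2 * \<beta>) * (?c \<omega> * (u \<omega> * v \<omega>) * a \<omega> * b \<omega>) + \<beta>\<^sup>2 * (?c \<omega> * (v \<omega>)\<^sup>2 * b \<omega> * b \<omega>)
      + (2 * \<beta>) * (?m \<omega> * (u \<omega> * v \<omega>) * a \<omega> * a \<omega>) + \<beta>\<^sup>2 * (?m \<omega> * (v \<omega>)\<^sup>2 * a \<omega> * a \<omega>)" for \<omega>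
    by (cases "m \<omega>") (simp_all add: e_def[symmetric] a_def[symmetric] b_def[symmetric] power2_eq_square algebra_simps)
  have i1: "integrable M (\<lambda>\<omega>. (u \<omega>)\<^sup>2 * a \<omega> * a \<omega>)"
    unfolding a_def by (intro iw Iu) measurable
  have i2: "integrable M (\<lambda>\<omega>. ?c \<omega> * (u \<omega> * v \<omega>) * a \<omega> * b \<omega>)"
    unfolding a_def b_def by (intro iw Iuv0) measurable
  have i3: "integrable M (\<lambda>\<omega>. ?c \<omega> * (v \<omega>)\<^sup>2 * b \<omega> * b \<omega>)"
    unfolding b_def by (intro iw Iv0) measurable
  have i4: "integrable M (\<lambda>\<omega>. (2 * \<beta>) * (?m \<omega> * (u \<omega> * v \<omega>) * a \<omega> * a \<omega>))"
  proof (cases "\<beta> = 0")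
    case False
    then show ?thesis unfolding a_def by (intro integrable_mult_right iw Iuv1) measurable
  qed simp
  have i5: "integrable M (\<lambda>\<omega>. \<beta>\<^sup>2 * (?m \<omega> * (v \<omega>)\<^sup>2 * a \<omega> * a \<omega>))"
  proof (cases "\<beta> = 0")
    case False
    then show ?thesis unfolding a_def by (intro integrable_mult_right iw Iv1) measurable
  qed simp
  have "expectation (\<lambda>\<omega>. ((c, (- \<beta>) *\<^sub>R (c v* A)) \<bullet>
      ((u \<omega> + \<beta> * ?m \<omega> * v \<omega>) *\<^sub>R z \<omega>, (?c \<omega> * v \<omega>) *\<^sub>R z \<omega>))\<^sup>2) =
     expectation (\<lambda>\<omega>. (u \<omega>)\<^sup>2 * a \<omega> * a \<omega>) - (2 * \<beta>) * expectation (\<lambda>\<omega>. ?c \<omega> * (u \<omega> * v \<omega>) * a \<omega> * b \<omega>)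
     + \<beta>\<^sup>2 * expectation (\<lambda>\<omega>. ?c \<omega> * (v \<omega>)\<^sup>2 * b \<omega> * b \<omega>)
     + (2 * \<beta>) * expectation (\<lambda>\<omega>. ?m \<omega> * (u \<omega> * v \<omega>) * a \<omega> * a \<omega>)
     + \<beta>\<^sup>2 * expectation (\<lambda>\<omega>. ?m \<omega> * (v \<omega>)\<^sup>2 * a \<omega> * a \<omega>)"
    unfolding expand
    by (simp only: Bochner_Integration.integral_add Bochner_Integration.integral_diff
        Bochner_Integration.integrable_add Bochner_Integration.integrable_diff integrable_mult_right
        i1 i2 i3 i4 i5 integral_mult_right_zero)
  also have "\<dots> = c \<bullet> (Omega_RI M u v z m p \<beta> Q0 Q1 *v c)"
  proof -
    let ?E0 = "expectation_on M (complete_event M m)" and ?E1 = "expectation_on M (missing_event M m)"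
    define U where "U = expectation (\<lambda>\<omega>. (u \<omega>)\<^sup>2 *\<^sub>R outer (z \<omega>) (z \<omega>))"
    define X0 where "X0 = ?E0 (\<lambda>\<omega>. (u \<omega> * v \<omega>) *\<^sub>R outer (z \<omega>) (z \<omega>))"
    define Y0 where "Y0 = ?E0 (\<lambda>\<omega>. (v \<omega>)\<^sup>2 *\<^sub>R outer (z \<omega>) (z \<omega>))"
    define X1 where "X1 = ?E1 (\<lambda>\<omega>. (u \<omega> * v \<omega>) *\<^sub>R outer (z \<omega>) (z \<omega>))"
    define Y1 where "Y1 = ?E1 (\<lambda>\<omega>. (v \<omega>)\<^sup>2 *\<^sub>R outer (z \<omega>) (z \<omega>))"
    define t where "t = matrix_inv Q0 *v (Q1 *v c)"
    have A_eq: "A = (p / q) *\<^sub>R (Q1 ** matrix_inv Q0)"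
      using q Q0 unfolding A_def q_def[symmetric]
      by (simp add: matrix_inv_scaleR scalar_matrix_assoc[symmetric] matrix_scalar_ac)
    \<comment> \<open>\<open>e\<close> is the transpose of \<open>A\<close> applied to
      \<open>c\<close>. Symmetry of \<open>Q0\<close> passes to its inverse, and the transpose of
      \<open>Q1\<close> may be dropped because it carries the factor \<open>p\<close>.\<close>
    have e_eq: "e = (p / q) *\<^sub>R t"
    proof -
      have "e = transpose A *v c" by (simp add: e_def)
      also have "transpose A = (1 / q) *\<^sub>R (matrix_inv Q0 ** (p *\<^sub>R transpose Q1))"
        using Q0 unfolding A_eq
        by (simp add: transpose_scalar matrix_transpose_mul transpose_matrix_inv matrix_scalar_ac scalar_matrix_assoc[symmetric])
      also have "\<dots> *v c = (p / q) *\<^sub>R t"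
        unfolding Q1 by (simp add: matrix_scalar_ac scalar_matrix_assoc[symmetric] scaleR_matrix_vector_assoc[symmetric] t_def matrix_vector_mul_assoc[symmetric])
      finally show ?thesis .
    qed
    \<comment> \<open>The same vector in row form, as needed for the left half of the third summand
      of \<Omega>. Scaling by \<open>p\<close> keeps it valid when \<open>p = 0\<close>.\<close>
    have dual: "p *\<^sub>R (c v* (Q1 ** matrix_inv Q0)) = p *\<^sub>R t"
    proof -
      have "e = (p / q) *\<^sub>R (c v* (Q1 ** matrix_inv Q0))"
        by (simp add: e_def A_eq vector_scaleR_matrix_ac)
      then show ?thesis using e_eq q by (auto simp: field_simps)
    qed
    \<comment> \<open>Conditioning on a complete observation contributes \<open>q\<close>, and each
      \<open>e\<close> contributes \<open>p / q\<close>. One \<open>e\<close> leaves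
      \<open>p\<close> here; two of them leave \<open>p\<^sup>2 / q\<close> in
      \<open>T3\<close>.\<close>
    have T2: "expectation (\<lambda>\<omega>. ?c \<omega> * (u \<omega> * v \<omega>) * a \<omega> * b \<omega>) = p * (c \<bullet> (X0 *v t))"
    proof -
      have "expectation (\<lambda>\<omega>. ?c \<omega> * (u \<omega> * v \<omega>) * a \<omega> * b \<omega>) = c \<bullet> ((q *\<^sub>R X0) *v e)"
        unfolding a_def b_def X0_def by (subst E0, measurable, subst qf) (auto intro: Iuv0)
      then show ?thesis using q
        by (simp add: scaleR_matrix_vector_assoc[symmetric] e_eq matrix_vector_mult_scaleR)
    qed
    have T3: "expectation (\<lambda>\<omega>. ?c \<omega> * (v \<omega>)\<^sup>2 * b \<omega> * b \<omega>) = p\<^sup>2 / q * (c \<bullet> ((Q1 ** matrix_inv Q0) *v (Y0 *v t)))"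
    proof -
      have "expectation (\<lambda>\<omega>. ?c \<omega> * (v \<omega>)\<^sup>2 * b \<omega> * b \<omega>) = e \<bullet> ((q *\<^sub>R Y0) *v e)"
        unfolding b_def Y0_def by (subst E0, measurable, subst qf) (auto intro: Iv0)
      also have "\<dots> = p / q * ((p *\<^sub>R t) \<bullet> (Y0 *v t))"
        using q by (simp add: scaleR_matrix_vector_assoc[symmetric] e_eq matrix_vector_mult_scaleR)
      also have "\<dots> = p / q * ((p *\<^sub>R (c v* (Q1 ** matrix_inv Q0))) \<bullet> (Y0 *v t))"
        by (simp only: dual)
      finally show ?thesis
        by (simp add: dot_lmul_matrix power2_eq_square)
    qed
    have T4: "(2 * \<beta>) * expectation (\<lambda>\<omega>. ?m \<omega> * (u \<omega> * v \<omega>) * a \<omega> * a \<omega>) = (2 * p * \<beta>) * (c \<bullet> (X1 *v c))"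
    proof (cases "\<beta> = 0")
      case False
      have "expectation (\<lambda>\<omega>. ?m \<omega> * (u \<omega> * v \<omega>) * a \<omega> * a \<omega>) = c \<bullet> ((p *\<^sub>R X1) *v c)"
        unfolding a_def X1_def by (subst E1, measurable, subst qf) (auto intro: Iuv1[OF False])
      then show ?thesis by (simp add: scaleR_matrix_vector_assoc[symmetric])
    qed simp
    have T5: "\<beta>\<^sup>2 * expectation (\<lambda>\<omega>. ?m \<omega> * (v \<omega>)\<^sup>2 * a \<omega> * a \<omega>) = (p * \<beta>\<^sup>2) * (c \<bullet> (Y1 *v c))"
    proof (cases "\<beta> = 0")
      case False
      have "expectation (\<lambda>\<omega>. ?m \<omega> * (v \<omega>)\<^sup>2 * a \<omega> * a \<omega>) = c \<bullet> ((p *\<^sub>R Y1) *v c)"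
        unfolding a_def Y1_def by (subst E1, measurable, subst qf) (auto intro: Iv1[OF False])
      then show ?thesis by (simp add: scaleR_matrix_vector_assoc[symmetric])
    qed simp
    have T1: "expectation (\<lambda>\<omega>. (u \<omega>)\<^sup>2 * a \<omega> * a \<omega>) = c \<bullet> (U *v c)"
      unfolding a_def U_def by (subst qf) (auto intro: Iu)
    have "Omega_RI M u v z m p \<beta> Q0 Q1 *v c =
        U *v c - (2 * p * \<beta>) *\<^sub>R (X0 *v t) + (p\<^sup>2 / q * \<beta>\<^sup>2) *\<^sub>R ((Q1 ** matrix_inv Q0) *v (Y0 *v t))
        + (2 * p * \<beta>) *\<^sub>R (X1 *v c) + (p * \<beta>\<^sup>2) *\<^sub>R (Y1 *v c)"
      unfolding Omega_RI_def Let_def U_def[symmetric] X0_def[symmetric] Y0_def[symmetric] X1_def[symmetric] Y1_def[symmetric] q_def[symmetric]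
      by (simp only: matrix_vector_mult_add_rdistrib matrix_vector_mult_diff_rdistrib
          scaleR_matrix_vector_assoc[symmetric] matrix_vector_mul_assoc[symmetric] t_def)
    then show ?thesis
      by (simp add: T1 T2 T3 T4 T5 inner_add_right inner_diff_right)
  qed
  finally show ?thesis .
qed

text \<open>Functions of \<open>(y, x, z)\<close> and of \<open>m\<close> generate
  sub-sigma-algebras of those that \<open>MCAR\<close> makes independent. The general codomain
  allows both real and extended nonnegative instances.\<close>

lemma (in prob_space) MCAR_indep_var:
  fixes x y :: "'a \<Rightarrow> real" and z :: "'a \<Rightarrow> real^'L"
    and f :: "real \<times> real \<times> (real^'L) \<Rightarrow> 'b::topological_space"
  assumes "MCAR M y x z m"
    and [measurable]: "y \<in> borel_measurable M" "x \<in> borel_measurable M" "z \<in> borel_measurable M"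
      "m \<in> measurable M (count_space UNIV)" "f \<in> borel_measurable borel"
  shows "indep_var borel (\<lambda>\<omega>. f (y \<omega>, x \<omega>, z \<omega>)) borel (\<lambda>\<omega>. g (m \<omega>))"
proof -
  let ?X = "\<lambda>\<omega>. (y \<omega>, x \<omega>, z \<omega>)"
  let ?A = "sigma_sets (space M) {(\<lambda>\<omega>. f (?X \<omega>)) -` B \<inter> space M | B. B \<in> sets borel}"
  let ?B = "sigma_sets (space M) {(\<lambda>\<omega>. g (m \<omega>)) -` B \<inter> space M | B. B \<in> sets borel}"
  have A: "?A \<subseteq> sets (vimage_algebra (space M) ?X borel)"
  proof -
    have "{(\<lambda>\<omega>. f (?X \<omega>)) -` B \<inter> space M | B. B \<in> sets borel} \<subseteq> sets (vimage_algebra (space M) ?X borel)"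
    proof clarify
      fix B :: "'b set" assume "B \<in> sets borel"
      then have "f -` B \<in> sets borel" using measurable_sets_borel by measurable
      then have "?X -` (f -` B) \<inter> space M \<in> sets (vimage_algebra (space M) ?X borel)"
        by (rule in_vimage_algebra)
      then show "(\<lambda>\<omega>. f (?X \<omega>)) -` B \<inter> space M \<in> sets (vimage_algebra (space M) ?X borel)"
        by (simp add: vimage_def)
    qed
    then show ?thesis
      using sets.sigma_sets_subset[of _ "vimage_algebra (space M) ?X borel"] by simp
  qed
  have B: "?B \<subseteq> sets (vimage_algebra (space M) m (count_space UNIV))"
  proof -
    have "{(\<lambda>\<omega>. g (m \<omega>)) -` B \<inter> space M | B. B \<in> sets borel} \<subseteq> sets (vimage_algebra (space M) m (count_space UNIV))"
    proof clarify
      fix B :: "'b set"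
      have "m -` (g -` B) \<inter> space M \<in> sets (vimage_algebra (space M) m (count_space UNIV))"
        by (rule in_vimage_algebra) simp
      then show "(\<lambda>\<omega>. g (m \<omega>)) -` B \<inter> space M \<in> sets (vimage_algebra (space M) m (count_space UNIV))"
        by (simp add: vimage_def)
    qed
    then show ?thesis
      using sets.sigma_sets_subset[of _ "vimage_algebra (space M) m (count_space UNIV)"] by simp
  qed
  have "indep_set ?A ?B"
    using assms(1) unfolding MCAR_def indep_set_def
    by (rule indep_sets_mono_sets) (use A B in \<open>auto split: bool.split\<close>)
  moreover have "(\<lambda>\<omega>. g (m \<omega>)) \<in> borel_measurable M"
    by (rule measurable_compose[of m M "count_space UNIV"]) auto
  ultimately show ?thesis
    unfolding indep_var_eq by simp
qed

lemma (in prob_space) MCAR_expectation: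
  fixes x y :: "'a \<Rightarrow> real" and z :: "'a \<Rightarrow> real^'L" and f :: "real \<times> real \<times> (real^'L) \<Rightarrow> 'b::euclidean_space"
  assumes mcar: "MCAR M y x z m"
    and [measurable]: "y \<in> borel_measurable M" "x \<in> borel_measurable M" "z \<in> borel_measurable M"
      "m \<in> measurable M (count_space UNIV)" "f \<in> borel_measurable borel"
    and int: "integrable M (\<lambda>\<omega>. f (y \<omega>, x \<omega>, z \<omega>))"
  shows "expectation (\<lambda>\<omega>. of_bool (\<not> m \<omega>) *\<^sub>R f (y \<omega>, x \<omega>, z \<omega>)) =
    expectation (\<lambda>\<omega>. of_bool (\<not> m \<omega>)) *\<^sub>R expectation (\<lambda>\<omega>. f (y \<omega>, x \<omega>, z \<omega>))"
proof (rule euclidean_eqI)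
  fix b :: 'b assume "b \<in> Basis"
  have indep: "indep_var borel (\<lambda>\<omega>. f (y \<omega>, x \<omega>, z \<omega>) \<bullet> b) borel (\<lambda>\<omega>. of_bool (\<not> m \<omega>) :: real)"
    by (rule MCAR_indep_var[OF mcar, where f="\<lambda>t. f t \<bullet> b" and g="\<lambda>t. of_bool (\<not> t)"]) measurable
  have 1: "integrable M (\<lambda>\<omega>. of_bool (\<not> m \<omega>) :: real)"
    by (rule integrable_const_bound[of _ 1]) auto
  have 2: "integrable M (\<lambda>\<omega>. f (y \<omega>, x \<omega>, z \<omega>) \<bullet> b)"
    using int by simp
  have 3: "integrable M (\<lambda>\<omega>. of_bool (\<not> m \<omega>) *\<^sub>R f (y \<omega>, x \<omega>, z \<omega>))"
    by (rule Bochner_Integration.integrable_bound[OF int]) auto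
  have "expectation (\<lambda>\<omega>. of_bool (\<not> m \<omega>) *\<^sub>R f (y \<omega>, x \<omega>, z \<omega>)) \<bullet> b =
      expectation (\<lambda>\<omega>. (f (y \<omega>, x \<omega>, z \<omega>) \<bullet> b) * of_bool (\<not> m \<omega>))"
    using 3 by (subst integral_inner_left[symmetric]) (auto simp: mult.commute)
  also have "\<dots> = expectation (\<lambda>\<omega>. of_bool (\<not> m \<omega>)) * (expectation (\<lambda>\<omega>. f (y \<omega>, x \<omega>, z \<omega>)) \<bullet> b)"
    using int by (subst indep_var_lebesgue_integral[OF indep 2 1]) simp
  finally show "expectation (\<lambda>\<omega>. of_bool (\<not> m \<omega>) *\<^sub>R f (y \<omega>, x \<omega>, z \<omega>)) \<bullet> b =
      (expectation (\<lambda>\<omega>. of_bool (\<not> m \<omega>)) *\<^sub>R expectation (\<lambda>\<omega>. f (y \<omega>, x \<omega>, z \<omega>))) \<bullet> b"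
    by simp
qed

text \<open>For nonnegative extended functions the integral over complete observations factors into
  the full integral and the probability of completeness. A finite product with a positive second
  factor forces the first to be finite. This extends the fourth moment of \<open>x\<close> to all
  observations.\<close>

lemma (in prob_space) MCAR_integrable:
  fixes x y :: "'a \<Rightarrow> real" and z :: "'a \<Rightarrow> real^'L" and f :: "real \<times> real \<times> (real^'L) \<Rightarrow> real"
  assumes mcar: "MCAR M y x z m"
    and [measurable]: "y \<in> borel_measurable M" "x \<in> borel_measurable M" "z \<in> borel_measurable M"
      "m \<in> measurable M (count_space UNIV)" "f \<in> borel_measurable borel"
    and f: "\<And>t. 0 \<le> f t"
    and int: "integrable M (\<lambda>\<omega>. of_bool (\<not> m \<omega>) * f (y \<omega>, x \<omega>, z \<omega>))"
    and pos: "prob (complete_event M m) > 0"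
  shows "integrable M (\<lambda>\<omega>. f (y \<omega>, x \<omega>, z \<omega>))"
proof -
  define X1 where "X1 \<omega> = ennreal (f (y \<omega>, x \<omega>, z \<omega>))" for \<omega>
  define X2 where "X2 \<omega> = (of_bool (\<not> m \<omega>) :: ennreal)" for \<omega>
  have "indep_var borel (\<lambda>\<omega>. ennreal (f (y \<omega>, x \<omega>, z \<omega>))) borel (\<lambda>\<omega>. of_bool (\<not> m \<omega>) :: ennreal)"
    by (rule MCAR_indep_var[OF mcar, where f="\<lambda>t. ennreal (f t)" and g="\<lambda>t. of_bool (\<not> t)"]) measurable
  then have "indep_vars (case_bool borel borel) (case_bool X1 X2) UNIV"
    by (simp add: indep_var_def comp_def X1_def[abs_def] X2_def[abs_def])
  moreover have "case_bool borel borel = (\<lambda>_. borel :: ennreal measure)"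
    by (auto simp: fun_eq_iff split: bool.split)
  ultimately have "indep_vars (\<lambda>_. borel) (case_bool X1 X2) UNIV" by simp
  from indep_vars_nn_integral[OF _ this]
  have prod: "(\<integral>\<^sup>+\<omega>. X1 \<omega> * X2 \<omega> \<partial>M) = (\<integral>\<^sup>+\<omega>. X1 \<omega> \<partial>M) * (\<integral>\<^sup>+\<omega>. X2 \<omega> \<partial>M)"
    by (simp add: UNIV_bool mult.commute)
  have [measurable]: "complete_event M m \<in> events"
    unfolding complete_event_def by measurable
  have "(\<integral>\<^sup>+\<omega>. X2 \<omega> \<partial>M) = (\<integral>\<^sup>+\<omega>. indicator (complete_event M m) \<omega> \<partial>M)"
    by (rule nn_integral_cong) (auto simp: X2_def complete_event_def indicator_def)
  then have X2: "(\<integral>\<^sup>+\<omega>. X2 \<omega> \<partial>M) = ennreal (prob (complete_event M m))"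
    by (simp add: emeasure_eq_measure)
  have "(\<integral>\<^sup>+\<omega>. X1 \<omega> * X2 \<omega> \<partial>M) = (\<integral>\<^sup>+\<omega>. ennreal (of_bool (\<not> m \<omega>) * f (y \<omega>, x \<omega>, z \<omega>)) \<partial>M)"
    by (rule nn_integral_cong) (auto simp: X1_def X2_def)
  also have "\<dots> < \<infinity>"
    using int f by (simp add: integrable_iff_bounded abs_mult)
  finally have "(\<integral>\<^sup>+\<omega>. X1 \<omega> \<partial>M) < \<infinity>"
    unfolding prod X2 using pos by (auto simp: ennreal_mult_less_top less_top[symmetric] ennreal_mult_eq_top_iff)
  then show ?thesis
    using f by (simp add: integrable_iff_bounded X1_def)
qed

text \<open>Since \<open>v\<close> is \<open>x\<close> minus a linear function of \<open>z\<close>,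
  its square is at most twice the sum of both squares; the linear part costs the fourth moment of
  \<open>z\<close>. The weight \<open>w\<close> is used as the constant 1 and as the indicator of
  completeness.\<close>

lemma integrable_weighted_residual:
  fixes x v :: "'a \<Rightarrow> real" and z :: "'a \<Rightarrow> real^'L"
  assumes [measurable]: "v \<in> borel_measurable M" "z \<in> borel_measurable M" "w \<in> borel_measurable M"
    and w: "\<And>\<omega>. 0 \<le> w \<omega>" "\<And>\<omega>. w \<omega> \<le> 1"
    and x: "\<And>\<omega>. \<omega> \<in> space M \<Longrightarrow> x \<omega> = z \<omega> \<bullet> \<pi> + v \<omega>"
    and Ix: "integrable M (\<lambda>\<omega>. w \<omega> * (x \<omega>)\<^sup>2 * (norm (z \<omega>))\<^sup>2)"
    and Iz: "integrable M (\<lambda>\<omega>. norm (z \<omega>) ^ 4)"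
  shows "integrable M (\<lambda>\<omega>. w \<omega> * (v \<omega>)\<^sup>2 * (norm (z \<omega>))\<^sup>2)"
proof (rule Bochner_Integration.integrable_bound)
  show "integrable M (\<lambda>\<omega>. 2 * (w \<omega> * (x \<omega>)\<^sup>2 * (norm (z \<omega>))\<^sup>2) + 2 * (norm \<pi>)\<^sup>2 * norm (z \<omega>) ^ 4)"
    using Ix Iz by simp
  show "AE \<omega> in M. norm (w \<omega> * (v \<omega>)\<^sup>2 * (norm (z \<omega>))\<^sup>2)
      \<le> norm (2 * (w \<omega> * (x \<omega>)\<^sup>2 * (norm (z \<omega>))\<^sup>2) + 2 * (norm \<pi>)\<^sup>2 * norm (z \<omega>) ^ 4)"
  proof (rule AE_I2)
    fix \<omega> assume \<omega>: "\<omega> \<in> space M"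
    have v: "v \<omega> = x \<omega> - z \<omega> \<bullet> \<pi>" using x[OF \<omega>] by simp
    have "(v \<omega>)\<^sup>2 \<le> 2 * (x \<omega>)\<^sup>2 + 2 * (z \<omega> \<bullet> \<pi>)\<^sup>2"
      unfolding v using zero_le_power2[of "x \<omega> + z \<omega> \<bullet> \<pi>"] by (simp add: power2_eq_square algebra_simps)
    also have "(z \<omega> \<bullet> \<pi>)\<^sup>2 \<le> (norm (z \<omega>))\<^sup>2 * (norm \<pi>)\<^sup>2"
      using Cauchy_Schwarz_ineq[of "z \<omega>" \<pi>] by (simp add: power2_norm_eq_inner)
    finally have "w \<omega> * (norm (z \<omega>))\<^sup>2 * (v \<omega>)\<^sup>2 \<le>
        w \<omega> * (norm (z \<omega>))\<^sup>2 * (2 * (x \<omega>)\<^sup>2 + 2 * ((norm (z \<omega>))\<^sup>2 * (norm \<pi>)\<^sup>2))"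
      using w by (intro mult_left_mono) auto
    also have "\<dots> = 2 * (w \<omega> * (x \<omega>)\<^sup>2 * (norm (z \<omega>))\<^sup>2) + w \<omega> * (2 * (norm \<pi>)\<^sup>2 * norm (z \<omega>) ^ 4)"
      by (simp add: algebra_simps power4_eq_xxxx power2_eq_square)
    also have "\<dots> \<le> 2 * (w \<omega> * (x \<omega>)\<^sup>2 * (norm (z \<omega>))\<^sup>2) + 1 * (2 * (norm \<pi>)\<^sup>2 * norm (z \<omega>) ^ 4)"
      using w by (intro add_left_mono mult_right_mono) auto
    finally show "norm (w \<omega> * (v \<omega>)\<^sup>2 * (norm (z \<omega>))\<^sup>2)
      \<le> norm (2 * (w \<omega> * (x \<omega>)\<^sup>2 * (norm (z \<omega>))\<^sup>2) + 2 * (norm \<pi>)\<^sup>2 * norm (z \<omega>) ^ 4)"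
      using w by (simp add: abs_mult mult_ac)
  qed
qed measurable

lemma integrable_square_mult_norm:
  fixes a :: "'a \<Rightarrow> real" and z :: "'a \<Rightarrow> 'b::{real_normed_vector, second_countable_topology}"
  assumes [measurable]: "a \<in> borel_measurable M" "z \<in> borel_measurable M" "w \<in> borel_measurable M"
    and w: "\<And>\<omega>. 0 \<le> w \<omega>" "\<And>\<omega>. w \<omega> \<le> 1"
    and "integrable M (\<lambda>\<omega>. w \<omega> * a \<omega> ^ 4)" "integrable M (\<lambda>\<omega>. norm (z \<omega>) ^ 4)"
  shows "integrable M (\<lambda>\<omega>. w \<omega> * (a \<omega>)\<^sup>2 * (norm (z \<omega>))\<^sup>2)"
proof (rule Bochner_Integration.integrable_bound)
  show "integrable M (\<lambda>\<omega>. w \<omega> * a \<omega> ^ 4 + norm (z \<omega>) ^ 4)"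
    using assms by simp
  show "AE \<omega> in M. norm (w \<omega> * (a \<omega>)\<^sup>2 * (norm (z \<omega>))\<^sup>2) \<le> norm (w \<omega> * a \<omega> ^ 4 + norm (z \<omega>) ^ 4)"
  proof (rule AE_I2)
    fix \<omega>
    have "(a \<omega>)\<^sup>2 * (norm (z \<omega>))\<^sup>2 \<le> a \<omega> ^ 4 + norm (z \<omega>) ^ 4"
    proof -
      have "s * t \<le> s\<^sup>2 + t\<^sup>2" if "0 \<le> s" "0 \<le> t" for s t :: real
        using sum_squares_bound[of s t] mult_nonneg_nonneg[OF that] by linarith
      from this[of "(a \<omega>)\<^sup>2" "(norm (z \<omega>))\<^sup>2"] show ?thesis by simp
    qed
    then have "w \<omega> * ((a \<omega>)\<^sup>2 * (norm (z \<omega>))\<^sup>2) \<le> w \<omega> * (a \<omega> ^ 4 + norm (z \<omega>) ^ 4)"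
      using w by (intro mult_left_mono) auto
    also have "\<dots> = w \<omega> * a \<omega> ^ 4 + w \<omega> * norm (z \<omega>) ^ 4"
      by (simp add: distrib_left)
    also have "\<dots> \<le> w \<omega> * a \<omega> ^ 4 + 1 * norm (z \<omega>) ^ 4"
      using w by (intro add_left_mono mult_right_mono) auto
    finally show "norm (w \<omega> * (a \<omega>)\<^sup>2 * (norm (z \<omega>))\<^sup>2) \<le> norm (w \<omega> * a \<omega> ^ 4 + norm (z \<omega>) ^ 4)"
      using w by (simp add: abs_mult mult_ac)
  qed
qed measurable

text \<open>Supplies the second moments needed for the separate summands of \<Omega>, starting from
  a fourth moment of \<open>x\<close> on complete observations only. Each alternative of
  \<open>ign\<close> closes the gap on incomplete observations in its own way.\<close>

lemma (in prob_space) RI_moments: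
  fixes x y u v :: "'a \<Rightarrow> real" and z :: "'a \<Rightarrow> real^'L"
  assumes [measurable]: "y \<in> borel_measurable M" "x \<in> borel_measurable M" "z \<in> borel_measurable M"
      "u \<in> borel_measurable M" "v \<in> borel_measurable M" "m \<in> measurable M (count_space UNIV)"
    and model: "\<And>\<omega>. \<omega> \<in> space M \<Longrightarrow> y \<omega> = x \<omega> * \<beta> + u \<omega>"
      "\<And>\<omega>. \<omega> \<in> space M \<Longrightarrow> x \<omega> = z \<omega> \<bullet> \<pi> + v \<omega>"
    and y4: "integrable M (\<lambda>\<omega>. y \<omega> ^ 4)" and z4: "integrable M (\<lambda>\<omega>. norm (z \<omega>) ^ 4)"
    and x4: "integrable M (\<lambda>\<omega>. of_bool (\<not> m \<omega>) * x \<omega> ^ 4)"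
    and pos: "prob (complete_event M m) > 0"
    and ign: "MCAR M y x z m \<or> integrable M (\<lambda>\<omega>. (u \<omega>)\<^sup>2 *\<^sub>R outer (z \<omega>) (z \<omega>))"
  shows "integrable M (\<lambda>\<omega>. (u \<omega>)\<^sup>2 * (norm (z \<omega>))\<^sup>2)" (is ?u)
    and "integrable M (\<lambda>\<omega>. of_bool (\<not> m \<omega>) * (v \<omega>)\<^sup>2 * (norm (z \<omega>))\<^sup>2)" (is ?c)
    and "\<beta> \<noteq> 0 \<Longrightarrow> integrable M (\<lambda>\<omega>. (v \<omega>)\<^sup>2 * (norm (z \<omega>))\<^sup>2)" (is "_ \<Longrightarrow> ?v")
proof -
  have yz: "integrable M (\<lambda>\<omega>. (y \<omega>)\<^sup>2 * (norm (z \<omega>))\<^sup>2)"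
    using integrable_square_mult_norm[of y M z "\<lambda>_. 1"] y4 z4 by simp
  have v_if_x: ?v if "integrable M (\<lambda>\<omega>. (x \<omega>)\<^sup>2 * (norm (z \<omega>))\<^sup>2)"
    using integrable_weighted_residual[where w="\<lambda>_. 1" and M=M and v=v and x=x and z=z and \<pi>=\<pi>] that z4 model(2)
    by simp
  show ?c
    by (rule integrable_weighted_residual[where x=x and \<pi>=\<pi>])
      (auto intro!: integrable_square_mult_norm x4 z4 model(2))
  have "?u \<and> (\<beta> \<noteq> 0 \<longrightarrow> ?v)"
    using ign
  proof
    assume mcar: "MCAR M y x z m"
    have "(\<lambda>t :: real \<times> real \<times> (real^'L). fst (snd t) ^ 4) \<in> borel_measurable borel"
      by (intro borel_measurable_continuous_onI continuous_intros)
    \<comment> \<open>Independence extends the fourth moment of \<open>x\<close> to all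
      observations; \<open>u\<close> and \<open>v\<close> are then bounded through the model
      equations.\<close>
    then have "integrable M (\<lambda>\<omega>. (\<lambda>t. fst (snd t) ^ 4) (y \<omega>, x \<omega>, z \<omega>))"
      by (intro MCAR_integrable[OF mcar]) (use x4 pos in auto)
    then have xz: "integrable M (\<lambda>\<omega>. (x \<omega>)\<^sup>2 * (norm (z \<omega>))\<^sup>2)"
      using integrable_square_mult_norm[of x M z "\<lambda>_. 1"] z4 by simp
    have ?u
    proof (rule Bochner_Integration.integrable_bound)
      show "integrable M (\<lambda>\<omega>. 2 * ((y \<omega>)\<^sup>2 * (norm (z \<omega>))\<^sup>2) + 2 * \<beta>\<^sup>2 * ((x \<omega>)\<^sup>2 * (norm (z \<omega>))\<^sup>2))"
        using yz xz by simp
      show "AE \<omega> in M. norm ((u \<omega>)\<^sup>2 * (norm (z \<omega>))\<^sup>2)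
          \<le> norm (2 * ((y \<omega>)\<^sup>2 * (norm (z \<omega>))\<^sup>2) + 2 * \<beta>\<^sup>2 * ((x \<omega>)\<^sup>2 * (norm (z \<omega>))\<^sup>2))"
      proof (rule AE_I2)
        fix \<omega> assume "\<omega> \<in> space M"
        then have u: "u \<omega> = y \<omega> - x \<omega> * \<beta>" using model(1) by simp
        have "(u \<omega>)\<^sup>2 \<le> 2 * (y \<omega>)\<^sup>2 + 2 * \<beta>\<^sup>2 * (x \<omega>)\<^sup>2"
          unfolding u using zero_le_power2[of "y \<omega> + x \<omega> * \<beta>"] by (simp add: power2_eq_square algebra_simps)
        from mult_right_mono[OF this, of "(norm (z \<omega>))\<^sup>2"]
        show "norm ((u \<omega>)\<^sup>2 * (norm (z \<omega>))\<^sup>2)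
          \<le> norm (2 * ((y \<omega>)\<^sup>2 * (norm (z \<omega>))\<^sup>2) + 2 * \<beta>\<^sup>2 * ((x \<omega>)\<^sup>2 * (norm (z \<omega>))\<^sup>2))"
          by (simp add: algebra_simps)
      qed
    qed measurable
    then show ?thesis using v_if_x[OF xz] by blast
  next
    assume "integrable M (\<lambda>\<omega>. (u \<omega>)\<^sup>2 *\<^sub>R outer (z \<omega>) (z \<omega>))"
    then have uz: ?u by (rule integrable_mult_norm_sq)
    \<comment> \<open>Here \<open>u\<close> is controlled by hypothesis and \<open>y\<close> by its
      fourth moment, so the first model equation is solved for \<open>x\<close>, which requires a
      nonzero \<beta>.\<close>
    have "integrable M (\<lambda>\<omega>. (x \<omega>)\<^sup>2 * (norm (z \<omega>))\<^sup>2)" if "\<beta> \<noteq> 0"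
    proof (rule Bochner_Integration.integrable_bound)
      show "integrable M (\<lambda>\<omega>. (2 / \<beta>\<^sup>2) * ((y \<omega>)\<^sup>2 * (norm (z \<omega>))\<^sup>2 + (u \<omega>)\<^sup>2 * (norm (z \<omega>))\<^sup>2))"
        using yz uz by simp
      show "AE \<omega> in M. norm ((x \<omega>)\<^sup>2 * (norm (z \<omega>))\<^sup>2)
          \<le> norm ((2 / \<beta>\<^sup>2) * ((y \<omega>)\<^sup>2 * (norm (z \<omega>))\<^sup>2 + (u \<omega>)\<^sup>2 * (norm (z \<omega>))\<^sup>2))"
      proof (rule AE_I2)
        fix \<omega> assume "\<omega> \<in> space M"
        then have x: "x \<omega> = (y \<omega> - u \<omega>) / \<beta>" using model(1) that by simp
        have "(y \<omega> - u \<omega>)\<^sup>2 \<le> 2 * ((y \<omega>)\<^sup>2 + (u \<omega>)\<^sup>2)"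
          using zero_le_power2[of "y \<omega> + u \<omega>"] by (simp add: power2_eq_square algebra_simps)
        then have "(x \<omega>)\<^sup>2 \<le> 2 / \<beta>\<^sup>2 * ((y \<omega>)\<^sup>2 + (u \<omega>)\<^sup>2)"
          unfolding x using that by (simp add: power_divide divide_right_mono)
        from mult_right_mono[OF this, of "(norm (z \<omega>))\<^sup>2"]
        show "norm ((x \<omega>)\<^sup>2 * (norm (z \<omega>))\<^sup>2)
          \<le> norm ((2 / \<beta>\<^sup>2) * ((y \<omega>)\<^sup>2 * (norm (z \<omega>))\<^sup>2 + (u \<omega>)\<^sup>2 * (norm (z \<omega>))\<^sup>2))"
          by (simp add: algebra_simps add_divide_distrib)
      qed
    qed measurable
    then show ?thesis using v_if_x uz by blast
  qed
  then show ?u "\<beta> \<noteq> 0 \<Longrightarrow> ?v" by auto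
qed

subsection \<open>Asymptotic normality\<close>

text \<open>The Gram matrix over \<open>n\<close> is the group share times the Gram matrix over the
  group size. A group of cardinality 0 has Gram matrix 0, so the factorization survives division by
  0; uniqueness of limits does the rest.\<close>

lemma (in prob_space) normalized_gram_limit:
  fixes z :: "nat \<Rightarrow> 'a \<Rightarrow> real^'L" and S :: "nat \<Rightarrow> 'a \<Rightarrow> nat set"
  assumes [measurable]: "\<And>n. (\<lambda>\<omega>. real (card (S n \<omega>))) \<in> borel_measurable M"
      "\<And>n. (\<lambda>\<omega>. gram (S n \<omega>) (\<lambda>i. z i \<omega>)) \<in> borel_measurable M"
    and card: "conv_in_prob M (\<lambda>n \<omega>. real (card (S n \<omega>)) / real n) r"
    and Q: "conv_in_prob M (\<lambda>n \<omega>. (1 / real (card (S n \<omega>))) *\<^sub>R gram (S n \<omega>) (\<lambda>i. z i \<omega>)) Q"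
    and H: "conv_in_prob M (\<lambda>n \<omega>. (1 / real n) *\<^sub>R gram (S n \<omega>) (\<lambda>i. z i \<omega>)) H"
  shows "H = r *\<^sub>R Q"
proof -
  have "isCont (\<lambda>t. fst t *\<^sub>R snd t) (r, Q)"
    by (intro continuous_intros)
  then have "conv_in_prob M (\<lambda>n \<omega>. (\<lambda>t. fst t *\<^sub>R snd t)
      (real (card (S n \<omega>)) / real n, (1 / real (card (S n \<omega>))) *\<^sub>R gram (S n \<omega>) (\<lambda>i. z i \<omega>)))
      ((\<lambda>t. fst t *\<^sub>R snd t) (r, Q))"
    by (intro conv_in_prob_isCont[OF conv_in_prob_Pair[OF card _ Q]]) (auto, measurable)
  moreover have "(\<lambda>t. fst t *\<^sub>R snd t)
      (real (card (S n \<omega>)) / real n, (1 / real (card (S n \<omega>))) *\<^sub>R gram (S n \<omega>) (\<lambda>i. z i \<omega>)) =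
      (1 / real n) *\<^sub>R gram (S n \<omega>) (\<lambda>i. z i \<omega>)" for n \<omega>
    by (cases "card (S n \<omega>) = 0") (auto simp: gram_def card_eq_0_iff)
  ultimately have "conv_in_prob M (\<lambda>n \<omega>. (1 / real n) *\<^sub>R gram (S n \<omega>) (\<lambda>i. z i \<omega>)) (r *\<^sub>R Q)"
    by (simp only: fst_conv snd_conv)
  then show ?thesis
    by (intro conv_in_prob_unique[OF H]) measurable
qed

theorem proposition1:
  fixes M :: "'a measure"
    and y x u v :: "nat \<Rightarrow> 'a \<Rightarrow> real"
    and Z :: "nat \<Rightarrow> 'a \<Rightarrow> real^'L"
    and miss :: "nat \<Rightarrow> 'a \<Rightarrow> bool"
    and \<beta> p :: real
    and \<pi> QZx :: "real^'L"
    and QZZ Q0 Q1 :: "real^'L^'L"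
    and k :: nat
  assumes "prob_space M"
    and model_y: "\<And>i \<omega>. \<omega> \<in> space M \<Longrightarrow> y i \<omega> = x i \<omega> * \<beta> + u i \<omega>"
    and model_x: "\<And>i \<omega>. \<omega> \<in> space M \<Longrightarrow> x i \<omega> = Z i \<omega> \<bullet> \<pi> + v i \<omega>"
    and Zu_mean: "\<And>i. has_bochner_integral M (\<lambda>\<omega>. u i \<omega> *\<^sub>R Z i \<omega>) 0"
    and Zu_plim: "conv_in_prob M
          (\<lambda>n \<omega>. (1 / real n) *\<^sub>R cross {..<n} (\<lambda>i. Z i \<omega>) (\<lambda>i. u i \<omega>)) 0"
    and Zv_mean: "\<And>i. has_bochner_integral M (\<lambda>\<omega>. v i \<omega> *\<^sub>R Z i \<omega>) 0"
    and Zv_plim: "conv_in_prob M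
          (\<lambda>n \<omega>. (1 / real n) *\<^sub>R cross {..<n} (\<lambda>i. Z i \<omega>) (\<lambda>i. v i \<omega>)) 0"
    and Zx_mean: "\<And>i. has_bochner_integral M (\<lambda>\<omega>. x i \<omega> *\<^sub>R Z i \<omega>) QZx"
    and Zx_plim: "conv_in_prob M
          (\<lambda>n \<omega>. (1 / real n) *\<^sub>R cross {..<n} (\<lambda>i. Z i \<omega>) (\<lambda>i. x i \<omega>)) QZx"
    and QZx_nonzero: "QZx \<noteq> 0"
    and ZZ_mean: "\<And>i. has_bochner_integral M (\<lambda>\<omega>. outer (Z i \<omega>) (Z i \<omega>)) QZZ"
    and ZZ_plim: "conv_in_prob M
          (\<lambda>n \<omega>. (1 / real n) *\<^sub>R gram {..<n} (\<lambda>i. Z i \<omega>)) QZZ"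
    and QZZ_full_rank: "invertible QZZ"
    and independent: "prob_space.indep_vars M (\<lambda>_. borel \<Otimes>\<^sub>M count_space UNIV)
          (\<lambda>i \<omega>. ((y i \<omega>, x i \<omega>, Z i \<omega>), miss i \<omega>)) UNIV"
    and identically_distributed: "\<And>i j.
          distr M (borel \<Otimes>\<^sub>M count_space UNIV) (\<lambda>\<omega>. ((y i \<omega>, x i \<omega>, Z i \<omega>), miss i \<omega>)) =
          distr M (borel \<Otimes>\<^sub>M count_space UNIV) (\<lambda>\<omega>. ((y j \<omega>, x j \<omega>, Z j \<omega>), miss j \<omega>))"
    and p_plim: "conv_in_prob M
          (\<lambda>n \<omega>. real (card (incomplete_obs n (\<lambda>i. miss i \<omega>))) / real n) p"
    and p_less: "p < 1"
    and Q0_plim: "conv_in_prob M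
          (\<lambda>n \<omega>. (1 / real (card (complete_obs n (\<lambda>i. miss i \<omega>)))) *\<^sub>R
             gram (complete_obs n (\<lambda>i. miss i \<omega>)) (\<lambda>i. Z i \<omega>)) Q0"
    and Q1_plim: "conv_in_prob M
          (\<lambda>n \<omega>. (1 / real (card (incomplete_obs n (\<lambda>i. miss i \<omega>)))) *\<^sub>R
             gram (incomplete_obs n (\<lambda>i. miss i \<omega>)) (\<lambda>i. Z i \<omega>)) Q1"
    and ignorable: "(\<forall>i. MCAR M (y i) (x i) (Z i) (miss i)) \<or>
          (\<forall>i. MAR M (y i) (x i) (Z i) (miss i) \<and>
             expectation_on M (complete_event M (miss i)) (\<lambda>\<omega>. v i \<omega> *\<^sub>R Z i \<omega>) = 0 \<and>
             integrable M (\<lambda>\<omega>. (u i \<omega>)\<^sup>2 *\<^sub>R outer (Z i \<omega>) (Z i \<omega>)) \<and>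
             invertible Q0)"
    and y_moment: "\<And>i. integrable M (\<lambda>\<omega>. (y i \<omega>) ^ 4)"
    and imputed_moment: "\<And>n i. i < n \<Longrightarrow>
          integrable M (\<lambda>\<omega>. (imputed n (\<lambda>j. x j \<omega>) (\<lambda>j. Z j \<omega>) (\<lambda>j. miss j \<omega>) i) ^ 4)"
    and Z_moment: "\<And>i. integrable M (\<lambda>\<omega>. norm (Z i \<omega>) ^ 4)"
  shows "weak_conv_m
          (\<lambda>n. distr M borel (\<lambda>\<omega>. sqrt (real n) *
             (beta_RI n (\<lambda>i. y i \<omega>) (\<lambda>i. x i \<omega>) (\<lambda>i. Z i \<omega>) (\<lambda>i. miss i \<omega>) - \<beta>)))
          (normal_law 0
             (V_RI QZZ QZx (Omega_RI M (u k) (v k) (Z k) (miss k) p \<beta> Q0 Q1)))"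
proof -
  interpret prob_space M by fact

  \<comment> \<open>The data as functions of one i.i.d. sequence\<close>
  let ?N = "borel \<Otimes>\<^sub>M count_space UNIV :: ((real \<times> real \<times> (real^'L)) \<times> bool) measure"
  \<comment> \<open>Every per-observation quantity is written below as a fixed function of
    \<open>obs i\<close>, the form in which independence and equality in law are
    transferred.\<close>
  define obs where "obs i \<omega> = ((y i \<omega>, x i \<omega>, Z i \<omega>), miss i \<omega>)" for i \<omega>
  define py where "py t = fst (fst t)" for t :: "(real \<times> real \<times> (real^'L)) \<times> bool"
  define px where "px t = fst (snd (fst t))" for t :: "(real \<times> real \<times> (real^'L)) \<times> bool"
  define pz where "pz t = snd (snd (fst t))" for t :: "(real \<times> real \<times> (real^'L)) \<times> bool"
  have indep_obs: "indep_vars (\<lambda>_. ?N) obs UNIV"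
    using independent unfolding obs_def[abs_def] .
  have obs[measurable]: "obs i \<in> measurable M ?N" for i
    using indep_obs by (auto simp: indep_vars_def)
  have py[measurable]: "py \<in> borel_measurable ?N"
    unfolding py_def[abs_def]
    by (rule measurable_compose[OF measurable_fst]) (intro borel_measurable_continuous_onI continuous_intros)
  have px[measurable]: "px \<in> borel_measurable ?N"
    unfolding px_def[abs_def]
    by (rule measurable_compose[OF measurable_fst]) (intro borel_measurable_continuous_onI continuous_intros)
  have pz[measurable]: "pz \<in> borel_measurable ?N"
    unfolding pz_def[abs_def]
    by (rule measurable_compose[OF measurable_fst]) (intro borel_measurable_continuous_onI continuous_intros)
  have pm[measurable]: "snd \<in> measurable ?N (count_space UNIV)" by simp
  have proj: "py (obs i \<omega>) = y i \<omega>" "px (obs i \<omega>) = x i \<omega>" "pz (obs i \<omega>) = Z i \<omega>" "snd (obs i \<omega>) = miss i \<omega>" for i \<omega>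
    by (simp_all add: obs_def py_def px_def pz_def)
  have y[measurable]: "y i \<in> borel_measurable M" for i
    using measurable_compose[OF obs py] by (simp add: proj)
  have x[measurable]: "x i \<in> borel_measurable M" for i
    using measurable_compose[OF obs px] by (simp add: proj)
  have Z[measurable]: "Z i \<in> borel_measurable M" for i
    using measurable_compose[OF obs pz] by (simp add: proj)
  have miss[measurable]: "miss i \<in> measurable M (count_space UNIV)" for i
    using measurable_compose[OF obs pm] by (simp add: proj)
  have u[measurable]: "u i \<in> borel_measurable M" for i
  proof -
    have "u i \<in> borel_measurable M \<longleftrightarrow> (\<lambda>\<omega>. y i \<omega> - x i \<omega> * \<beta>) \<in> borel_measurable M"
      by (rule measurable_cong) (simp add: model_y)
    then show ?thesis by simp
  qed
  have v[measurable]: "v i \<in> borel_measurable M" for i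
  proof -
    have "v i \<in> borel_measurable M \<longleftrightarrow> (\<lambda>\<omega>. x i \<omega> - Z i \<omega> \<bullet> \<pi>) \<in> borel_measurable M"
      by (rule measurable_cong) (simp add: model_x)
    then show ?thesis by simp
  qed
  have iid_indep: "indep_vars (\<lambda>_. borel) (\<lambda>i \<omega>. f (obs i \<omega>)) UNIV"
    if "f \<in> borel_measurable ?N" for f :: "_ \<Rightarrow> 'c::topological_space"
    by (rule indep_vars_compose2[OF indep_obs]) (rule that)
  have iid_distr: "distr M borel (\<lambda>\<omega>. f (obs i \<omega>)) = distr M borel (\<lambda>\<omega>. f (obs 0 \<omega>))"
    if f[measurable]: "f \<in> borel_measurable ?N" for f :: "_ \<Rightarrow> 'c::topological_space" and i
  proof -
    have "distr (distr M ?N (obs i)) borel f = distr (distr M ?N (obs 0)) borel f"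
      using identically_distributed[of i 0] by (simp add: obs_def[abs_def])
    then show ?thesis by (subst (asm) (1 2) distr_distr) (auto simp: comp_def)
  qed
  have wlln: "conv_in_prob M (\<lambda>n \<omega>. (1 / real n) *\<^sub>R (\<Sum>i<n. f (obs i \<omega>))) (expectation (\<lambda>\<omega>. f (obs 0 \<omega>)))"
    if "f \<in> borel_measurable ?N" "integrable M (\<lambda>\<omega>. (norm (f (obs 0 \<omega>)))\<^sup>2)" for f :: "_ \<Rightarrow> 'c::euclidean_space"
    by (rule weak_law_of_large_numbers[OF iid_indep[OF that(1)] iid_distr[OF that(1)] that(2)])

  \<comment> \<open>The probability of a missing regressor\<close>
  have intm: "integrable M (\<lambda>\<omega>. of_bool (miss i \<omega>) :: real)" "integrable M (\<lambda>\<omega>. of_bool (\<not> miss i \<omega>) :: real)" for i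
    by (rule integrable_const_bound[of _ 1]; simp)+
  have miss_ev[measurable]: "missing_event M (miss i) \<in> events" for i
    unfolding missing_event_def by measurable
  have E_miss: "expectation (\<lambda>\<omega>. of_bool (miss i \<omega>)) = prob (missing_event M (miss i))" for i
  proof -
    have "expectation (\<lambda>\<omega>. of_bool (miss i \<omega>)) = expectation (indicator (missing_event M (miss i)))"
      by (rule Bochner_Integration.integral_cong) (auto simp: missing_event_def indicator_def)
    also have "\<dots> = prob (missing_event M (miss i) \<inter> space M)" by simp
    also have "\<dots> = prob (missing_event M (miss i))"
      by (rule arg_cong[where f=prob]) (auto simp: missing_event_def)
    finally show ?thesis .
  qed
  have prob_miss: "prob (missing_event M (miss i)) = p" for i
  proof -
    have "conv_in_prob M (\<lambda>n \<omega>. (1 / real n) *\<^sub>R (\<Sum>i<n. of_bool (snd (obs i \<omega>))))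
        (expectation (\<lambda>\<omega>. of_bool (snd (obs 0 \<omega>)) :: real))"
    proof (rule wlln)
      show "integrable M (\<lambda>\<omega>. (norm (of_bool (snd (obs 0 \<omega>)) :: real))\<^sup>2)"
        by (rule integrable_const_bound[of _ 1]) auto
    qed measurable
    then have conv: "conv_in_prob M (\<lambda>n \<omega>. real (card (incomplete_obs n (\<lambda>i. miss i \<omega>))) / real n)
        (expectation (\<lambda>\<omega>. of_bool (miss 0 \<omega>)))"
      by (simp add: proj card_incomplete_obs)
    \<comment> \<open>The hypothesis on \<open>p\<close> and the weak law give two limits of the
      same relative frequency.\<close>
    have "p = expectation (\<lambda>\<omega>. of_bool (miss 0 \<omega>))"
      by (rule conv_in_prob_unique[OF p_plim conv]) (simp add: card_incomplete_obs)
    also have "\<dots> = expectation (\<lambda>\<omega>. of_bool (miss i \<omega>))"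
    proof -
      have m: "(\<lambda>t. of_bool (snd t) :: real) \<in> borel_measurable ?N" by measurable
      have "expectation (\<lambda>\<omega>. of_bool (snd (obs 0 \<omega>)) :: real) = expectation (\<lambda>\<omega>. of_bool (snd (obs i \<omega>)))"
        by (rule integral_cong_distr[OF _ _ iid_distr[OF m, symmetric], where g="\<lambda>r. r"]) measurable
      then show ?thesis by (simp add: proj)
    qed
    finally show ?thesis by (simp add: E_miss)
  qed
  have E_compl: "expectation (\<lambda>\<omega>. of_bool (\<not> miss i \<omega>)) = 1 - p" for i
  proof -
    have "expectation (\<lambda>\<omega>. of_bool (\<not> miss i \<omega>)) = expectation (\<lambda>\<omega>. 1 - of_bool (miss i \<omega>))"
      by (rule Bochner_Integration.integral_cong) auto
    also have "\<dots> = 1 - p"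
      using intm E_miss prob_miss by (subst Bochner_Integration.integral_diff) (auto simp: prob_space)
    finally show ?thesis .
  qed
  have compl_ev: "complete_event M (miss i) = space M - missing_event M (miss i)" for i
    by (auto simp: complete_event_def missing_event_def)
  have compl_ev_sets[measurable]: "complete_event M (miss i) \<in> events" for i
    unfolding compl_ev by measurable
  have prob_compl: "prob (complete_event M (miss i)) = 1 - p" for i
    unfolding compl_ev using prob_compl[OF miss_ev] prob_miss by simp

  \<comment> \<open>Moments of one observation and centring over complete observations\<close>
  have x4: "integrable M (\<lambda>\<omega>. of_bool (\<not> miss i \<omega>) * x i \<omega> ^ 4)" for i
    \<comment> \<open>\<open>Suc i\<close> is the smallest sample size that includes observation
      \<open>i\<close>. Where that observation is complete, its imputed value is \<open>x i\<close>;
      elsewhere the weight is 0.\<close>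
    by (rule Bochner_Integration.integrable_bound[OF imputed_moment[of i "Suc i"]])
      (auto simp: imputed_def)
  note moments = RI_moments[OF y x Z u v miss model_y model_x y_moment Z_moment x4, unfolded prob_compl]
  have ign: "MCAR M (y i) (x i) (Z i) (miss i) \<or> integrable M (\<lambda>\<omega>. (u i \<omega>)\<^sup>2 *\<^sub>R outer (Z i \<omega>) (Z i \<omega>))" for i
    using ignorable by blast
  have Iu: "integrable M (\<lambda>\<omega>. (u i \<omega>)\<^sup>2 * (norm (Z i \<omega>))\<^sup>2)"
    and Iv0: "integrable M (\<lambda>\<omega>. of_bool (\<not> miss i \<omega>) * (v i \<omega>)\<^sup>2 * (norm (Z i \<omega>))\<^sup>2)"
    and Iv: "\<beta> \<noteq> 0 \<Longrightarrow> integrable M (\<lambda>\<omega>. (v i \<omega>)\<^sup>2 * (norm (Z i \<omega>))\<^sup>2)" for i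
    by (rule moments; use ign p_less in auto)+
  have int_vZ: "integrable M (\<lambda>\<omega>. v i \<omega> *\<^sub>R Z i \<omega>)" and E_vZ: "expectation (\<lambda>\<omega>. v i \<omega> *\<^sub>R Z i \<omega>) = 0"
    and int_uZ: "integrable M (\<lambda>\<omega>. u i \<omega> *\<^sub>R Z i \<omega>)" and E_uZ: "expectation (\<lambda>\<omega>. u i \<omega> *\<^sub>R Z i \<omega>) = 0"
    and int_ZZ: "integrable M (\<lambda>\<omega>. outer (Z i \<omega>) (Z i \<omega>))" and E_ZZ: "expectation (\<lambda>\<omega>. outer (Z i \<omega>) (Z i \<omega>)) = QZZ"
    for i
    using Zu_mean[of i] Zv_mean[of i] ZZ_mean[of i] by (auto simp: has_bochner_integral_iff)
  have int_cvZ: "integrable M (\<lambda>\<omega>. (of_bool (\<not> miss i \<omega>) * v i \<omega>) *\<^sub>R Z i \<omega>)" for i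
    by (rule Bochner_Integration.integrable_bound[OF int_vZ[of i]]) auto
  have int_cZZ: "integrable M (\<lambda>\<omega>. of_bool (\<not> miss i \<omega>) *\<^sub>R outer (Z i \<omega>) (Z i \<omega>))" for i
    by (rule Bochner_Integration.integrable_bound[OF int_ZZ[of i]]) auto
  have int_mZZ: "integrable M (\<lambda>\<omega>. of_bool (miss i \<omega>) *\<^sub>R outer (Z i \<omega>) (Z i \<omega>))" for i
    by (rule Bochner_Integration.integrable_bound[OF int_ZZ[of i]]) auto
  \<comment> \<open>Under MCAR the indicator factors out of the expectation. In the other
    alternative the condition comes with the hypothesis: \<open>MAR\<close> lets missingness depend
    on \<open>y\<close>, hence possibly on \<open>v\<close>, and such selection can shift the mean
    of \<open>Z v\<close>.\<close>
  have E_cvZ: "expectation (\<lambda>\<omega>. (of_bool (\<not> miss i \<omega>) * v i \<omega>) *\<^sub>R Z i \<omega>) = 0" for i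
    using ignorable
  proof
    assume "\<forall>i. MCAR M (y i) (x i) (Z i) (miss i)"
    then have mcar: "MCAR M (y i) (x i) (Z i) (miss i)" ..
    define f where "f t = (fst (snd t) - snd (snd t) \<bullet> \<pi>) *\<^sub>R snd (snd t)" for t :: "real \<times> real \<times> (real^'L)"
    have f[measurable]: "f \<in> borel_measurable borel"
      unfolding f_def[abs_def] by (intro borel_measurable_continuous_onI continuous_intros)
    have vf: "v i \<omega> *\<^sub>R Z i \<omega> = f (y i \<omega>, x i \<omega>, Z i \<omega>)" if "\<omega> \<in> space M" for \<omega>
      using model_x[OF that] by (simp add: f_def)
    have int: "integrable M (\<lambda>\<omega>. f (y i \<omega>, x i \<omega>, Z i \<omega>))"
      using int_vZ[of i] by (simp add: vf cong: Bochner_Integration.integrable_cong)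
    have "expectation (\<lambda>\<omega>. (of_bool (\<not> miss i \<omega>) * v i \<omega>) *\<^sub>R Z i \<omega>) =
        expectation (\<lambda>\<omega>. of_bool (\<not> miss i \<omega>) *\<^sub>R f (y i \<omega>, x i \<omega>, Z i \<omega>))"
      by (rule Bochner_Integration.integral_cong) (auto simp: vf[symmetric])
    also have "\<dots> = (1 - p) *\<^sub>R expectation (\<lambda>\<omega>. f (y i \<omega>, x i \<omega>, Z i \<omega>))"
      by (subst MCAR_expectation[OF mcar y x Z miss f int]) (simp add: E_compl)
    also have "expectation (\<lambda>\<omega>. f (y i \<omega>, x i \<omega>, Z i \<omega>)) = expectation (\<lambda>\<omega>. v i \<omega> *\<^sub>R Z i \<omega>)"
      by (rule Bochner_Integration.integral_cong) (auto simp: vf)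
    finally show ?thesis by (simp add: E_vZ)
  next
    assume "\<forall>i. MAR M (y i) (x i) (Z i) (miss i) \<and>
             expectation_on M (complete_event M (miss i)) (\<lambda>\<omega>. v i \<omega> *\<^sub>R Z i \<omega>) = 0 \<and>
             integrable M (\<lambda>\<omega>. (u i \<omega>)\<^sup>2 *\<^sub>R outer (Z i \<omega>) (Z i \<omega>)) \<and>
             invertible Q0"
    then have "expectation_on M (complete_event M (miss i)) (\<lambda>\<omega>. v i \<omega> *\<^sub>R Z i \<omega>) = 0" by blast
    then have "0 = expectation (\<lambda>\<omega>. indicator (complete_event M (miss i)) \<omega> *\<^sub>R (v i \<omega> *\<^sub>R Z i \<omega>))"
      using scaleR_expectation_on[OF compl_ev_sets, of "\<lambda>\<omega>. v i \<omega> *\<^sub>R Z i \<omega>" i] by simp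
    also have "\<dots> = expectation (\<lambda>\<omega>. (of_bool (\<not> miss i \<omega>) * v i \<omega>) *\<^sub>R Z i \<omega>)"
      by (rule Bochner_Integration.integral_cong) (auto simp: complete_event_def indicator_def)
    finally show ?thesis by simp
  qed

  \<comment> \<open>Probability limits of the Gram and cross moments\<close>
  define H0 where "H0 = expectation (\<lambda>\<omega>. of_bool (\<not> miss 0 \<omega>) *\<^sub>R outer (Z 0 \<omega>) (Z 0 \<omega>))"
  define H1 where "H1 = expectation (\<lambda>\<omega>. of_bool (miss 0 \<omega>) *\<^sub>R outer (Z 0 \<omega>) (Z 0 \<omega>))"
  have Z_sq: "integrable M (\<lambda>\<omega>. (norm (outer (Z i \<omega>) (Z i \<omega>)))\<^sup>2)" for i
    using Z_moment[of i] by (simp add: norm_outer power_mult_distrib flip: power_add)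
  have conv_G0: "conv_in_prob M (\<lambda>n \<omega>. (1 / real n) *\<^sub>R gram (complete_obs n (\<lambda>i. miss i \<omega>)) (\<lambda>i. Z i \<omega>)) H0"
  proof -
    have "conv_in_prob M (\<lambda>n \<omega>. (1 / real n) *\<^sub>R (\<Sum>i<n. of_bool (\<not> snd (obs i \<omega>)) *\<^sub>R outer (pz (obs i \<omega>)) (pz (obs i \<omega>))))
       (expectation (\<lambda>\<omega>. of_bool (\<not> snd (obs 0 \<omega>)) *\<^sub>R outer (pz (obs 0 \<omega>)) (pz (obs 0 \<omega>))))"
    proof (rule wlln)
      show "integrable M (\<lambda>\<omega>. (norm (of_bool (\<not> snd (obs 0 \<omega>)) *\<^sub>R outer (pz (obs 0 \<omega>)) (pz (obs 0 \<omega>))))\<^sup>2)"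
        unfolding proj by (rule Bochner_Integration.integrable_bound[OF Z_sq[of 0]]) auto
    qed measurable
    then show ?thesis by (simp add: proj gram_complete_obs H0_def)
  qed
  have conv_G1: "conv_in_prob M (\<lambda>n \<omega>. (1 / real n) *\<^sub>R gram (incomplete_obs n (\<lambda>i. miss i \<omega>)) (\<lambda>i. Z i \<omega>)) H1"
  proof -
    have "conv_in_prob M (\<lambda>n \<omega>. (1 / real n) *\<^sub>R (\<Sum>i<n. of_bool (snd (obs i \<omega>)) *\<^sub>R outer (pz (obs i \<omega>)) (pz (obs i \<omega>))))
       (expectation (\<lambda>\<omega>. of_bool (snd (obs 0 \<omega>)) *\<^sub>R outer (pz (obs 0 \<omega>)) (pz (obs 0 \<omega>))))"
    proof (rule wlln)
      show "integrable M (\<lambda>\<omega>. (norm (of_bool (snd (obs 0 \<omega>)) *\<^sub>R outer (pz (obs 0 \<omega>)) (pz (obs 0 \<omega>))))\<^sup>2)"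
        unfolding proj by (rule Bochner_Integration.integrable_bound[OF Z_sq[of 0]]) auto
    qed measurable
    then show ?thesis by (simp add: proj gram_incomplete_obs H1_def)
  qed
  \<comment> \<open>The limit has no noise part because \<open>Z v\<close> has mean 0 over complete
    observations; this is the consistency of the complete-case first stage.\<close>
  have conv_g: "conv_in_prob M (\<lambda>n \<omega>. (1 / real n) *\<^sub>R cross (complete_obs n (\<lambda>i. miss i \<omega>)) (\<lambda>i. Z i \<omega>) (\<lambda>i. x i \<omega>)) (H0 *v \<pi>)"
  proof -
    have "conv_in_prob M (\<lambda>n \<omega>. (1 / real n) *\<^sub>R (\<Sum>i<n. (of_bool (\<not> snd (obs i \<omega>)) * px (obs i \<omega>)) *\<^sub>R pz (obs i \<omega>)))
       (expectation (\<lambda>\<omega>. (of_bool (\<not> snd (obs 0 \<omega>)) * px (obs 0 \<omega>)) *\<^sub>R pz (obs 0 \<omega>)))"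
    proof (rule wlln)
      have "integrable M (\<lambda>\<omega>. of_bool (\<not> miss 0 \<omega>) * (x 0 \<omega>)\<^sup>2 * (norm (Z 0 \<omega>))\<^sup>2)"
        by (rule integrable_square_mult_norm[OF _ _ _ _ _ x4 Z_moment]) auto
      then show "integrable M (\<lambda>\<omega>. (norm ((of_bool (\<not> snd (obs 0 \<omega>)) * px (obs 0 \<omega>)) *\<^sub>R pz (obs 0 \<omega>)))\<^sup>2)"
        unfolding proj by (rule Bochner_Integration.integrable_bound) (auto simp: power_mult_distrib)
    qed measurable
    moreover have "expectation (\<lambda>\<omega>. (of_bool (\<not> miss 0 \<omega>) * x 0 \<omega>) *\<^sub>R Z 0 \<omega>) = H0 *v \<pi>"
    proof -
      have "expectation (\<lambda>\<omega>. (of_bool (\<not> miss 0 \<omega>) * x 0 \<omega>) *\<^sub>R Z 0 \<omega>) =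
          expectation (\<lambda>\<omega>. (of_bool (\<not> miss 0 \<omega>) *\<^sub>R outer (Z 0 \<omega>) (Z 0 \<omega>)) *v \<pi> + (of_bool (\<not> miss 0 \<omega>) * v 0 \<omega>) *\<^sub>R Z 0 \<omega>)"
        by (rule Bochner_Integration.integral_cong)
          (auto simp: model_x scaleR_matrix_vector_assoc[symmetric] outer_mult_vec algebra_simps)
      also have "\<dots> = expectation (\<lambda>\<omega>. (of_bool (\<not> miss 0 \<omega>) *\<^sub>R outer (Z 0 \<omega>) (Z 0 \<omega>)) *v \<pi>)"
        using int_cvZ[of 0] integrable_bounded_linear[OF bounded_linear_matrix_mult_vec int_cZZ[of 0]]
        by (subst Bochner_Integration.integral_add) (auto simp: E_cvZ)
      also have "\<dots> = H0 *v \<pi>"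
        unfolding H0_def by (rule integral_bounded_linear[OF bounded_linear_matrix_mult_vec int_cZZ])
      finally show ?thesis .
    qed
    ultimately show ?thesis by (simp add: proj cross_complete_obs)
  qed
  have meas_G0[measurable]: "(\<lambda>\<omega>. gram (complete_obs n (\<lambda>i. miss i \<omega>)) (\<lambda>i. Z i \<omega>)) \<in> borel_measurable M" for n
    unfolding gram_complete_obs by measurable
  have meas_G1[measurable]: "(\<lambda>\<omega>. gram (incomplete_obs n (\<lambda>i. miss i \<omega>)) (\<lambda>i. Z i \<omega>)) \<in> borel_measurable M" for n
    unfolding gram_incomplete_obs by measurable
  have meas_G[measurable]: "(\<lambda>\<omega>. gram {..<n} (\<lambda>i. Z i \<omega>)) \<in> borel_measurable M" for n
    unfolding gram_def by measurable
  have meas_g[measurable]: "(\<lambda>\<omega>. cross (complete_obs n (\<lambda>i. miss i \<omega>)) (\<lambda>i. Z i \<omega>) (\<lambda>i. x i \<omega>)) \<in> borel_measurable M" for n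
    unfolding cross_complete_obs by measurable

  \<comment> \<open>Scaling, symmetry and invertibility of the group limits\<close>
  have H0: "H0 = (1 - p) *\<^sub>R Q0"
  proof (rule normalized_gram_limit[OF _ meas_G0 _ Q0_plim conv_G0])
    have "conv_in_prob M (\<lambda>n \<omega>. (1 / real n) *\<^sub>R (\<Sum>i<n. of_bool (\<not> snd (obs i \<omega>))))
        (expectation (\<lambda>\<omega>. of_bool (\<not> snd (obs 0 \<omega>)) :: real))"
    proof (rule wlln)
      show "integrable M (\<lambda>\<omega>. (norm (of_bool (\<not> snd (obs 0 \<omega>)) :: real))\<^sup>2)"
        by (rule integrable_const_bound[of _ 1]) auto
    qed measurable
    then show "conv_in_prob M (\<lambda>n \<omega>. real (card (complete_obs n (\<lambda>i. miss i \<omega>))) / real n) (1 - p)"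
      by (simp add: proj card_complete_obs E_compl)
  qed (simp add: card_complete_obs)
  have H1: "H1 = p *\<^sub>R Q1"
    by (rule normalized_gram_limit[OF _ meas_G1 p_plim Q1_plim conv_G1]) (simp add: card_incomplete_obs)
  have sum_H: "QZZ = H0 + H1"
  proof -
    have "H0 + H1 = expectation (\<lambda>\<omega>. of_bool (\<not> miss 0 \<omega>) *\<^sub>R outer (Z 0 \<omega>) (Z 0 \<omega>) + of_bool (miss 0 \<omega>) *\<^sub>R outer (Z 0 \<omega>) (Z 0 \<omega>))"
      unfolding H0_def H1_def using int_cZZ int_mZZ by (subst Bochner_Integration.integral_add) auto
    also have "\<dots> = expectation (\<lambda>\<omega>. outer (Z 0 \<omega>) (Z 0 \<omega>))"
      by (rule Bochner_Integration.integral_cong) auto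
    finally show ?thesis by (simp add: E_ZZ)
  qed
  have sym_H0: "transpose H0 = H0"
    unfolding H0_def using int_cZZ[of 0]
    by (subst integral_bounded_linear[OF bounded_linear_transpose, symmetric]) (auto simp: transpose_scalar transpose_outer)
  have sym_H1: "transpose H1 = H1"
    unfolding H1_def using int_mZZ[of 0]
    by (subst integral_bounded_linear[OF bounded_linear_transpose, symmetric]) (auto simp: transpose_scalar transpose_outer)
  have sym_QZZ: "transpose QZZ = QZZ"
    unfolding E_ZZ[of 0, symmetric] using int_ZZ[of 0]
    by (subst integral_bounded_linear[OF bounded_linear_transpose, symmetric]) (auto simp: transpose_outer)
  have sym_Q0: "transpose Q0 = Q0"
    using sym_H0 p_less by (simp add: H0 transpose_scalar)
  \<comment> \<open>Symmetry is read off from \<open>H1\<close>, which determines \<open>Q1\<close>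
    only up to the factor \<open>p\<close>.\<close>
  have sym_Q1: "p *\<^sub>R transpose Q1 = p *\<^sub>R Q1"
    using sym_H1 by (simp add: H1 transpose_scalar)
  \<comment> \<open>Under MCAR the complete observations have the population second moments, so
    \<open>Q0\<close> is \<open>QZZ\<close>; the other alternative supplies invertibility
    directly.\<close>
  have Q0_inv: "invertible Q0"
    using ignorable
  proof
    assume "\<forall>i. MCAR M (y i) (x i) (Z i) (miss i)"
    then have mcar: "MCAR M (y 0) (x 0) (Z 0) (miss 0)" ..
    define f where "f t = outer (snd (snd t)) (snd (snd t))" for t :: "real \<times> real \<times> (real^'L)"
    have f[measurable]: "f \<in> borel_measurable borel"
      unfolding f_def[abs_def] by (intro borel_measurable_outer borel_measurable_continuous_onI continuous_intros)
    have "H0 = (1 - p) *\<^sub>R QZZ"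
      using MCAR_expectation[OF mcar y x Z miss f] int_ZZ[of 0]
      by (simp add: f_def E_compl E_ZZ H0_def)
    then have "Q0 = QZZ" using p_less by (simp add: H0)
    then show ?thesis using QZZ_full_rank by simp
  qed blast
  have H0_inv: "invertible H0"
    unfolding H0 using p_less Q0_inv by (intro scalar_invertible) auto

  \<comment> \<open>Limits of the random coefficients\<close>
  have QZx: "QZx = QZZ *v \<pi>"
  proof -
    have "QZx = expectation (\<lambda>\<omega>. x 0 \<omega> *\<^sub>R Z 0 \<omega>)"
      using Zx_mean[of 0] by (simp add: has_bochner_integral_iff)
    also have "\<dots> = expectation (\<lambda>\<omega>. outer (Z 0 \<omega>) (Z 0 \<omega>) *v \<pi> + v 0 \<omega> *\<^sub>R Z 0 \<omega>)"
      by (rule Bochner_Integration.integral_cong) (auto simp: model_x outer_mult_vec algebra_simps)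
    also have "\<dots> = expectation (\<lambda>\<omega>. outer (Z 0 \<omega>) (Z 0 \<omega>) *v \<pi>)"
      using int_vZ[of 0] integrable_bounded_linear[OF bounded_linear_matrix_mult_vec int_ZZ[of 0]]
      by (subst Bochner_Integration.integral_add) (auto simp: E_vZ)
    also have "\<dots> = QZZ *v \<pi>"
      unfolding E_ZZ[of 0, symmetric] by (rule integral_bounded_linear[OF bounded_linear_matrix_mult_vec int_ZZ])
    finally show ?thesis .
  qed
  have inv_QZx: "matrix_inv QZZ *v QZx = \<pi>"
    by (simp add: QZx matrix_vector_mul_assoc matrix_inv_left QZZ_full_rank)
  \<comment> \<open>The observed part tends to \<open>H0 *v \<pi>\<close> and the imputed part to
    \<open>(QZZ - H0) *v \<pi>\<close>. Together they give the limit for fully observed data, which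
    is why outside \<Omega> the variance involves only \<open>QZx\<close> and
    \<open>QZZ\<close>.\<close>
  have moment_lim: "imputed_cross_moment QZZ H0 (H0 *v \<pi>) = QZx"
  proof -
    have "(QZZ - H0) ** matrix_inv H0 *v (H0 *v \<pi>) = (QZZ - H0) *v ((matrix_inv H0 ** H0) *v \<pi>)"
      by (simp add: matrix_vector_mul_assoc matrix_mul_assoc)
    then show ?thesis
      by (simp add: imputed_cross_moment_def matrix_inv_left H0_inv QZx matrix_vector_mult_diff_rdistrib)
  qed
  define d where "d = QZx \<bullet> (matrix_inv QZZ *v QZx)"
  have form_lim: "first_stage_form QZZ H0 (H0 *v \<pi>) = d"
    by (simp add: first_stage_form_def moment_lim d_def)
  \<comment> \<open>\<open>d\<close> is the second moment of \<open>\<pi> \<bullet> Z 0\<close>.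
    Were it 0, this variable would vanish almost surely, and so would \<open>QZZ *v \<pi>\<close>,
    which is \<open>QZx\<close>.\<close>
  have d_nz: "d \<noteq> 0"
  proof
    assume "d = 0"
    moreover have "d = \<pi> \<bullet> (QZZ *v \<pi>)"
      unfolding d_def inv_QZx unfolding QZx by (rule inner_commute)
    moreover have "\<pi> \<bullet> (QZZ *v \<pi>) = expectation (\<lambda>\<omega>. (\<pi> \<bullet> Z 0 \<omega>)\<^sup>2)"
      using quadratic_form_integral_outer[of M "\<lambda>_. 1" "Z 0" \<pi> \<pi>] int_ZZ[of 0] E_ZZ[of 0]
      by (simp add: power2_eq_square)
    moreover have "integrable M (\<lambda>\<omega>. (\<pi> \<bullet> Z 0 \<omega>)\<^sup>2)"
      using integrable_bounded_linear[OF bounded_linear_quadratic_form int_ZZ[of 0], of \<pi> \<pi>]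
      by (simp add: outer_mult_vec power2_eq_square inner_commute)
    ultimately have "AE \<omega> in M. (\<pi> \<bullet> Z 0 \<omega>)\<^sup>2 = 0"
      by (subst integral_nonneg_eq_0_iff_AE[symmetric]) auto
    then have "AE \<omega> in M. outer (Z 0 \<omega>) (Z 0 \<omega>) *v \<pi> = 0"
      by (auto simp: outer_mult_vec inner_commute)
    then have "expectation (\<lambda>\<omega>. outer (Z 0 \<omega>) (Z 0 \<omega>) *v \<pi>) = expectation (\<lambda>_. 0)"
      by (intro integral_cong_AE) auto
    then have "QZZ *v \<pi> = 0"
      unfolding E_ZZ[of 0, symmetric] by (simp add: integral_bounded_linear[OF bounded_linear_matrix_mult_vec int_ZZ])
    then show False using QZx QZx_nonzero by simp
  qed
  define c where "c = inverse d *\<^sub>R (matrix_inv QZZ *v QZx)"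
  define A where "A = (p *\<^sub>R Q1) ** matrix_inv ((1 - p) *\<^sub>R Q0)"
  have c_lim: "score_coeff QZZ H0 (H0 *v \<pi>) = c"
  proof -
    have "QZx v* matrix_inv QZZ = transpose (matrix_inv QZZ) *v QZx" by simp
    also have "\<dots> = matrix_inv QZZ *v QZx"
      by (simp only: transpose_matrix_inv[OF QZZ_full_rank] sym_QZZ)
    finally show ?thesis by (simp add: score_coeff_def form_lim moment_lim c_def)
  qed
  have coeffs_lim: "RI_coeffs \<beta> QZZ H0 (H0 *v \<pi>) = (c, (- \<beta>) *\<^sub>R (c v* A))"
  proof -
    have "QZZ - H0 = p *\<^sub>R Q1" using sum_H H1 by simp
    then show ?thesis by (simp only: RI_coeffs_def c_lim A_def H0[symmetric])
  qed

  \<comment> \<open>Convergence in probability of the coefficients\<close>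
  define G where "G n \<omega> = (1 / real n) *\<^sub>R gram {..<n} (\<lambda>i. Z i \<omega>)" for n \<omega>
  define G0 where "G0 n \<omega> = (1 / real n) *\<^sub>R gram (complete_obs n (\<lambda>i. miss i \<omega>)) (\<lambda>i. Z i \<omega>)" for n \<omega>
  define g where "g n \<omega> = (1 / real n) *\<^sub>R cross (complete_obs n (\<lambda>i. miss i \<omega>)) (\<lambda>i. Z i \<omega>) (\<lambda>i. x i \<omega>)" for n \<omega>
  have [measurable]: "G n \<in> borel_measurable M" "G0 n \<in> borel_measurable M" "g n \<in> borel_measurable M" for n
    unfolding G_def[abs_def] G0_def[abs_def] g_def[abs_def] by measurable
  have conv3: "conv_in_prob M (\<lambda>n \<omega>. (G n \<omega>, G0 n \<omega>, g n \<omega>)) (QZZ, H0, H0 *v \<pi>)"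
    using ZZ_plim conv_G0 conv_g unfolding G_def[symmetric] G0_def[symmetric] g_def[symmetric]
    by (intro conv_in_prob_Pair) auto
  have conv_form: "conv_in_prob M (\<lambda>n \<omega>. first_stage_form (G n \<omega>) (G0 n \<omega>) (g n \<omega>)) d"
  proof -
    have "isCont (\<lambda>t. first_stage_form (fst t) (fst (snd t)) (snd (snd t))) (QZZ, H0, H0 *v \<pi>)"
      unfolding isCont_def using tendsto_first_stage_form[OF QZZ_full_rank H0_inv] by simp
    from conv_in_prob_isCont[OF conv3 _ this] show ?thesis by (simp add: form_lim)
  qed
  have conv_B: "conv_in_prob M (\<lambda>n \<omega>. RI_coeffs \<beta> (G n \<omega>) (G0 n \<omega>) (g n \<omega>)) (c, (- \<beta>) *\<^sub>R (c v* A))"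
    using conv_in_prob_isCont[OF conv3 _ isCont_RI_coeffs[OF QZZ_full_rank H0_inv, of "H0 *v \<pi>" \<beta>]]
    by (simp add: form_lim d_nz coeffs_lim)

  \<comment> \<open>Second moment and mean of the stacked score\<close>
  define w where "w t = ((py t - px t * \<beta> + \<beta> * of_bool (snd t) * (px t - pz t \<bullet> \<pi>)) *\<^sub>R pz t,
      (of_bool (\<not> snd t) * (px t - pz t \<bullet> \<pi>)) *\<^sub>R pz t)" for t
  have w[measurable]: "w \<in> borel_measurable ?N"
    unfolding w_def[abs_def] by measurable
  \<comment> \<open>\<open>w\<close> is defined on the coordinates of \<open>obs i\<close> so that
    it inherits the i.i.d. property; on the sample space the model equations turn the residuals back
    into \<open>u\<close> and \<open>v\<close>.\<close>
  have w_eq: "w (obs i \<omega>) = ((u i \<omega> + \<beta> * of_bool (miss i \<omega>) * v i \<omega>) *\<^sub>R Z i \<omega>, (of_bool (\<not> miss i \<omega>) * v i \<omega>) *\<^sub>R Z i \<omega>)"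
    if "\<omega> \<in> space M" for i \<omega>
    using model_y[OF that] model_x[OF that] by (simp add: w_def proj)
  have sq_w: "integrable M (\<lambda>\<omega>. (norm (w (obs 0 \<omega>)))\<^sup>2)"
  proof (rule Bochner_Integration.integrable_bound)
    \<comment> \<open>The factor \<open>\<beta>\<^sup>2\<close> stays inside the integrand, which is
      then 0 when \<beta> is 0 even if \<open>v\<close> has no second moment.\<close>
    have "integrable M (\<lambda>\<omega>. \<beta>\<^sup>2 * ((v 0 \<omega>)\<^sup>2 * (norm (Z 0 \<omega>))\<^sup>2))"
      using Iv[of 0] by (cases "\<beta> = 0") auto
    then show "integrable M (\<lambda>\<omega>. 2 * ((u 0 \<omega>)\<^sup>2 * (norm (Z 0 \<omega>))\<^sup>2) + 2 * (\<beta>\<^sup>2 * ((v 0 \<omega>)\<^sup>2 * (norm (Z 0 \<omega>))\<^sup>2))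
        + of_bool (\<not> miss 0 \<omega>) * (v 0 \<omega>)\<^sup>2 * (norm (Z 0 \<omega>))\<^sup>2)"
      using Iu[of 0] Iv0[of 0] by simp
    show "AE \<omega> in M. norm ((norm (w (obs 0 \<omega>)))\<^sup>2) \<le> norm (2 * ((u 0 \<omega>)\<^sup>2 * (norm (Z 0 \<omega>))\<^sup>2)
        + 2 * (\<beta>\<^sup>2 * ((v 0 \<omega>)\<^sup>2 * (norm (Z 0 \<omega>))\<^sup>2)) + of_bool (\<not> miss 0 \<omega>) * (v 0 \<omega>)\<^sup>2 * (norm (Z 0 \<omega>))\<^sup>2)"
    proof (rule AE_I2)
      fix \<omega> assume \<omega>: "\<omega> \<in> space M"
      let ?u = "u 0 \<omega>" and ?v = "v 0 \<omega>" and ?m = "of_bool (miss 0 \<omega>) :: real" and ?z = "(norm (Z 0 \<omega>))\<^sup>2"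
      have "(?u + \<beta> * ?m * ?v)\<^sup>2 \<le> 2 * ?u\<^sup>2 + 2 * (\<beta>\<^sup>2 * ?v\<^sup>2)"
      proof (cases "miss 0 \<omega>")
        case True
        then show ?thesis
          using zero_le_power2[of "?u - \<beta> * ?v"] by (simp add: power2_eq_square algebra_simps)
      next
        case False
        then show ?thesis
          using zero_le_power2[of ?u] zero_le_power2[of "\<beta> * ?v"] by (simp add: power_mult_distrib)
      qed
      then have "(?u + \<beta> * ?m * ?v)\<^sup>2 * ?z \<le> (2 * ?u\<^sup>2 + 2 * (\<beta>\<^sup>2 * ?v\<^sup>2)) * ?z"
        by (rule mult_right_mono) simp
      moreover have "(norm (w (obs 0 \<omega>)))\<^sup>2 = (?u + \<beta> * ?m * ?v)\<^sup>2 * ?z + of_bool (\<not> miss 0 \<omega>) * ?v\<^sup>2 * ?z"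
        by (simp add: w_eq[OF \<omega>] norm_Pair power_mult_distrib)
      ultimately have "(norm (w (obs 0 \<omega>)))\<^sup>2 \<le> 2 * (?u\<^sup>2 * ?z) + 2 * (\<beta>\<^sup>2 * (?v\<^sup>2 * ?z)) + of_bool (\<not> miss 0 \<omega>) * ?v\<^sup>2 * ?z"
        by (simp add: distrib_right mult.assoc)
      then show "norm ((norm (w (obs 0 \<omega>)))\<^sup>2) \<le> norm (2 * (?u\<^sup>2 * ?z) + 2 * (\<beta>\<^sup>2 * (?v\<^sup>2 * ?z)) + of_bool (\<not> miss 0 \<omega>) * ?v\<^sup>2 * ?z)"
        by simp
    qed
  qed measurable
  have mean_w: "expectation (\<lambda>\<omega>. w (obs 0 \<omega>)) = 0"
  proof (rule prod_eqI)
    have int_w: "integrable M (\<lambda>\<omega>. w (obs 0 \<omega>))"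
      by (rule integrable_if_norm_sq[OF _ sq_w]) measurable
    have "fst (expectation (\<lambda>\<omega>. w (obs 0 \<omega>))) = expectation (\<lambda>\<omega>. fst (w (obs 0 \<omega>)))"
      by (rule integral_bounded_linear[OF bounded_linear_fst int_w, symmetric])
    \<comment> \<open>The missingness indicator is replaced by 1 minus its complement, so that only
      the means already known to vanish occur.\<close>
    also have "\<dots> = expectation (\<lambda>\<omega>. u 0 \<omega> *\<^sub>R Z 0 \<omega> + \<beta> *\<^sub>R (v 0 \<omega> *\<^sub>R Z 0 \<omega> - (of_bool (\<not> miss 0 \<omega>) * v 0 \<omega>) *\<^sub>R Z 0 \<omega>))"
      by (rule Bochner_Integration.integral_cong) (auto simp: w_eq algebra_simps)
    also have "\<dots> = 0"
      using int_uZ[of 0] int_vZ[of 0] int_cvZ[of 0] by (simp add: E_uZ E_vZ E_cvZ)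
    finally show "fst (expectation (\<lambda>\<omega>. w (obs 0 \<omega>))) = fst 0" by simp
    have "snd (expectation (\<lambda>\<omega>. w (obs 0 \<omega>))) = expectation (\<lambda>\<omega>. snd (w (obs 0 \<omega>)))"
      by (rule integral_bounded_linear[OF bounded_linear_snd int_w, symmetric])
    also have "\<dots> = expectation (\<lambda>\<omega>. (of_bool (\<not> miss 0 \<omega>) * v 0 \<omega>) *\<^sub>R Z 0 \<omega>)"
      by (rule Bochner_Integration.integral_cong) (auto simp: w_eq)
    finally show "snd (expectation (\<lambda>\<omega>. w (obs 0 \<omega>))) = snd 0" by (simp add: E_cvZ)
  qed

  \<comment> \<open>Exact error formula outside events of vanishing probability\<close>
  let ?T = "\<lambda>n \<omega>. sqrt (real n) *
      (beta_RI n (\<lambda>i. y i \<omega>) (\<lambda>i. x i \<omega>) (\<lambda>i. Z i \<omega>) (\<lambda>i. miss i \<omega>) - \<beta>)"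
  let ?S = "\<lambda>n \<omega>. RI_coeffs \<beta> (G n \<omega>) (G0 n \<omega>) (g n \<omega>) \<bullet> ((1 / sqrt (real n)) *\<^sub>R (\<Sum>i<n. w (obs i \<omega>)))"
  have meas_T[measurable]: "?T n \<in> borel_measurable M" for n
    using borel_measurable_beta_RI[OF y x Z miss] by measurable
  have bad: "(\<lambda>n. prob {\<omega> \<in> space M. ?T n \<omega> \<noteq> ?S n \<omega>}) \<longlonglongrightarrow> 0"
  proof -
    let ?I = "{A :: real^'L^'L. invertible A}"
    have [measurable]: "?I \<in> sets borel" using open_invertible by (rule borel_open)
    let ?A = "\<lambda>n. {\<omega> \<in> space M. G n \<omega> \<notin> ?I}"
    let ?B = "\<lambda>n. {\<omega> \<in> space M. G0 n \<omega> \<notin> ?I}"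
    let ?C = "\<lambda>n. {\<omega> \<in> space M. first_stage_form (G n \<omega>) (G0 n \<omega>) (g n \<omega>) \<notin> - {0}}"
    have [measurable]: "?A n \<in> events" "?B n \<in> events" "?C n \<in> events" for n
      by measurable
    have "(\<lambda>n. prob (?A n)) \<longlonglongrightarrow> 0"
      using ZZ_plim QZZ_full_rank unfolding G_def[symmetric]
      by (intro conv_in_prob_imp_prob_not_in[OF _ _ open_invertible]) auto
    moreover have "(\<lambda>n. prob (?B n)) \<longlonglongrightarrow> 0"
      using conv_G0 H0_inv unfolding G0_def[symmetric]
      by (intro conv_in_prob_imp_prob_not_in[OF _ _ open_invertible]) auto
    moreover have "(\<lambda>n. prob (?C n)) \<longlonglongrightarrow> 0"
      using d_nz by (intro conv_in_prob_imp_prob_not_in[OF conv_form]) (auto simp: open_delete)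
    ultimately have lim: "(\<lambda>n. prob (?A n) + prob (?B n) + prob (?C n)) \<longlonglongrightarrow> 0"
      by (auto intro!: tendsto_eq_intros)
    have "prob {\<omega> \<in> space M. ?T n \<omega> \<noteq> ?S n \<omega>} \<le> prob (?A n) + prob (?B n) + prob (?C n)" if n: "n > 0" for n
    proof -
      have "{\<omega> \<in> space M. ?T n \<omega> \<noteq> ?S n \<omega>} \<subseteq> (?A n \<union> ?B n) \<union> ?C n"
      proof (rule subsetI, rule ccontr)
        fix \<omega> assume "\<omega> \<in> {\<omega> \<in> space M. ?T n \<omega> \<noteq> ?S n \<omega>}" and ok: "\<omega> \<notin> (?A n \<union> ?B n) \<union> ?C n"
        then have \<omega>: "\<omega> \<in> space M" and ne: "?T n \<omega> \<noteq> ?S n \<omega>"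
          by auto
        have inv: "invertible (G n \<omega>)" "invertible (G0 n \<omega>)"
            "first_stage_form (G n \<omega>) (G0 n \<omega>) (g n \<omega>) \<noteq> 0"
          using ok \<omega> by auto
        have "?T n \<omega> = ?S n \<omega>"
          using beta_RI_error[where y="\<lambda>i. y i \<omega>" and x="\<lambda>i. x i \<omega>" and u="\<lambda>i. u i \<omega>" and v="\<lambda>i. v i \<omega>"
              and z="\<lambda>i. Z i \<omega>" and m="\<lambda>i. miss i \<omega>",
              OF n model_y[OF \<omega>] model_x[OF \<omega>], folded G_def G0_def g_def, OF inv]
          by (simp only: w_eq[OF \<omega>])
        then show False using ne by simp
      qed
      then have "prob {\<omega> \<in> space M. ?T n \<omega> \<noteq> ?S n \<omega>} \<le> prob ((?A n \<union> ?B n) \<union> ?C n)"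
        by (rule finite_measure_mono) measurable
      also have "\<dots> \<le> prob (?A n \<union> ?B n) + prob (?C n)"
        by (rule measure_Un_le) measurable
      also have "\<dots> \<le> prob (?A n) + prob (?B n) + prob (?C n)"
        by (intro add_right_mono measure_Un_le) measurable
      finally show ?thesis .
    qed
    then show ?thesis
      by (intro real_tendsto_sandwich[OF _ _ tendsto_const lim])
        (auto intro!: eventually_mono[OF eventually_gt_at_top[of 0]])
  qed
  have meas_B[measurable]: "(\<lambda>\<omega>. RI_coeffs \<beta> (G n \<omega>) (G0 n \<omega>) (g n \<omega>)) \<in> borel_measurable M" for n
    by measurable

  \<comment> \<open>The limit law and its variance\<close>
  have "weak_conv_m (\<lambda>n. distr M borel (?T n))
      (normal_law 0 (expectation (\<lambda>\<omega>. ((c, (- \<beta>) *\<^sub>R (c v* A)) \<bullet> w (obs 0 \<omega>))\<^sup>2)))"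
    by (rule clt_random_coefficients[OF iid_indep[OF w] iid_distr[OF w] mean_w sq_w conv_B meas_B meas_T bad])
  \<comment> \<open>The limit theorem speaks of observation 0; equality in law moves the second
    moment to the index \<open>k\<close> at which \<Omega> is evaluated.\<close>
  also have "expectation (\<lambda>\<omega>. ((c, (- \<beta>) *\<^sub>R (c v* A)) \<bullet> w (obs 0 \<omega>))\<^sup>2) =
      expectation (\<lambda>\<omega>. ((c, (- \<beta>) *\<^sub>R (c v* A)) \<bullet> w (obs k \<omega>))\<^sup>2)"
    by (rule integral_cong_distr[OF _ _ iid_distr[OF w, of k, symmetric],
        where g="\<lambda>t. ((c, (- \<beta>) *\<^sub>R (c v* A)) \<bullet> t)\<^sup>2"]) measurable
  also have "\<dots> = expectation (\<lambda>\<omega>. ((c, (- \<beta>) *\<^sub>R (c v* A)) \<bullet>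
      ((u k \<omega> + \<beta> * of_bool (miss k \<omega>) * v k \<omega>) *\<^sub>R Z k \<omega>, (of_bool (\<not> miss k \<omega>) * v k \<omega>) *\<^sub>R Z k \<omega>))\<^sup>2)"
    by (rule Bochner_Integration.integral_cong) (auto simp: w_eq)
  also have "\<dots> = c \<bullet> (Omega_RI M (u k) (v k) (Z k) (miss k) p \<beta> Q0 Q1 *v c)"
    unfolding A_def
    by (rule RI_score_variance[OF u v Z miss prob_miss p_less Iu Iv0 Iv Q0_inv sym_Q0 sym_Q1])
  also have "\<dots> = V_RI QZZ QZx (Omega_RI M (u k) (v k) (Z k) (miss k) p \<beta> Q0 Q1)"
  proof -
    \<comment> \<open>Symmetry of \<open>matrix_inv QZZ\<close> lets both outer factors of the
      sandwich be read as \<open>c\<close>, up to the scalar \<open>inverse d\<close> on each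
      side.\<close>
    have sw: "QZx \<bullet> (matrix_inv QZZ *v a) = (matrix_inv QZZ *v QZx) \<bullet> a" for a
    proof -
      have "QZx \<bullet> (matrix_inv QZZ *v a) = (transpose (matrix_inv QZZ) *v QZx) \<bullet> a"
        by (simp add: dot_lmul_matrix)
      then show ?thesis by (simp only: transpose_matrix_inv[OF QZZ_full_rank] sym_QZZ)
    qed
    show ?thesis
      unfolding V_RI_def Let_def d_def[symmetric] unfolding sw c_def
      by (simp add: matrix_vector_mult_scaleR)
  qed
  finally show ?thesis .
qed

end
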